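(* Let $M$ be a closed connected oriented smooth manifold with volume form $\Omega$, normalized by $\int_M\Omega=1$. For each closed 1-form $\alpha$ on $M$, the map $$\tau_\alpha:\mathrm{Homeo}_0(M,\Omega)\to\mathcal C(M,\mathbb R),\qquad h\mapsto\tau(h,\alpha),\qquad \tau(h,\alpha)(z)=\chi(h,\alpha)(z)=\frac{1}{\|\alpha\|_{L^2}}\int_M I_\alpha(h,z,y)\,\Omega(y),$$ induces a well-defined element $[\tau_\alpha]\in H^1(\mathrm{Homeo}_0(M,\Omega),\mathcal C(M,\mathbb R))$, and an injective group homomorphism $$\iota_0:H^1(M,\mathbb R)\to H^1(\mathrm{Homeo}_0(M,\Omega),\mathcal C(M,\mathbb R)),\qquad[\alpha]\mapsto[\tau_\alpha].$$
   Context: $\mathrm{Homeo}_0(M,\Omega)$ is the identity component ($C^0$ topology) of the group of homeomorphisms of $M$ preserving $\Omega$ (i.e. the associated measure). $\|\alpha\|_{L^2}$ is the $L^2$-norm of $\alpha$ with respect to a fixed Riemannian metric on $M$; $\chi(h,\alpha)$ and $\tau(h,\alpha)$ are introduced for non-trivial (nonzero) closed 1-forms $\alpha$. For a closed 1-form $\alpha$, $h\in\mathrm{Homeo}_0(M,\Omega)$ and $x,y\in M$, $I_\alpha(h,x,y):=\int_{h\circ\gamma}\alpha-\int_\gamma\alpha$ for a $C^1$ curve $\gamma$ from $x$ to $y$ (the value is independent of $\gamma$). $H^1(M,\mathbb R)$ is the first de Rham cohomology group of $M$. $\mathcal C(M,\mathbb R)$ is the space of continuous real functions on $M$, on which $G=\mathrm{Homeo}_0(M,\Omega)$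 acts by $h\cdot f=f\circ h$. $C^l(M,\Omega)$ is the abelian group of all functions $F:G^l\to\mathcal C(M,\mathbb R)$, with $C^0=\mathcal C(M,\mathbb R)$, and $\partial^l:C^l\to C^{l+1}$ is $$\partial^l(F)(h_1,\dots,h_{l+1})=F(h_1,\dots,h_l)\circ h_{l+1}+\sum_{i=1}^l(-1)^iF(h_1,\dots,h_{i-1},h_i\circ h_{i+1},\dots,h_{l+1})+(-1)^{l+1}F(h_2,\dots,h_{l+1}).$$ In particular $(\partial^0f)(h)=f\circ h-f$ and $(\partial^1F)(h_1,h_2)=F(h_1)\circ h_2-F(h_1\circ h_2)+F(h_2)$. Then $H^l(G,\mathcal C(M,\mathbb R)):=\ker\partial^l/\operatorname{im}\partial^{l-1}$; in particular $H^1(G,\mathcal C(M,\mathbb R))=\ker\partial^1/\operatorname{im}\partial^0$.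
   Formalization: As stated the second claim fails: τ_{2α}=τ_α contradicts an injective homomorphism if H¹(M,ℝ)≠0, and on S¹ [τ_Ω]=0. Here ι₀ sends [α] to ‖α‖_{L²}[τ_α], and injectivity is claimed only for dim M ≥ 2; M is taken of dimension at least 1. *)

theory Defs
  imports "HOL-Analysis.Analysis" "HOL-Algebra.Coset"
begin

section \<open>Oriented smooth manifolds\<close>

text \<open>
  \<open>C\<^sup>k\<close> maps on an open set \<open>S\<close>, through iterated directional derivatives.
\<close>

primrec Ck_on ::
    "nat \<Rightarrow> ('a::real_normed_vector \<Rightarrow> 'b::real_normed_vector) \<Rightarrow> 'a set \<Rightarrow> bool" where
  "Ck_on 0 f S \<longleftrightarrow> continuous_on S f"
| "Ck_on (Suc k) f S \<longleftrightarrow>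
     (\<forall>x\<in>S. f differentiable (at x)) \<and>
     (\<forall>v. Ck_on k (\<lambda>x. frechet_derivative f (at x) v) S)"

definition smooth_on :: "('a::real_normed_vector \<Rightarrow> 'b::real_normed_vector) \<Rightarrow> 'a set \<Rightarrow> bool" where
  "smooth_on f S \<longleftrightarrow> (\<forall>k. Ck_on k f S)"

text \<open>
  A manifold is a type \<open>'m\<close> (Hausdorff and second countable by its sort) with an atlas modelled on
  \<open>real ^ 'n\<close>. A chart is a pair of its domain and its coordinate map; the coordinate map is
  total, but only its values on the domain are relevant.
\<close>

type_synonym ('m, 'n) chart = "'m set \<times> ('m \<Rightarrow> real ^ 'n)"

abbreviation cdom :: "('m, 'n) chart \<Rightarrow> 'm set" where "cdom \<equiv> fst"
abbreviation cmap :: "('m, 'n) chart \<Rightarrow> 'm \<Rightarrow> real ^ 'n" where "cmap \<equiv> snd"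
abbreviation cimg :: "('m, 'n) chart \<Rightarrow> (real ^ 'n) set" where "cimg c \<equiv> cmap c ` cdom c"

definition cinv :: "('m, 'n) chart \<Rightarrow> real ^ 'n \<Rightarrow> 'm" where
  "cinv c = inv_into (cdom c) (cmap c)"

definition is_chart :: "('m::topological_space, 'n::finite) chart \<Rightarrow> bool" where
  "is_chart c \<longleftrightarrow>
     open (cdom c) \<and> open (cimg c) \<and> homeomorphism (cdom c) (cimg c) (cmap c) (cinv c)"

definition transition :: "('m, 'n) chart \<Rightarrow> ('m, 'n) chart \<Rightarrow> real ^ 'n \<Rightarrow> real ^ 'n" where
  "transition c d = cmap d \<circ> cinv c"

definition dtransition ::
    "('m, 'n::finite) chart \<Rightarrow> ('m, 'n) chart \<Rightarrow> real ^ 'n \<Rightarrow> real ^ 'n \<Rightarrow> real ^ 'n" where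
  "dtransition c d x = frechet_derivative (transition c d) (at x)"

text \<open>
  The orientation is encoded by the atlas: all changes of coordinates preserve orientation.
\<close>

definition oriented_smooth_atlas ::
    "('m::{second_countable_topology, t2_space}, 'n::finite) chart set \<Rightarrow> bool" where
  "oriented_smooth_atlas A \<longleftrightarrow>
     (\<Union>c\<in>A. cdom c) = UNIV \<and>
     (\<forall>c\<in>A. is_chart c) \<and>
     (\<forall>c\<in>A. \<forall>d\<in>A. smooth_on (transition c d) (cmap c ` (cdom c \<inter> cdom d))) \<and>
     (\<forall>c\<in>A. \<forall>d\<in>A. \<forall>p\<in>cdom c \<inter> cdom d. det (matrix (dtransition c d (cmap c p))) > 0)"

definition closed_connected_oriented_manifold ::
    "('m::{second_countable_topology, t2_space}, 'n::finite) chart set \<Rightarrow> bool" where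
  "closed_connected_oriented_manifold A \<longleftrightarrow>
     oriented_smooth_atlas A \<and> compact (UNIV :: 'm set) \<and> connected (UNIV :: 'm set)"

definition chart_at :: "('m, 'n) chart set \<Rightarrow> 'm \<Rightarrow> ('m, 'n) chart" where
  "chart_at A p = (SOME c. c \<in> A \<and> p \<in> cdom c)"

definition smooth_function ::
    "('m, 'n::finite) chart set \<Rightarrow> ('m \<Rightarrow> real) \<Rightarrow> bool" where
  "smooth_function A f \<longleftrightarrow> (\<forall>c\<in>A. smooth_on (f \<circ> cinv c) (cimg c))"


section \<open>Volume forms and Riemannian metrics\<close>

text \<open>
  A volume form is given by its coefficients: in the chart \<open>c\<close> it is
  \<open>\<Omega> c x dx\<^sub>1 \<and> \<dots> \<and> dx\<^sub>n\<close>. It is positive with respect to the orientation, so its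
  integral is the total mass of the associated measure.
\<close>

definition volume_form ::
    "('m, 'n::finite) chart set \<Rightarrow> (('m, 'n) chart \<Rightarrow> real ^ 'n \<Rightarrow> real) \<Rightarrow> bool" where
  "volume_form A \<Omega> \<longleftrightarrow>
     (\<forall>c\<in>A. smooth_on (\<Omega> c) (cimg c) \<and> (\<forall>x\<in>cimg c. \<Omega> c x > 0)) \<and>
     (\<forall>c\<in>A. \<forall>d\<in>A. \<forall>p\<in>cdom c \<inter> cdom d.
        \<Omega> c (cmap c p) = \<Omega> d (cmap d p) * det (matrix (dtransition c d (cmap c p))))"

text \<open>
  The Borel measure on the manifold with density \<open>\<rho> c\<close> with respect to Lebesgue measure in each
  chart \<open>c\<close>; it exists and is unique if \<open>\<rho>\<close> transforms as the coefficients of a volume form.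
\<close>

definition density_measure ::
    "('m::topological_space, 'n::finite) chart set \<Rightarrow>
     (('m, 'n) chart \<Rightarrow> real ^ 'n \<Rightarrow> real) \<Rightarrow> 'm measure" where
  "density_measure A \<rho> = (THE \<mu>. sets \<mu> = sets borel \<and>
     (\<forall>c\<in>A. \<forall>B\<in>sets borel. B \<subseteq> cdom c \<longrightarrow>
        emeasure \<mu> B = (\<integral>\<^sup>+ x\<in>cmap c ` B. ennreal (\<rho> c x) \<partial>lborel)))"

text \<open>The metric is given by its matrix \<open>g c x\<close> in each chart.\<close>

definition riemannian_metric ::
    "('m, 'n::finite) chart set \<Rightarrow> (('m, 'n) chart \<Rightarrow> real ^ 'n \<Rightarrow> real ^ 'n ^ 'n) \<Rightarrow> bool" where
  "riemannian_metric A g \<longleftrightarrow>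
     (\<forall>c\<in>A. smooth_on (g c) (cimg c) \<and>
        (\<forall>x\<in>cimg c. transpose (g c x) = g c x \<and> (\<forall>v. v \<noteq> 0 \<longrightarrow> v \<bullet> (g c x *v v) > 0))) \<and>
     (\<forall>c\<in>A. \<forall>d\<in>A. \<forall>p\<in>cdom c \<inter> cdom d. \<forall>v w.
        v \<bullet> (g c (cmap c p) *v w) =
        dtransition c d (cmap c p) v \<bullet> (g d (cmap d p) *v dtransition c d (cmap c p) w))"

definition riemannian_measure ::
    "('m::topological_space, 'n::finite) chart set \<Rightarrow>
     (('m, 'n) chart \<Rightarrow> real ^ 'n \<Rightarrow> real ^ 'n ^ 'n) \<Rightarrow> 'm measure" where
  "riemannian_measure A g = density_measure A (\<lambda>c x. sqrt (det (g c x)))"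


section \<open>Closed 1-forms and de Rham cohomology\<close>

text \<open>
  A 1-form is the family of its coordinate expressions, compatible under changes of coordinates.
  The value 0 outside the relevant arguments makes the representation unique, so that equality of
  forms is equality in HOL.
\<close>

type_synonym ('m, 'n) form1 = "('m, 'n) chart \<Rightarrow> real ^ 'n \<Rightarrow> ((real ^ 'n) \<Rightarrow>\<^sub>L real)"

definition one_form :: "('m, 'n::finite) chart set \<Rightarrow> ('m, 'n) form1 \<Rightarrow> bool" where
  "one_form A \<alpha> \<longleftrightarrow>
     (\<forall>c\<in>A. smooth_on (\<alpha> c) (cimg c)) \<and>
     (\<forall>c\<in>A. \<forall>d\<in>A. \<forall>p\<in>cdom c \<inter> cdom d. \<forall>v.
        blinfun_apply (\<alpha> c (cmap c p)) v =
        blinfun_apply (\<alpha> d (cmap d p)) (dtransition c d (cmap c p) v)) \<and>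
     (\<forall>c x. c \<notin> A \<or> x \<notin> cimg c \<longrightarrow> \<alpha> c x = 0)"

definition exterior_derivative ::
    "('m, 'n::finite) form1 \<Rightarrow> ('m, 'n) chart \<Rightarrow> real ^ 'n \<Rightarrow> real ^ 'n \<Rightarrow> real ^ 'n \<Rightarrow> real" where
  "exterior_derivative \<alpha> c x v w =
     blinfun_apply (frechet_derivative (\<alpha> c) (at x) v) w -
     blinfun_apply (frechet_derivative (\<alpha> c) (at x) w) v"

definition closed_form :: "('m, 'n::finite) chart set \<Rightarrow> ('m, 'n) form1 \<Rightarrow> bool" where
  "closed_form A \<alpha> \<longleftrightarrow> one_form A \<alpha> \<and>
     (\<forall>c\<in>A. \<forall>x\<in>cimg c. \<forall>v w. exterior_derivative \<alpha> c x v w = 0)"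

text \<open>\<open>df = \<alpha>\<close> on the open set \<open>V\<close>.\<close>

definition primitive_on ::
    "('m, 'n::finite) chart set \<Rightarrow> 'm set \<Rightarrow> ('m, 'n) form1 \<Rightarrow> ('m \<Rightarrow> real) \<Rightarrow> bool" where
  "primitive_on A V \<alpha> f \<longleftrightarrow>
     (\<forall>c\<in>A. \<forall>p\<in>V \<inter> cdom c.
        ((f \<circ> cinv c) has_derivative blinfun_apply (\<alpha> c (cmap c p))) (at (cmap c p)))"

definition exact_form :: "('m, 'n::finite) chart set \<Rightarrow> ('m, 'n) form1 \<Rightarrow> bool" where
  "exact_form A \<alpha> \<longleftrightarrow> one_form A \<alpha> \<and> (\<exists>f. smooth_function A f \<and> primitive_on A UNIV \<alpha> f)"

definition closed_forms :: "('m, 'n::finite) chart set \<Rightarrow> ('m, 'n) form1 monoid" where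
  "closed_forms A = \<lparr>carrier = {\<alpha>. closed_form A \<alpha>},
     mult = (\<lambda>\<alpha> \<beta> c x. \<alpha> c x + \<beta> c x), one = (\<lambda>c x. 0)\<rparr>"

definition exact_forms :: "('m, 'n::finite) chart set \<Rightarrow> ('m, 'n) form1 set" where
  "exact_forms A = {\<alpha>. exact_form A \<alpha>}"

definition deRham_H1 :: "('m, 'n::finite) chart set \<Rightarrow> ('m, 'n) form1 set monoid" where
  "deRham_H1 A = closed_forms A Mod exact_forms A"

definition deRham_class ::
    "('m, 'n::finite) chart set \<Rightarrow> ('m, 'n) form1 \<Rightarrow> ('m, 'n) form1 set" where
  "deRham_class A \<alpha> = exact_forms A #>\<^bsub>closed_forms A\<^esub> \<alpha>"

text \<open>
  The square of the pointwise norm of \<open>\<alpha>\<close> is \<open>g\<^sup>i\<^sup>j a\<^sub>i a\<^sub>j\<close>, where \<open>a\<^sub>i\<close> are the coordinates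
  of \<open>\<alpha>\<close> and \<open>g\<^sup>i\<^sup>j\<close> the inverse matrix; this does not depend on the chart.
\<close>

definition covector_coords :: "((real ^ 'n::finite) \<Rightarrow>\<^sub>L real) \<Rightarrow> real ^ 'n" where
  "covector_coords a = (\<chi> i. blinfun_apply a (axis i 1))"

definition norm_sq_at ::
    "('m, 'n::finite) chart set \<Rightarrow> (('m, 'n) chart \<Rightarrow> real ^ 'n \<Rightarrow> real ^ 'n ^ 'n) \<Rightarrow>
     ('m, 'n) form1 \<Rightarrow> 'm \<Rightarrow> real" where
  "norm_sq_at A g \<alpha> p =
     (let c = chart_at A p; a = covector_coords (\<alpha> c (cmap c p))
      in a \<bullet> (matrix_inv (g c (cmap c p)) *v a))"

definition form_L2_norm ::
    "('m::topological_space, 'n::finite) chart set \<Rightarrow>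
     (('m, 'n) chart \<Rightarrow> real ^ 'n \<Rightarrow> real ^ 'n ^ 'n) \<Rightarrow> ('m, 'n) form1 \<Rightarrow> real" where
  "form_L2_norm A g \<alpha> = sqrt (\<integral>p. norm_sq_at A g \<alpha> p \<partial>riemannian_measure A g)"


section \<open>Integration along curves\<close>

definition C1_curve ::
    "('m::topological_space, 'n::finite) chart set \<Rightarrow> (real \<Rightarrow> 'm) \<Rightarrow> bool" where
  "C1_curve A \<gamma> \<longleftrightarrow> path \<gamma> \<and>
     (\<forall>c\<in>A. \<exists>D. continuous_on {t\<in>{0..1}. \<gamma> t \<in> cdom c} D \<and>
        (\<forall>t\<in>{0..1}. \<gamma> t \<in> cdom c \<longrightarrow>
           ((cmap c \<circ> \<gamma>) has_vector_derivative D t) (at t within {0..1})))"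

definition line_integral ::
    "('m, 'n::finite) chart set \<Rightarrow> ('m, 'n) form1 \<Rightarrow> (real \<Rightarrow> 'm) \<Rightarrow> real" where
  "line_integral A \<alpha> \<gamma> = integral {0..1} (\<lambda>t.
     let c = chart_at A (\<gamma> t)
     in blinfun_apply (\<alpha> c (cmap c (\<gamma> t))) (vector_derivative (cmap c \<circ> \<gamma>) (at t within {0..1})))"

text \<open>
  The curve \<open>h \<circ> \<gamma>\<close> is only continuous. The integral of a closed form along a continuous curve
  is the sum of the increments of local primitives over a subdivision; it does not depend on the
  choices, and agrees with the usual line integral on \<open>C\<^sup>1\<close> curves.
\<close>

definition path_integral ::
    "('m::topological_space, 'n::finite) chart set \<Rightarrow> ('m, 'n) form1 \<Rightarrow> (real \<Rightarrow> 'm) \<Rightarrow> real" where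
  "path_integral A \<alpha> \<gamma> = (THE s. \<exists>(k::nat) t f.
     t 0 = 0 \<and> t k = 1 \<and>
     (\<forall>i<k. t i \<le> t (Suc i) \<and>
        (\<exists>V. open V \<and> \<gamma> ` {t i..t (Suc i)} \<subseteq> V \<and> primitive_on A V \<alpha> (f i))) \<and>
     s = (\<Sum>i<k. f i (\<gamma> (t (Suc i))) - f i (\<gamma> (t i))))"

text \<open>\<open>I\<^sub>\<alpha>(h, x, y)\<close>\<close>

definition displacement ::
    "('m::topological_space, 'n::finite) chart set \<Rightarrow> ('m, 'n) form1 \<Rightarrow>
     ('m \<Rightarrow> 'm) \<Rightarrow> 'm \<Rightarrow> 'm \<Rightarrow> real" where
  "displacement A \<alpha> h x y = (THE r. \<exists>\<gamma>. C1_curve A \<gamma> \<and> pathstart \<gamma> = x \<and> pathfinish \<gamma> = y \<and>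
     r = path_integral A \<alpha> (h \<circ> \<gamma>) - line_integral A \<alpha> \<gamma>)"


section \<open>The group of volume preserving homeomorphisms\<close>

definition compact_open_topology :: "('a::topological_space \<Rightarrow> 'b::topological_space) topology" where
  "compact_open_topology = topology_generated_by {{h. h ` K \<subseteq> U} | K U. compact K \<and> open U}"

definition Homeo_vol ::
    "('m::topological_space, 'n::finite) chart set \<Rightarrow>
     (('m, 'n) chart \<Rightarrow> real ^ 'n \<Rightarrow> real) \<Rightarrow> ('m \<Rightarrow> 'm) set" where
  "Homeo_vol A \<Omega> = {h. (\<exists>k. homeomorphism UNIV UNIV h k) \<and>
     distr (density_measure A \<Omega>) (density_measure A \<Omega>) h = density_measure A \<Omega>}"

definition Homeo0 ::
    "('m::topological_space, 'n::finite) chart set \<Rightarrow>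
     (('m, 'n) chart \<Rightarrow> real ^ 'n \<Rightarrow> real) \<Rightarrow> ('m \<Rightarrow> 'm) set" where
  "Homeo0 A \<Omega> =
     connected_component_of_set (subtopology compact_open_topology (Homeo_vol A \<Omega>)) id"


section \<open>First group cohomology with coefficients in the continuous functions\<close>

text \<open>
  \<open>G\<close> is a set of self-maps of \<open>'m\<close> closed under composition, acting on functions by
  \<open>f \<mapsto> f \<circ> h\<close>. A 1-cochain is a function from \<open>G\<close> to the continuous functions.
\<close>

type_synonym 'm cochain1 = "('m \<Rightarrow> 'm) \<Rightarrow> 'm \<Rightarrow> real"

definition cont_funs :: "('m::topological_space \<Rightarrow> real) set" where
  "cont_funs = {f. continuous_on UNIV f}"

definition cochains1 :: "('m::topological_space \<Rightarrow> 'm) set \<Rightarrow> 'm cochain1 set" where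
  "cochains1 G = G \<rightarrow>\<^sub>E cont_funs"

definition coboundary0 :: "('m \<Rightarrow> 'm) set \<Rightarrow> ('m \<Rightarrow> real) \<Rightarrow> 'm cochain1" where
  "coboundary0 G f = (\<lambda>h\<in>G. \<lambda>z. f (h z) - f z)"

definition coboundary1 :: "'m cochain1 \<Rightarrow> ('m \<Rightarrow> 'm) \<Rightarrow> ('m \<Rightarrow> 'm) \<Rightarrow> 'm \<Rightarrow> real" where
  "coboundary1 F h1 h2 = (\<lambda>z. F h1 (h2 z) - F (h1 \<circ> h2) z + F h2 z)"

definition cocycles1 :: "('m::topological_space \<Rightarrow> 'm) set \<Rightarrow> 'm cochain1 monoid" where
  "cocycles1 G = \<lparr>carrier = {F \<in> cochains1 G. \<forall>h1\<in>G. \<forall>h2\<in>G. coboundary1 F h1 h2 = (\<lambda>z. 0)},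
     mult = (\<lambda>F F'. \<lambda>h\<in>G. \<lambda>z. F h z + F' h z), one = (\<lambda>h\<in>G. \<lambda>z. 0)\<rparr>"

definition coboundaries1 :: "('m::topological_space \<Rightarrow> 'm) set \<Rightarrow> 'm cochain1 set" where
  "coboundaries1 G = coboundary0 G ` cont_funs"

definition group_H1 :: "('m::topological_space \<Rightarrow> 'm) set \<Rightarrow> 'm cochain1 set monoid" where
  "group_H1 G = cocycles1 G Mod coboundaries1 G"

definition group_H1_class ::
    "('m::topological_space \<Rightarrow> 'm) set \<Rightarrow> 'm cochain1 \<Rightarrow> 'm cochain1 set" where
  "group_H1_class G F = coboundaries1 G #>\<^bsub>cocycles1 G\<^esub> F"

definition cochain_scale :: "('m \<Rightarrow> 'm) set \<Rightarrow> real \<Rightarrow> 'm cochain1 \<Rightarrow> 'm cochain1" where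
  "cochain_scale G r F = (\<lambda>h\<in>G. \<lambda>z. r * F h z)"


section \<open>The cocycle of a closed form\<close>

text \<open>For \<open>\<alpha> = 0\<close> the norm vanishes, and division by zero gives the zero function.\<close>

definition tau ::
    "('m::topological_space, 'n::finite) chart set \<Rightarrow>
     (('m, 'n) chart \<Rightarrow> real ^ 'n \<Rightarrow> real) \<Rightarrow> (('m, 'n) chart \<Rightarrow> real ^ 'n \<Rightarrow> real ^ 'n ^ 'n) \<Rightarrow>
     ('m \<Rightarrow> 'm) \<Rightarrow> ('m, 'n) form1 \<Rightarrow> 'm \<Rightarrow> real" where
  "tau A \<Omega> g h \<alpha> z =
     1 / form_L2_norm A g \<alpha> * (\<integral>y. displacement A \<alpha> h z y \<partial>density_measure A \<Omega>)"

definition tau_cochain ::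
    "('m::topological_space, 'n::finite) chart set \<Rightarrow>
     (('m, 'n) chart \<Rightarrow> real ^ 'n \<Rightarrow> real) \<Rightarrow> (('m, 'n) chart \<Rightarrow> real ^ 'n \<Rightarrow> real ^ 'n ^ 'n) \<Rightarrow>
     ('m, 'n) form1 \<Rightarrow> 'm cochain1" where
  "tau_cochain A \<Omega> g \<alpha> = (\<lambda>h\<in>Homeo0 A \<Omega>. tau A \<Omega> g h \<alpha>)"

text \<open>
  The normalised class \<open>[\<tau>\<^sub>\<alpha>]\<close> is invariant under scaling \<open>\<alpha>\<close> by a positive number (and the
  norm depends on the representative of the de Rham class), so the homomorphism on
  cohomology is \<open>[\<alpha>] \<mapsto> \<parallel>\<alpha>\<parallel> [\<tau>\<^sub>\<alpha>]\<close>, the class of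
  \<open>h \<mapsto> (z \<mapsto> \<integral> I\<^sub>\<alpha>(h, z, y) \<Omega>(y))\<close>.
\<close>

definition iota0_class ::
    "('m::topological_space, 'n::finite) chart set \<Rightarrow>
     (('m, 'n) chart \<Rightarrow> real ^ 'n \<Rightarrow> real) \<Rightarrow> (('m, 'n) chart \<Rightarrow> real ^ 'n \<Rightarrow> real ^ 'n ^ 'n) \<Rightarrow>
     ('m, 'n) form1 \<Rightarrow> 'm cochain1 set" where
  "iota0_class A \<Omega> g \<alpha> = group_H1_class (Homeo0 A \<Omega>)
     (cochain_scale (Homeo0 A \<Omega>) (form_L2_norm A g \<alpha>) (tau_cochain A \<Omega> g \<alpha>))"

end

theory Submission
  imports Defs
begin

text \<open>A closed 1-form \<open>\<alpha>\<close> has local primitives, and these define its integral along every continuous curve.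
  Two homeomorphisms that are close in the compact-open topology differ, in \<open>\<integral>\<^bsub>h \<circ> \<gamma>\<^esub> \<alpha>\<close>, by a term that
  depends only on the end points of \<open>\<gamma>\<close>. Hence the dependence of \<open>I\<^sub>\<alpha>(h, x, y)\<close> on \<open>\<gamma>\<close> is locally constant
  in \<open>h\<close>; it vanishes at the identity, so it vanishes on the identity component \<open>G\<close>. Invariance of \<open>\<Omega>\<close> turns
  the additivity of \<open>I\<^sub>\<alpha>\<close> into the cocycle identity for \<open>\<tau>\<^sub>\<alpha>\<close>, and for \<open>\<alpha> = dg\<close> the cocycle is the coboundary
  of a multiple of \<open>g\<close>.

  For injectivity let \<open>\<tau>\<^sub>\<alpha>\<close>, without its norm factor, be the coboundary of \<open>f\<close>. Then
  \<open>I\<^sub>\<alpha>(h, x, y)\<close> is determined by the increments of \<open>f\<close> from \<open>x\<close> to \<open>h x\<close> and from \<open>y\<close> to \<open>h y\<close>. In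
  coordinates in which \<open>\<Omega>\<close> is Lebesgue measure, rotating concentric spheres in a fixed plane by an angle depending on the
  radius preserves \<open>\<Omega>\<close>, belongs to \<open>G\<close>, fixes the centre and can exchange two given points that are opposite
  to each other. So, up to a constant, \<open>- f\<close> agrees with the local primitives of \<open>\<alpha>\<close>, and \<open>\<alpha>\<close> is exact.\<close>

section \<open>Iterated derivatives and the Poincare lemma\<close>

text \<open>Since \<open>tau\<close> does not change when \<alpha> is multiplied by a positive
  number, it is not additive in \<alpha>. The homomorphism is therefore built from the unnormalised
  mean of the displacement, and the norm enters only through being nonzero for \<alpha> \<noteq> 0.
  Members of G are merely continuous, and G is a connected component that offers no isotopy to the
  identity. So integrals are increments of functions of time that imitate local primitives, and h is
  controlled on compact-open neighbourhoods. For injectivity the test homeomorphisms are given by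
  formulas, not as flows: twists form an explicit one-parameter group, and their derivative is a
  rotation composed with a transvection. They preserve Lebesgue measure only, so the density is
  straightened by integrating it in one coordinate; as twists need not be smooth, the straight
  coordinates need only be homeomorphic. A plane of rotation requires dimension at least 2. On the
  circle with length as measure, G consists of rotations, for which the invariant form has
  displacement 0, so injectivity fails there.\<close>

lemma frechet_derivative_cong_open:
  assumes "open S" "x \<in> S" "\<And>y. y \<in> S \<Longrightarrow> f y = g y"
  shows "f differentiable (at x) \<longleftrightarrow> g differentiable (at x)"
    "frechet_derivative f (at x) = frechet_derivative g (at x)"
proof -
  have *: "(f has_derivative D) (at x) \<longleftrightarrow> (g has_derivative D) (at x)" for D
    using has_derivative_transform_within_open[OF _ assms(1,2), of f D UNIV g]
      has_derivative_transform_within_open[OF _ assms(1,2), of g D UNIV f] assms(3) by auto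
  show "f differentiable (at x) \<longleftrightarrow> g differentiable (at x)"
    by (simp add: differentiable_def *)
  show "frechet_derivative f (at x) = frechet_derivative g (at x)"
    by (simp add: frechet_derivative_def *)
qed

lemma Ck_on_cong:
  assumes "open S" "\<And>y. y \<in> S \<Longrightarrow> f y = g y"
  shows "Ck_on k f S \<longleftrightarrow> Ck_on k g S"
  using assms(2)
proof (induction k arbitrary: f g)
  case 0
  then show ?case by (simp cong: continuous_on_cong)
next
  case (Suc k)
  note * = frechet_derivative_cong_open[OF assms(1) _ Suc.prems]
  have "Ck_on k (\<lambda>x. frechet_derivative f (at x) v) S \<longleftrightarrow> Ck_on k (\<lambda>x. frechet_derivative g (at x) v) S"
    for v
    by (rule Suc.IH) (simp add: *(2))
  with *(1) show ?case by auto
qed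

lemma Ck_on_const: "Ck_on k (\<lambda>x. c) S"
proof (induction k arbitrary: c)
  case (Suc k)
  then show ?case by simp
qed simp

lemma smooth_on_const [simp]: "smooth_on (\<lambda>x. c) S"
  by (simp add: smooth_on_def Ck_on_const)

lemma Ck_on_add:
  assumes "open S" "Ck_on k f S" "Ck_on k g S"
  shows "Ck_on k (\<lambda>x. f x + g x) S"
  using assms(2,3)
proof (induction k arbitrary: f g)
  case 0
  then show ?case by (simp add: continuous_on_add)
next
  case (Suc k)
  have *: "((\<lambda>x. f x + g x) has_derivative
      (\<lambda>v. frechet_derivative f (at x) v + frechet_derivative g (at x) v)) (at x)" if "x \<in> S" for x
    using Suc.prems that by (auto intro!: has_derivative_add simp: frechet_derivative_works[symmetric])
  have "Ck_on k (\<lambda>x. frechet_derivative (\<lambda>x. f x + g x) (at x) v) S" for v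
  proof (subst Ck_on_cong[OF assms(1)])
    show "Ck_on k (\<lambda>x. frechet_derivative f (at x) v + frechet_derivative g (at x) v) S"
      using Suc by auto
    show "frechet_derivative (\<lambda>x. f x + g x) (at x) v
        = frechet_derivative f (at x) v + frechet_derivative g (at x) v" if "x \<in> S" for x
      using frechet_derivative_at[OF *[OF that]] by metis
  qed
  then show ?case using * by (auto simp: differentiable_def)
qed

lemma smooth_on_add:
  "open S \<Longrightarrow> smooth_on f S \<Longrightarrow> smooth_on g S \<Longrightarrow> smooth_on (\<lambda>x. f x + g x) S"
  by (simp add: smooth_on_def Ck_on_add)

lemma Ck_on_bounded_linear:
  assumes "bounded_linear L" "open S" "Ck_on k f S"
  shows "Ck_on k (\<lambda>x. L (f x)) S"
  using assms(3)
proof (induction k arbitrary: f)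
  case 0
  then show ?case using bounded_linear.continuous_on[OF assms(1)] by auto
next
  case (Suc k)
  have *: "((\<lambda>x. L (f x)) has_derivative (\<lambda>v. L (frechet_derivative f (at x) v))) (at x)"
    if "x \<in> S" for x
    using Suc.prems that
    by (auto intro!: bounded_linear.has_derivative[OF assms(1)] simp: frechet_derivative_works[symmetric])
  have "Ck_on k (\<lambda>x. frechet_derivative (\<lambda>x. L (f x)) (at x) v) S" for v
  proof (subst Ck_on_cong[OF assms(2)])
    show "Ck_on k (\<lambda>x. L (frechet_derivative f (at x) v)) S"
      using Suc by auto
    show "frechet_derivative (\<lambda>x. L (f x)) (at x) v = L (frechet_derivative f (at x) v)"
      if "x \<in> S" for x
      using frechet_derivative_at[OF *[OF that]] by metis
  qed
  then show ?case using * by (auto simp: differentiable_def)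
qed

lemma smooth_on_bounded_linear:
  "bounded_linear L \<Longrightarrow> open S \<Longrightarrow> smooth_on f S \<Longrightarrow> smooth_on (\<lambda>x. L (f x)) S"
  by (simp add: smooth_on_def Ck_on_bounded_linear)

lemma smooth_on_minus:
  fixes f :: "'a::real_normed_vector \<Rightarrow> 'b::real_normed_vector"
  shows "open S \<Longrightarrow> smooth_on f S \<Longrightarrow> smooth_on (\<lambda>x. - f x) S"
  using smooth_on_bounded_linear[of uminus S f] by (simp add: bounded_linear_minus[OF bounded_linear_ident])

lemma smooth_on_continuous: "smooth_on f S \<Longrightarrow> continuous_on S f"
  unfolding smooth_on_def by (metis Ck_on.simps(1))

lemma smooth_on_differentiable: "smooth_on f S \<Longrightarrow> x \<in> S \<Longrightarrow> f differentiable (at x)"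
  unfolding smooth_on_def by (metis Ck_on.simps(2))

lemma smooth_on_has_derivative:
  "smooth_on f S \<Longrightarrow> x \<in> S \<Longrightarrow> (f has_derivative frechet_derivative f (at x)) (at x)"
  using smooth_on_differentiable frechet_derivative_works by blast

lemma smooth_on_derivative: "smooth_on f S \<Longrightarrow> smooth_on (\<lambda>x. frechet_derivative f (at x) v) S"
  unfolding smooth_on_def by (metis Ck_on.simps(2))

lemma smooth_on_continuous_derivative:
  "smooth_on f S \<Longrightarrow> continuous_on S (\<lambda>x. frechet_derivative f (at x) v)"
  using smooth_on_derivative smooth_on_continuous by blast

text \<open>The directional derivatives of \<open>f\<close> are values of \<alpha>, so
  \<open>f\<close> is one order smoother than \<alpha>.\<close>

lemma smooth_on_primitive:
  fixes \<alpha> :: "'a::real_normed_vector \<Rightarrow> 'a \<Rightarrow>\<^sub>L real"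
  assumes "open S" "smooth_on \<alpha> S" "\<And>x. x \<in> S \<Longrightarrow> (f has_derivative blinfun_apply (\<alpha> x)) (at x)"
  shows "smooth_on f S"
proof -
  have "Ck_on k f S" for k
  proof (cases k)
    case 0
    have "continuous_on S f"
      by (rule continuous_at_imp_continuous_on) (use assms(3) has_derivative_continuous in blast)
    with 0 show ?thesis by simp
  next
    case (Suc j)
    have "Ck_on j (\<lambda>x. frechet_derivative f (at x) v) S" for v
    proof (subst Ck_on_cong[OF assms(1)])
      show "Ck_on j (\<lambda>x. blinfun_apply (\<alpha> x) v) S"
        by (rule Ck_on_bounded_linear[OF blinfun.bounded_linear_left assms(1)])
          (use assms(2) in \<open>simp add: smooth_on_def\<close>)
      show "frechet_derivative f (at x) v = blinfun_apply (\<alpha> x) v" if "x \<in> S" for x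
        using frechet_derivative_at[OF assms(3)[OF that]] by metis
    qed
    then show ?thesis using assms(3) Suc by (auto simp: differentiable_def)
  qed
  then show ?thesis by (simp add: smooth_on_def)
qed

text \<open>The mean value theorem compares the second difference of \<open>f\<close> along \<open>t v\<close>, \<open>t w\<close>, which is
  symmetric in \<open>v\<close> and \<open>w\<close>, with \<open>t\<^sup>2 H w v\<close>.\<close>

lemma second_difference_estimate:
  fixes f :: "'a::real_normed_vector \<Rightarrow> real" and \<alpha> :: "'a \<Rightarrow> 'a \<Rightarrow>\<^sub>L real"
  assumes f: "\<And>y. norm (y - x) < d \<Longrightarrow> (f has_derivative blinfun_apply (\<alpha> y)) (at y)"
    and R: "\<And>y. norm (y - x) < d \<Longrightarrow> norm (\<alpha> y - \<alpha> x - H (y - x)) \<le> e * norm (y - x)"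
    and H: "linear H" and e: "e \<ge> 0" and t: "t > 0" "t * (norm v + norm w) < d"
  shows "\<bar>(f (x + t *\<^sub>R v + t *\<^sub>R w) - f (x + t *\<^sub>R v) - f (x + t *\<^sub>R w) + f x)
      - t\<^sup>2 * blinfun_apply (H w) v\<bar> \<le> 2 * e * (norm v + norm w)\<^sup>2 * t\<^sup>2"
proof -
  define N where "N = norm v + norm w"
  \<comment> \<open>\<open>k 1 - k 0\<close> is the second difference, and \<open>k'\<close>
    compares \<alpha> at two points that differ by t w. Linearity of \<open>H\<close> turns that
    comparison into t H w plus the two remainders collected in \<open>E\<close> below.\<close>
  define k where "k = (\<lambda>s::real. f (x + s *\<^sub>R (t *\<^sub>R v) + t *\<^sub>R w) - f (x + s *\<^sub>R (t *\<^sub>R v)))"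
  define k' where "k' = (\<lambda>s::real. blinfun_apply (\<alpha> (x + s *\<^sub>R (t *\<^sub>R v) + t *\<^sub>R w)) (t *\<^sub>R v)
      - blinfun_apply (\<alpha> (x + s *\<^sub>R (t *\<^sub>R v))) (t *\<^sub>R v))"
  have n: "norm (s *\<^sub>R (t *\<^sub>R v) + t *\<^sub>R w) \<le> t * N" "norm (s *\<^sub>R (t *\<^sub>R v)) \<le> t * N"
    if "0 \<le> s" "s \<le> 1" for s
  proof -
    have "norm (s *\<^sub>R (t *\<^sub>R v)) \<le> t * norm v"
      using that t(1) by (simp add: mult_left_le_one_le)
    then show "norm (s *\<^sub>R (t *\<^sub>R v)) \<le> t * N"
      using t(1) unfolding N_def by (smt (verit) mult_left_mono norm_ge_zero)
    have "norm (s *\<^sub>R (t *\<^sub>R v) + t *\<^sub>R w) \<le> norm (s *\<^sub>R (t *\<^sub>R v)) + norm (t *\<^sub>R w)"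
      by (rule norm_triangle_ineq)
    also have "\<dots> \<le> t * norm v + t * norm w"
      using \<open>norm (s *\<^sub>R (t *\<^sub>R v)) \<le> t * norm v\<close> t(1) by simp
    finally show "norm (s *\<^sub>R (t *\<^sub>R v) + t *\<^sub>R w) \<le> t * N"
      by (simp add: N_def distrib_left)
  qed
  have small: "t * N < d" using t by (simp add: N_def)
  have der: "(k has_derivative (\<lambda>r. r * k' s)) (at s within {0..1})" if "0 \<le> s" "s \<le> 1" for s
  proof -
    have 1: "(f has_derivative blinfun_apply (\<alpha> (x + s *\<^sub>R (t *\<^sub>R v) + t *\<^sub>R w)))
        (at (x + s *\<^sub>R (t *\<^sub>R v) + t *\<^sub>R w))"
      using n(1)[OF that] small by (intro f) (simp add: algebra_simps)
    have 2: "(f has_derivative blinfun_apply (\<alpha> (x + s *\<^sub>R (t *\<^sub>R v))))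
        (at (x + s *\<^sub>R (t *\<^sub>R v)))"
      using n(2)[OF that] small by (intro f) simp
    have 3: "((\<lambda>s. f (x + s *\<^sub>R (t *\<^sub>R v) + t *\<^sub>R w)) has_derivative
        (\<lambda>r. blinfun_apply (\<alpha> (x + s *\<^sub>R (t *\<^sub>R v) + t *\<^sub>R w)) (r *\<^sub>R (t *\<^sub>R v)))) (at s within {0..1})"
      by (rule has_derivative_compose[of "\<lambda>s. x + s *\<^sub>R (t *\<^sub>R v) + t *\<^sub>R w"
          "\<lambda>r. r *\<^sub>R (t *\<^sub>R v)" s "{0..1}" f, OF _ 1]) (auto intro!: derivative_eq_intros)
    have 4: "((\<lambda>s. f (x + s *\<^sub>R (t *\<^sub>R v))) has_derivative
        (\<lambda>r. blinfun_apply (\<alpha> (x + s *\<^sub>R (t *\<^sub>R v))) (r *\<^sub>R (t *\<^sub>R v)))) (at s within {0..1})"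
      by (rule has_derivative_compose[of "\<lambda>s. x + s *\<^sub>R (t *\<^sub>R v)"
          "\<lambda>r. r *\<^sub>R (t *\<^sub>R v)" s "{0..1}" f, OF _ 2]) (auto intro!: derivative_eq_intros)
    show ?thesis
      unfolding k_def k'_def using has_derivative_diff[OF 3 4]
      by (simp add: blinfun.scaleR_right algebra_simps)
  qed
  obtain s where s: "0 \<le> s" "s \<le> 1" "k 1 - k 0 = k' s"
    using mvt_very_simple[OF zero_le_one, of k "\<lambda>s r. r * k' s"] der by auto
  define y where "y = x + s *\<^sub>R (t *\<^sub>R v) + t *\<^sub>R w"
  define z where "z = x + s *\<^sub>R (t *\<^sub>R v)"
  define E where "E = (\<alpha> y - \<alpha> x - H (y - x)) - (\<alpha> z - \<alpha> x - H (z - x))"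
  have "norm (y - x) \<le> t * N" "norm (z - x) \<le> t * N"
    using n[OF s(1,2)] by (simp_all add: y_def z_def algebra_simps)
  moreover have "norm E \<le> e * norm (y - x) + e * norm (z - x)"
    unfolding E_def using R[of y] R[of z] calculation small
    by (smt (verit) norm_triangle_ineq4)
  ultimately have "norm E \<le> e * (t * N) + e * (t * N)"
    using e by (smt (verit) mult_left_mono)
  have "H (y - x) - H (z - x) = t *\<^sub>R H w"
    using H by (simp add: y_def z_def linear_diff[symmetric] linear_cmul[symmetric])
  then have "\<alpha> y - \<alpha> z = t *\<^sub>R H w + E"
    by (simp add: E_def algebra_simps)
  then have "k' s = blinfun_apply (t *\<^sub>R H w + E) (t *\<^sub>R v)"
    unfolding k'_def y_def z_def by (metis blinfun.diff_left)
  also have "\<dots> = t\<^sup>2 * blinfun_apply (H w) v + blinfun_apply E (t *\<^sub>R v)"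
    by (simp add: blinfun.bilinear_simps power2_eq_square distrib_left)
  finally have "\<bar>k' s - t\<^sup>2 * blinfun_apply (H w) v\<bar> = norm (blinfun_apply E (t *\<^sub>R v))"
    by simp
  also have "\<dots> \<le> norm E * norm (t *\<^sub>R v)" by (rule norm_blinfun)
  also have "\<dots> \<le> (e * (t * N) + e * (t * N)) * (t * N)"
  proof (rule mult_mono)
    show "norm (t *\<^sub>R v) \<le> t * N" using t(1) by (simp add: N_def)
    show "0 \<le> e * (t * N) + e * (t * N)" using e t(1) by (simp add: N_def)
  qed (use \<open>norm E \<le> e * (t * N) + e * (t * N)\<close> in simp_all)
  also have "\<dots> = 2 * e * N\<^sup>2 * t\<^sup>2" by (simp add: power2_eq_square)
  finally show ?thesis
    using s(3) by (simp add: k_def N_def)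
qed

text \<open>Exchanging \<open>v\<close> and \<open>w\<close> leaves the second difference unchanged,
  so after division by t^2 both values of \<open>H\<close> lie within 2 e N^2 of the same number,
  for every e > 0. This is the identity d(df) = 0.\<close>

lemma symmetric_second_derivative:
  fixes f :: "'a::real_normed_vector \<Rightarrow> real" and \<alpha> :: "'a \<Rightarrow> 'a \<Rightarrow>\<^sub>L real"
  assumes "open S" "x \<in> S"
    and f: "\<And>y. y \<in> S \<Longrightarrow> (f has_derivative blinfun_apply (\<alpha> y)) (at y)"
    and H: "(\<alpha> has_derivative H) (at x)"
  shows "blinfun_apply (H v) w = blinfun_apply (H w) v"
proof -
  define N where "N = norm v + norm w"
  have lin: "linear H" by (rule has_derivative_linear[OF H])
  obtain r where r: "r > 0" "ball x r \<subseteq> S" by (rule openE[OF assms(1,2)])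
  have est: "\<bar>blinfun_apply (H v) w - blinfun_apply (H w) v\<bar> \<le> 4 * e * N\<^sup>2" if e: "e > 0" for e
  proof -
    obtain d0 where d0: "d0 > 0" "\<And>y. norm (y - x) < d0 \<Longrightarrow>
        norm (\<alpha> y - \<alpha> x - H (y - x)) \<le> e * norm (y - x)"
      using H[unfolded has_derivative_at_alt, THEN conjunct2, rule_format, OF e] by auto
    define d where "d = min d0 r"
    \<comment> \<open>The 1 in the denominator keeps \<open>t\<close> positive when \<open>v\<close>
      and \<open>w\<close> are 0, and \<open>t * N\<close> is at most d / 2 in all cases.\<close>
    define t where "t = d / (2 * (N + 1))"
    have N0: "N \<ge> 0" by (simp add: N_def)
    have d: "d > 0" using d0 r by (simp add: d_def)
    have t: "t > 0" using d N0 by (simp add: t_def)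
    have "t * N \<le> t * (N + 1)" using t by simp
    also have "\<dots> = d / 2" using N0 by (simp add: t_def field_simps)
    finally have tN: "t * N < d" using d by linarith
    have fd: "(f has_derivative blinfun_apply (\<alpha> y)) (at y)" if "norm (y - x) < d" for y
      using that r by (intro f) (auto simp: d_def dist_norm norm_minus_commute subset_iff)
    have Rd: "norm (\<alpha> y - \<alpha> x - H (y - x)) \<le> e * norm (y - x)" if "norm (y - x) < d" for y
      using that d0(2) by (simp add: d_def)
    have 1: "\<bar>(f (x + t *\<^sub>R v + t *\<^sub>R w) - f (x + t *\<^sub>R v) - f (x + t *\<^sub>R w) + f x)
        - t\<^sup>2 * blinfun_apply (H w) v\<bar> \<le> 2 * e * N\<^sup>2 * t\<^sup>2"
      unfolding N_def
      by (rule second_difference_estimate[OF fd Rd lin]) (use t tN e in \<open>auto simp: N_def\<close>)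
    have 2: "\<bar>(f (x + t *\<^sub>R w + t *\<^sub>R v) - f (x + t *\<^sub>R w) - f (x + t *\<^sub>R v) + f x)
        - t\<^sup>2 * blinfun_apply (H v) w\<bar> \<le> 2 * e * (norm w + norm v)\<^sup>2 * t\<^sup>2"
      by (rule second_difference_estimate[OF fd Rd lin])
        (use t tN e in \<open>auto simp: N_def add.commute\<close>)
    have 3: "x + t *\<^sub>R w + t *\<^sub>R v = x + t *\<^sub>R v + t *\<^sub>R w" by simp
    have "\<bar>t\<^sup>2 * blinfun_apply (H v) w - t\<^sup>2 * blinfun_apply (H w) v\<bar> \<le> 4 * e * N\<^sup>2 * t\<^sup>2"
      using 1 2 unfolding 3 N_def by (simp add: add.commute[of "norm w"])
    then have "t\<^sup>2 * \<bar>blinfun_apply (H v) w - blinfun_apply (H w) v\<bar> \<le> t\<^sup>2 * (4 * e * N\<^sup>2)"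
      by (simp add: right_diff_distrib[symmetric] abs_mult mult.commute[of "t\<^sup>2"])
        (simp add: left_diff_distrib[symmetric] abs_mult)
    then show ?thesis using t by simp
  qed
  have "\<bar>blinfun_apply (H v) w - blinfun_apply (H w) v\<bar> \<le> 0 + e" if "e > 0" for e
  proof -
    have "\<bar>blinfun_apply (H v) w - blinfun_apply (H w) v\<bar> \<le> 4 * (e / (4 * (N\<^sup>2 + 1))) * N\<^sup>2"
      using that by (intro est) (simp add: add_nonneg_pos)
    also have "\<dots> = e * (N\<^sup>2 / (N\<^sup>2 + 1))"
      by (simp add: field_simps add_nonneg_eq_0_iff)
    also have "\<dots> \<le> e * 1"
      using that by (intro mult_left_mono) (auto simp: divide_le_eq add_nonneg_pos)
    finally show ?thesis by simp
  qed
  then have "\<bar>blinfun_apply (H v) w - blinfun_apply (H w) v\<bar> \<le> 0"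
    by (rule field_le_epsilon)
  then show ?thesis by simp
qed

text \<open>The primitive is the integral of \<alpha> along the segment from the centre. Symmetry of
  \<open>H\<close> turns the derivative of the integrand in \<open>x\<close> into d/dt of
  \<open>t *\<^sub>R \<alpha> (p x t)\<close>, whose integral over the unit interval is
  \<open>\<alpha> x\<close>.\<close>

lemma poincare_ball:
  fixes \<alpha> :: "'a::euclidean_space \<Rightarrow> 'a \<Rightarrow>\<^sub>L real"
  assumes der: "\<And>x. x \<in> ball a r \<Longrightarrow> (\<alpha> has_derivative H x) (at x)"
    and contH: "\<And>v. continuous_on (ball a r) (\<lambda>x. H x v)"
    and sym: "\<And>x v w. x \<in> ball a r \<Longrightarrow> blinfun_apply (H x v) w = blinfun_apply (H x w) v"
  obtains \<phi> where "\<And>x. x \<in> ball a r \<Longrightarrow> (\<phi> has_derivative blinfun_apply (\<alpha> x)) (at x)"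
proof -
  define H' where "H' = (\<lambda>x. Blinfun (H x))"
  have H': "blinfun_apply (H' x) = H x" if "x \<in> ball a r" for x
    unfolding H'_def
    by (rule bounded_linear_Blinfun_apply[OF has_derivative_bounded_linear[OF der[OF that]]])
  have contH': "continuous_on (ball a r) H'"
  proof (rule continuous_on_blinfun_componentwise)
    fix i :: 'a assume "i \<in> Basis"
    show "continuous_on (ball a r) (\<lambda>x. blinfun_apply (H' x) i)"
      using contH[of i] by (rule continuous_on_eq) (simp add: H')
  qed
  have cont\<alpha>: "continuous_on (ball a r) \<alpha>"
    by (rule continuous_at_imp_continuous_on) (use der has_derivative_continuous in blast)
  define p where "p = (\<lambda>x (t::real). a + t *\<^sub>R (x - a))"
  have p: "p x t \<in> ball a r" if "x \<in> ball a r" "t \<in> {0..1}" for x t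
  proof -
    have "norm (t *\<^sub>R (x - a)) \<le> norm (x - a)" using that(2) by (simp add: mult_left_le_one_le)
    with that(1) show ?thesis by (simp add: p_def dist_norm norm_minus_commute)
  qed
  define f where "f = (\<lambda>x t. blinfun_apply (\<alpha> (p x t)) (x - a))"
  define fx where "fx = (\<lambda>x t. \<alpha> (p x t) + t *\<^sub>R blinfun_apply (H' (p x t)) (x - a))"
  define \<phi> where "\<phi> = (\<lambda>x. integral (cbox 0 1) (f x))"
  have d: "(\<phi> has_derivative blinfun_apply (\<alpha> x)) (at x)" if x: "x \<in> ball a r" for x
  proof -
    have cp: "continuous_on (ball a r \<times> cbox 0 1) (\<lambda>(x, t). p x t)"
      unfolding p_def split_beta by (intro continuous_intros)
    have cp\<alpha>: "continuous_on (ball a r \<times> cbox 0 1) (\<lambda>z. \<alpha> (p (fst z) (snd z)))"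
      by (rule continuous_on_compose2[OF cont\<alpha> cp[unfolded split_beta]]) (auto simp del: mem_ball intro: p)
    have cpH: "continuous_on (ball a r \<times> cbox 0 1) (\<lambda>z. H' (p (fst z) (snd z)))"
      by (rule continuous_on_compose2[OF contH' cp[unfolded split_beta]]) (auto simp del: mem_ball intro: p)
    have "(\<phi> has_derivative integral (cbox 0 1) (fx x)) (at x within ball a r)"
      unfolding \<phi>_def
    proof (rule leibniz_rule[OF _ _ _ x convex_ball])
      fix y and t :: real assume y: "y \<in> ball a r" and t: "t \<in> cbox 0 1"
      have "((\<lambda>y. p y t) has_derivative (\<lambda>v. t *\<^sub>R v)) (at y within ball a r)"
        unfolding p_def by (auto intro!: derivative_eq_intros)
      then have 1: "((\<lambda>y. \<alpha> (p y t)) has_derivative (\<lambda>v. H (p y t) (t *\<^sub>R v))) (at y within ball a r)"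
        by (rule has_derivative_compose) (intro der p y, use t in simp)
      have "((\<lambda>y. f y t) has_derivative (\<lambda>v. blinfun_apply (\<alpha> (p y t)) v
          + blinfun_apply (H (p y t) (t *\<^sub>R v)) (y - a))) (at y within ball a r)"
        unfolding f_def by (rule blinfun.FDERIV[OF 1]) (auto intro!: derivative_eq_intros)
      moreover have "blinfun_apply (\<alpha> (p y t)) v + blinfun_apply (H (p y t) (t *\<^sub>R v)) (y - a)
          = blinfun_apply (fx y t) v" for v
      proof -
        have py: "p y t \<in> ball a r" using p y t by auto
        have "blinfun_apply (H (p y t) (t *\<^sub>R v)) (y - a) = t * blinfun_apply (H (p y t) v) (y - a)"
          by (simp add: H'[OF py, symmetric] blinfun.scaleR_right blinfun.scaleR_left)
        \<comment> \<open>Closedness enters here: the argument \<open>v\<close> and the position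
          \<open>y - a\<close> change places.\<close>
        also have "\<dots> = t * blinfun_apply (H (p y t) (y - a)) v"
          by (rule arg_cong[OF sym[OF py]])
        finally show ?thesis
          by (simp add: fx_def H'[OF py] blinfun.add_left blinfun.scaleR_left)
      qed
      ultimately show "((\<lambda>y. f y t) has_derivative blinfun_apply (fx y t)) (at y within ball a r)"
        by (simp only:)
    next
      fix y assume y: "y \<in> ball a r"
      have "continuous_on (cbox 0 1) (p y)" unfolding p_def by (intro continuous_intros)
      then have "continuous_on (cbox 0 1) (\<lambda>t. \<alpha> (p y t))"
        by (rule continuous_on_compose2[OF cont\<alpha>]) (use p y in auto)
      then have "continuous_on (cbox 0 1) (f y)"
        unfolding f_def by (intro continuous_intros)
      then show "f y integrable_on cbox 0 1" by (rule integrable_continuous)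
    next
      show "continuous_on (ball a r \<times> cbox 0 1) (\<lambda>(x, t). fx x t)"
        unfolding fx_def split_beta by (intro continuous_intros cp\<alpha> cpH)
    qed
    moreover have "integral (cbox 0 1) (fx x) = \<alpha> x"
    proof -
      have "(fx x has_integral (1 *\<^sub>R \<alpha> (p x 1) - 0 *\<^sub>R \<alpha> (p x 0))) {0..1}"
      proof (rule fundamental_theorem_of_calculus)
        fix t :: real assume t: "t \<in> {0..1}"
        have "((p x) has_derivative (\<lambda>s. s *\<^sub>R (x - a))) (at t within {0..1})"
          unfolding p_def by (auto intro!: derivative_eq_intros)
        then have "((\<lambda>t. \<alpha> (p x t)) has_derivative (\<lambda>s. H (p x t) (s *\<^sub>R (x - a)))) (at t within {0..1})"
          by (rule has_derivative_compose) (intro der p x t)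
        moreover have "H (p x t) (s *\<^sub>R (x - a)) = s *\<^sub>R H' (p x t) (x - a)" for s
          unfolding H'[OF p[OF x t], symmetric] by (rule blinfun.scaleR_right)
        ultimately have "((\<lambda>t. \<alpha> (p x t)) has_vector_derivative (H' (p x t) (x - a))) (at t within {0..1})"
          by (simp add: has_vector_derivative_def)
        from has_vector_derivative_scaleR[OF DERIV_ident this]
        show "((\<lambda>t. t *\<^sub>R \<alpha> (p x t)) has_vector_derivative fx x t) (at t within {0..1})"
          by (simp add: fx_def add.commute)
      qed simp
      then show ?thesis by (simp add: p_def integral_unique)
    qed
    ultimately show ?thesis
      by (simp only: at_within_open[OF x open_ball])
  qed
  show thesis by (rule that[OF d])
qed

section \<open>Change of variables for arbitrary finite index types\<close>

text \<open>The change of variables theorem of the library needs a well-ordered index type. Every finite type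
  has a copy with a well-order, and Lebesgue measure and determinants are invariant under reindexing.\<close>

typedef 'a wo = "UNIV :: 'a set" morphisms un_wo mk_wo by simp

lemma bij_un_wo: "bij un_wo"
  by (metis UNIV_I bijI' mk_wo_inverse un_wo_inject)

instance wo :: (finite) finite
proof
  have "finite (un_wo -` UNIV :: 'a wo set)"
    by (rule finite_vimageI) (use bij_un_wo in \<open>auto simp: bij_def\<close>)
  then show "finite (UNIV :: 'a wo set)" by simp
qed

definition wo_index :: "'a::finite wo \<Rightarrow> nat" where
  "wo_index = (SOME f. inj f)"

lemma inj_wo_index: "inj (wo_index :: 'a::finite wo \<Rightarrow> nat)"
proof -
  have "\<exists>f :: 'a wo \<Rightarrow> nat. inj f"
    using finite_imp_inj_to_nat_seg[of "UNIV :: 'a wo set"] by auto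
  then show ?thesis unfolding wo_index_def by (rule someI_ex)
qed

instantiation wo :: (finite) wellorder
begin

definition less_eq_wo :: "'a wo \<Rightarrow> 'a wo \<Rightarrow> bool" where
  "less_eq_wo x y \<longleftrightarrow> wo_index x \<le> wo_index y"

definition less_wo :: "'a wo \<Rightarrow> 'a wo \<Rightarrow> bool" where
  "less_wo x y \<longleftrightarrow> wo_index x < wo_index y"

instance
proof
  fix P :: "'a wo \<Rightarrow> bool" and a
  assume *: "\<And>x. (\<And>y. y < x \<Longrightarrow> P y) \<Longrightarrow> P x"
  show "P a"
    by (induction a rule: measure_induct_rule[of wo_index]) (rule *, simp add: less_wo_def)
qed (auto simp: less_eq_wo_def less_wo_def dest: injD[OF inj_wo_index])

end

section \<open>Relabelling coordinates\<close>

definition reindex :: "('b \<Rightarrow> 'a) \<Rightarrow> real ^ 'a \<Rightarrow> real ^ 'b" where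
  "reindex r x = (\<chi> j. x $ r j)"

lemma reindex_nth [simp]: "reindex r x $ j = x $ r j"
  by (simp add: reindex_def)

lemma bounded_linear_reindex:
  "bounded_linear (reindex r :: real ^ 'a::finite \<Rightarrow> real ^ 'b::finite)"
  by (intro linear_conv_bounded_linear[THEN iffD1] linearI) (simp_all add: vec_eq_iff)

lemma reindex_measurable [measurable]:
  "(reindex r :: real ^ 'a::finite \<Rightarrow> real ^ 'b::finite) \<in> borel_measurable borel"
  by (intro borel_measurable_continuous_onI linear_continuous_on bounded_linear_reindex)

lemma reindex_inverse:
  fixes r :: "'b::finite \<Rightarrow> 'a::finite"
  assumes "bij r"
  shows "reindex (inv_into UNIV r) (reindex r x) = x" "reindex r (reindex (inv_into UNIV r) y) = y"
  using assms by (simp_all add: vec_eq_iff bij_def surj_f_inv_f inv_f_f)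

text \<open>Reindexing takes boxes to boxes with permuted side lengths, and the values on boxes
  determine Lebesgue measure.\<close>

lemma distr_lborel_reindex:
  fixes r :: "'b::finite \<Rightarrow> 'a::finite"
  assumes r: "bij r"
  shows "distr lborel borel (reindex r) = (lborel :: (real ^ 'b) measure)"
proof (rule lborel_eqI[symmetric])
  fix l u :: "real ^ 'b"
  assume lu: "\<And>b. b \<in> Basis \<Longrightarrow> l \<bullet> b \<le> u \<bullet> b"
  define s where "s = reindex (inv_into UNIV r)"
  have le: "l $ j \<le> u $ j" for j
    using lu[of "axis j 1"] by (simp add: inner_axis axis_in_Basis_iff)
  have pb: "(\<Prod>b\<in>Basis. y \<bullet> b) = (\<Prod>j\<in>UNIV. y $ j)" for y :: "real ^ 'c::finite"
    unfolding Basis_vec_def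
    by (subst prod.reindex_cong[of "\<lambda>j. axis j 1" UNIV _ "\<lambda>b. y \<bullet> b" "\<lambda>j. y $ j"])
      (auto simp: inj_on_def axis_eq_axis inner_axis)
  have "reindex r -` box l u = box (s l) (s u)"
  proof -
    have "reindex r x \<in> box l u \<longleftrightarrow> x \<in> box (s l) (s u)" for x
      unfolding mem_box_cart s_def using r
      by (metis reindex_nth bij_inv_eq_iff)
    then show ?thesis by auto
  qed
  then have "emeasure (distr lborel borel (reindex r)) (box l u) = emeasure lborel (box (s l) (s u))"
    by (simp add: emeasure_distr)
  also have "\<dots> = (\<Prod>b\<in>Basis. (s u - s l) \<bullet> b)"
    by (rule emeasure_lborel_box) (use le in \<open>auto simp: Basis_vec_def inner_axis s_def\<close>)
  also have "(\<Prod>b\<in>Basis. (s u - s l) \<bullet> b) = (\<Prod>i\<in>UNIV. (u - l) $ inv_into UNIV r i)"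
    unfolding pb by (simp add: s_def)
  also have "\<dots> = (\<Prod>j\<in>UNIV. (u - l) $ j)"
    by (rule prod.reindex_bij_betw) (use r bij_imp_bij_inv in auto)
  finally show "emeasure (distr lborel borel (reindex r)) (box l u) = (\<Prod>b\<in>Basis. (u - l) \<bullet> b)"
    unfolding pb .
qed simp

text \<open>Induction over transpositions: conjugation by \<open>r\<close> turns the transposition
  of two points into the transposition of their preimages under \<open>r\<close>.\<close>

lemma sign_conjugate:
  fixes r :: "'b::finite \<Rightarrow> 'a::finite"
  assumes r: "bij r" and p: "p permutes UNIV"
  shows "sign (inv_into UNIV r \<circ> p \<circ> r) = sign p"
  using p finite
proof (induction rule: permutes_induct)
  case id
  have "inv_into UNIV r \<circ> id \<circ> r = id" using r by (simp add: bij_def fun_eq_iff inv_f_f)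
  then show ?case by simp
next
  case (swap a b p)
  have ri: "r (inv_into UNIV r x) = x" "inv_into UNIV r (r y) = y" for x y
    using r by (simp_all add: bij_def surj_f_inv_f inv_f_f)
  have "inv_into UNIV r \<circ> (Transposition.transpose a b \<circ> p) \<circ> r
      = Transposition.transpose (inv_into UNIV r a) (inv_into UNIV r b) \<circ> (inv_into UNIV r \<circ> p \<circ> r)"
    by (auto simp: fun_eq_iff Transposition.transpose_def ri) (metis ri(1))+
  moreover have "inv_into UNIV r a \<noteq> inv_into UNIV r b" using \<open>a \<noteq> b\<close> by (metis ri(1))
  moreover have "permutation (inv_into UNIV r \<circ> p \<circ> r)"
  proof -
    have "bij (inv_into UNIV r \<circ> p \<circ> r)"
      by (intro bij_comp r bij_imp_bij_inv permutes_bij[OF \<open>p permutes UNIV\<close>])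
    then show ?thesis by (simp add: permutation finite)
  qed
  moreover have "permutation p" using permutes_bij[OF \<open>p permutes UNIV\<close>] by (simp add: permutation finite)
  ultimately show ?case
    using swap.IH \<open>a \<noteq> b\<close>
    by (simp only: sign_compose[OF permutation_swap_id] sign_swap_id if_False)
qed

text \<open>Conjugation by \<open>r\<close> is a sign preserving bijection between the permutations
  of the two index types, and it matches the Leibniz expansions term by term.\<close>

lemma det_reindex:
  fixes r :: "'b::finite \<Rightarrow> 'a::finite" and M :: "real ^ 'a ^ 'a"
  assumes r: "bij r"
  shows "det (\<chi> i j. M $ r i $ r j) = det M"
proof -
  have ri: "r (inv_into UNIV r x) = x" "inv_into UNIV r (r y) = y" for x y
    using r by (simp_all add: bij_def surj_f_inv_f inv_f_f)
  define c where "c = (\<lambda>p. inv_into UNIV r \<circ> p \<circ> r)"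
  have c: "bij_betw c {p. p permutes UNIV} {p. p permutes UNIV}"
  proof (rule bij_betwI[where g = "\<lambda>q. r \<circ> q \<circ> inv_into UNIV r"])
    show "c \<in> {p. p permutes UNIV} \<rightarrow> {p. p permutes UNIV}"
       by (auto simp: c_def intro!: bij_imp_permutes bij_comp r bij_imp_bij_inv permutes_bij)
    show "(\<lambda>q. r \<circ> q \<circ> inv_into UNIV r) \<in> {p. p permutes UNIV} \<rightarrow> {p. p permutes UNIV}"
      by (auto intro!: bij_imp_permutes bij_comp r bij_imp_bij_inv permutes_bij)
  qed (auto simp: c_def fun_eq_iff ri)
  have "det (\<chi> i j. M $ r i $ r j)
      = (\<Sum>p | p permutes UNIV. of_int (sign (c p)) * (\<Prod>i\<in>UNIV. M $ r i $ r (c p i)))"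
    unfolding det_def by (subst sum.reindex_bij_betw[OF c, symmetric]) simp
  also have "\<dots> = (\<Sum>p | p permutes UNIV. of_int (sign p) * (\<Prod>i\<in>UNIV. M $ i $ p i))"
  proof (rule sum.cong)
    fix p assume "p \<in> {p. p permutes (UNIV :: 'a set)}"
    then have "sign (c p) = sign p" using sign_conjugate[OF r] by (simp add: c_def)
    moreover have "(\<Prod>i\<in>UNIV. M $ r i $ r (c p i)) = (\<Prod>i\<in>UNIV. M $ r i $ p (r i))"
      by (simp add: c_def ri)
    moreover have "\<dots> = (\<Prod>i\<in>UNIV. M $ i $ p i)"
      by (rule prod.reindex_bij_betw) (rule r)
    ultimately show "of_int (sign (c p)) * (\<Prod>i\<in>UNIV. M $ r i $ r (c p i))
        = of_int (sign p) * (\<Prod>i\<in>UNIV. M $ i $ p i)" by simp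
  qed simp
  finally show ?thesis by (simp add: det_def)
qed

text \<open>The image is the preimage under the continuous inverse, taken within
  \<open>V\<close>.\<close>

lemma homeomorphism_image_borel:
  fixes f :: "'a::topological_space \<Rightarrow> 'b::topological_space"
  assumes hom: "homeomorphism U V f k" and UV: "U \<in> sets borel" "V \<in> sets borel"
    and B: "B \<in> sets borel" "B \<subseteq> U"
  shows "f ` B \<in> sets borel"
proof -
  have "f ` B = k -` B \<inter> V"
    using hom B(2) by (force simp: homeomorphism_def image_iff subset_iff)
  moreover have "k -` B \<inter> space (restrict_space borel V) \<in> sets (restrict_space borel V)"
    using borel_measurable_continuous_on_restrict[OF homeomorphism_cont2[OF hom]] B(1)
    by (rule measurable_sets)
  ultimately show ?thesis
    using UV(2) by (simp add: space_restrict_space sets_restrict_space_iff)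
qed

text \<open>Invariance of domain makes \<open>T\<close> a homeomorphism onto an open set.\<close>

lemma inj_open_map_image_borel:
  fixes T :: "'a::euclidean_space \<Rightarrow> 'a"
  assumes "open U" "continuous_on U T" "inj_on T U" "S \<in> sets borel" "S \<subseteq> U"
  shows "T ` S \<in> sets borel"
proof -
  obtain k where k: "homeomorphism U (T ` U) T k"
    using invariance_of_domain_homeomorphism[OF assms(1,2) order_refl assms(3)] .
  have "open (T ` U)" using invariance_of_domain[OF assms(2,1,3)] .
  then show ?thesis
    using homeomorphism_image_borel[OF k _ _ assms(4,5)] assms(1) by auto
qed

text \<open>Both sides may be infinite. \<open>S\<close> is therefore exhausted by sets on which the
  norm and the Jacobian are bounded; there the change of variables theorem for sets of finite
  measure applies, and both sides pass to the limit along the increasing sequence.\<close>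

lemma emeasure_image_wellorder:
  fixes T :: "real ^ 'n::{finite,wellorder} \<Rightarrow> real ^ 'n::_"
  assumes U: "open U" and T: "\<And>x. x \<in> U \<Longrightarrow> (T has_derivative T' x) (at x)"
    and inj: "inj_on T U" and cont: "continuous_on U (\<lambda>x. det (matrix (T' x)))"
    and S: "S \<in> sets borel" "S \<subseteq> U"
  shows "emeasure lborel (T ` S) = (\<integral>\<^sup>+x\<in>S. ennreal \<bar>det (matrix (T' x))\<bar> \<partial>lborel)"
proof -
  \<comment> \<open>Extension by 0 outside \<open>U\<close>, where \<open>T'\<close> is arbitrary,
    gives a Borel function on the whole space.\<close>
  define D where "D = (\<lambda>x. indicator U x * \<bar>det (matrix (T' x))\<bar>)"
  have D_meas [measurable]: "D \<in> borel_measurable borel"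
    unfolding D_def
    using borel_measurable_continuous_on_indicator[OF _ continuous_on_rabs[OF cont]] U by simp
  have contT: "continuous_on U T"
    by (rule continuous_at_imp_continuous_on) (use T has_derivative_continuous in blast)
  define Sn where "Sn = (\<lambda>n::nat. {x \<in> S. norm x \<le> n \<and> D x \<le> n})"
  have Sn_meas: "Sn n \<in> sets borel" for n
    unfolding Sn_def using S(1) by measurable
  have Sn_sub: "Sn n \<subseteq> S" "Sn n \<subseteq> U" for n using S(2) by (auto simp: Sn_def)
  have Sn_inc: "incseq Sn" unfolding incseq_def Sn_def by (auto intro: order_trans)
  have Sn_Un: "(\<Union>n. Sn n) = S"
  proof
    show "S \<subseteq> (\<Union>n. Sn n)"
    proof
      fix x assume "x \<in> S"
      obtain n :: nat where "max (norm x) (D x) \<le> n" using real_arch_simple by blast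
      then show "x \<in> (\<Union>n. Sn n)" using \<open>x \<in> S\<close> by (auto simp: Sn_def)
    qed
  qed (use Sn_sub in auto)
  have D_nonneg: "0 \<le> D x" for x by (simp add: D_def)
  have TB: "T ` B \<in> sets borel" if "B \<in> sets borel" "B \<subseteq> U" for B
    by (rule inj_open_map_image_borel[OF U contT inj that])
  have step: "emeasure lborel (T ` Sn n) = emeasure (density lborel D) (Sn n)" for n
  proof -
    have eq: "emeasure (density lborel D) (Sn n) = (\<integral>\<^sup>+x. ennreal (D x * indicator (Sn n) x) \<partial>lborel)"
      using Sn_meas by (subst emeasure_density) (auto intro!: nn_integral_cong split: split_indicator)
    obtain K where K: "K = cball 0 (real n)" "Sn n \<subseteq> K" by (force simp: Sn_def)
    have "(\<integral>\<^sup>+x. ennreal (D x * indicator (Sn n) x) \<partial>lborel)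
        \<le> (\<integral>\<^sup>+x. ennreal (real n) * indicator K x \<partial>lborel)"
      using K(2) by (intro nn_integral_mono) (auto simp: Sn_def split: split_indicator intro!: ennreal_leI)
    also have "\<dots> = ennreal (real n) * emeasure lborel K"
      by (subst nn_integral_cmult_indicator) (auto simp: K(1))
    also have "\<dots> < \<infinity>"
      using emeasure_bounded_finite[of K] by (auto simp: K(1) ennreal_mult_less_top)
    finally have fin: "(\<integral>\<^sup>+x. ennreal (D x * indicator (Sn n) x) \<partial>lborel) < \<infinity>" .
    have meas: "(\<lambda>x. D x * indicator (Sn n) x) \<in> borel_measurable borel"
      using Sn_meas by measurable
    define m where "m = integral UNIV (\<lambda>x. D x * indicator (Sn n) x)"
    have int: "((\<lambda>x. D x * indicator (Sn n) x) has_integral m) UNIV"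
      unfolding m_def
      by (rule integrable_integral, rule nn_integral_integrable_on[OF meas _ fin]) (simp add: D_nonneg)
    have val: "(\<integral>\<^sup>+x. ennreal (D x * indicator (Sn n) x) \<partial>lborel) = ennreal m"
      unfolding m_def by (rule nn_integral_lborel_eq_integral[OF meas _ fin]) (simp add: D_nonneg)
    have "(\<lambda>x. D x * indicator (Sn n) x) = (\<lambda>x. if x \<in> Sn n then \<bar>det (matrix (T' x))\<bar> else 0)"
      using Sn_sub(2)[of n] by (auto simp: fun_eq_iff D_def split: split_indicator)
    then have "((\<lambda>x. \<bar>det (matrix (T' x))\<bar>) has_integral m) (Sn n)"
      using int by (simp add: has_integral_restrict_UNIV)
    then have *: "T ` Sn n \<in> lmeasurable \<and> measure lebesgue (T ` Sn n) = m"
      using Sn_meas T Sn_sub(2)[of n]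
      by (subst has_measure_differentiable_image[where f' = T'])
        (auto intro: has_derivative_at_withinI inj_on_subset[OF inj])
    then have "emeasure lebesgue (T ` Sn n) = ennreal m"
      by (metis emeasure_eq_measure2)
    moreover have "emeasure lebesgue (T ` Sn n) = emeasure lborel (T ` Sn n)"
      using TB[OF Sn_meas Sn_sub(2)] by (simp add: emeasure_completion)
    ultimately show ?thesis using eq val by simp
  qed
  have "emeasure lborel (T ` S) = emeasure lborel (\<Union>n. T ` Sn n)"
    using Sn_Un by (simp add: image_UN[symmetric])
  also have "\<dots> = (SUP n. emeasure lborel (T ` Sn n))"
    by (rule SUP_emeasure_incseq[symmetric])
      (use TB[OF Sn_meas Sn_sub(2)] Sn_inc in \<open>auto simp: incseq_def image_mono\<close>)
  also have "\<dots> = (SUP n. emeasure (density lborel D) (Sn n))" by (simp add: step)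
  also have "\<dots> = emeasure (density lborel D) (\<Union>n. Sn n)"
    by (rule SUP_emeasure_incseq) (use Sn_meas Sn_inc in auto)
  also have "\<dots> = (\<integral>\<^sup>+x\<in>S. ennreal \<bar>det (matrix (T' x))\<bar> \<partial>lborel)"
    unfolding Sn_Un using S
    by (subst emeasure_density, measurable) (auto intro!: nn_integral_cong simp: D_def split: split_indicator)
  finally show ?thesis .
qed

lemma emeasure_image_reindex:
  fixes r :: "'b::finite \<Rightarrow> 'a::finite" and B :: "(real ^ 'a) set"
  assumes r: "bij r" and B: "B \<in> sets borel"
  shows "emeasure lborel (reindex r ` B) = emeasure lborel B"
proof -
  have "reindex r ` B = reindex (inv_into UNIV r) -` B"
    using reindex_inverse[OF r] by (auto simp: image_iff) metis
  also have "emeasure lborel \<dots> = emeasure (distr lborel borel (reindex (inv_into UNIV r))) B"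
    using B by (simp add: emeasure_distr)
  also have "\<dots> = emeasure lborel B"
    by (simp add: distr_lborel_reindex[OF bij_imp_bij_inv[OF r]])
  finally show ?thesis .
qed

text \<open>Conjugating \<open>T\<close> with the relabelling of coordinates moves the statement to
  a well-ordered index type. The Jacobian matrix is only reindexed, so \<open>det_reindex\<close>
  keeps its determinant.\<close>

theorem emeasure_differentiable_image:
  fixes T :: "real ^ 'n::finite \<Rightarrow> real ^ 'n"
  assumes U: "open U" and T: "\<And>x. x \<in> U \<Longrightarrow> (T has_derivative T' x) (at x)"
    and inj: "inj_on T U" and cont: "continuous_on U (\<lambda>x. det (matrix (T' x)))"
    and S: "S \<in> sets borel" "S \<subseteq> U"
  shows "emeasure lborel (T ` S) = (\<integral>\<^sup>+x\<in>S. ennreal \<bar>det (matrix (T' x))\<bar> \<partial>lborel)"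
proof -
  define r where "r = (un_wo :: 'n wo \<Rightarrow> 'n)"
  have r: "bij r" by (simp add: r_def bij_un_wo)
  define e where "e = (reindex r :: real ^ 'n \<Rightarrow> real ^ 'n wo)"
  define d where "d = (reindex (inv_into UNIV r) :: real ^ 'n wo \<Rightarrow> real ^ 'n)"
  have de [simp]: "d (e x) = x" "e (d y) = y" for x y
    using reindex_inverse[OF r] by (simp_all add: d_def e_def)
  have bl: "bounded_linear e" "bounded_linear d"
    by (simp_all add: d_def e_def bounded_linear_reindex)
  define W where "W = e \<circ> T \<circ> d"
  define W' where "W' = (\<lambda>y. e \<circ> T' (d y) \<circ> d)"
  have eU: "e ` U = d -` U" by (auto simp: image_iff) (metis de(2))
  have W: "(W has_derivative W' y) (at y)" if "y \<in> e ` U" for y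
  proof -
    have "(T has_derivative T' (d y)) (at (d y))" using that by (intro T) auto
    then have "((T \<circ> d) has_derivative T' (d y) \<circ> d) (at y)"
      using diff_chain_at[of d d y T] bounded_linear_imp_has_derivative[OF bl(2)] by blast
    then show ?thesis
      unfolding W_def W'_def
      using diff_chain_at[of "T \<circ> d" "T' (d y) \<circ> d" y e e] bounded_linear_imp_has_derivative[OF bl(1)]
      by (simp add: o_assoc)
  qed
  have dt: "det (matrix (W' y)) = det (matrix (T' (d y)))" for y
  proof -
    have *: "d (axis j 1) = axis (r j) 1" for j
      unfolding d_def using r by (auto simp: vec_eq_iff axis_def bij_def surj_f_inv_f inv_f_f)
    then have "matrix (W' y) = (\<chi> i j. matrix (T' (d y)) $ r i $ r j)"
      by (simp add: matrix_def W'_def e_def * vec_eq_iff[of "vec_lambda _"])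
    then show ?thesis using det_reindex[OF r] by metis
  qed
  have eS: "e ` S \<in> sets borel"
  proof -
    have "e ` S = d -` S" by (auto simp: image_iff) (metis de(2))
    moreover have "d -` S \<inter> space borel \<in> sets borel"
      by (rule measurable_sets[OF _ S(1)]) (simp add: d_def)
    ultimately show ?thesis by simp
  qed
  have contT: "continuous_on U T"
    by (rule continuous_at_imp_continuous_on) (use T has_derivative_continuous in blast)
  have "emeasure lborel (T ` S) = emeasure lborel (e ` T ` S)"
    unfolding e_def
    by (rule emeasure_image_reindex[OF r, symmetric]) (rule inj_open_map_image_borel[OF U contT inj S])
  also have "e ` T ` S = W ` e ` S" by (auto simp: W_def image_iff)
  also have "emeasure lborel (W ` e ` S) = (\<integral>\<^sup>+y\<in>e ` S. ennreal \<bar>det (matrix (W' y))\<bar> \<partial>lborel)"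
  proof (rule emeasure_image_wellorder[where U = "e ` U"])
    show "open (e ` U)"
      unfolding eU by (rule open_vimage[OF U linear_continuous_on[OF bl(2)]])
    show "inj_on W (e ` U)"
    proof (rule inj_onI)
      fix x y assume "x \<in> e ` U" "y \<in> e ` U" "W x = W y"
      then have "T (d x) = T (d y)" "d x \<in> U" "d y \<in> U"
        using de(1) by (auto simp: W_def) (metis de(1))
      then have "d x = d y" using inj by (simp add: inj_on_def)
      then show "x = y" by (metis de(2))
    qed
    show "continuous_on (e ` U) (\<lambda>x. det (matrix (W' x)))"
      unfolding dt
      by (rule continuous_on_compose2[OF cont linear_continuous_on[OF bl(2)]]) auto
  qed (use W eS S in auto)
  also have "\<dots> = (\<integral>\<^sup>+y. ennreal \<bar>det (matrix (T' (d y)))\<bar> * indicator S (d y) \<partial>lborel)"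
    by (intro nn_integral_cong) (auto simp: dt split: split_indicator, metis de(2) imageI)
  also have "\<dots> = (\<integral>\<^sup>+y. ennreal (indicator U (d y) * \<bar>det (matrix (T' (d y)))\<bar>) * indicator S (d y) \<partial>lborel)"
    using S(2) by (intro nn_integral_cong) (auto split: split_indicator)
  also have "\<dots> = (\<integral>\<^sup>+x. ennreal (indicator U x * \<bar>det (matrix (T' x))\<bar>) * indicator S x
      \<partial>distr lborel borel d)"
  proof -
    have "(\<lambda>x. indicator U x * \<bar>det (matrix (T' x))\<bar>) \<in> borel_measurable borel"
      using borel_measurable_continuous_on_indicator[OF _ continuous_on_rabs[OF cont]] U by simp
    then have "(\<lambda>x. ennreal (indicator U x * \<bar>det (matrix (T' x))\<bar>) * indicator S x) \<in> borel_measurable borel"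
      using S(1) by measurable
    then show ?thesis
      by (subst nn_integral_distr) (simp_all add: d_def)
  qed
  also have "distr lborel borel d = lborel"
    unfolding d_def by (rule distr_lborel_reindex[OF bij_imp_bij_inv[OF r]])
  also have "(\<integral>\<^sup>+x. ennreal (indicator U x * \<bar>det (matrix (T' x))\<bar>) * indicator S x \<partial>lborel)
      = (\<integral>\<^sup>+x\<in>S. ennreal \<bar>det (matrix (T' x))\<bar> \<partial>lborel)"
    using S(2) by (intro nn_integral_cong) (auto split: split_indicator)
  finally show ?thesis .
qed

text \<open>The measure on \<open>S\<close> whose density is the absolute Jacobian is pushed forward
  by \<open>T\<close> to Lebesgue measure on the image of \<open>S\<close>. On sets this is
  \<open>emeasure_differentiable_image\<close>, and equality of measures gives equality of
  integrals.\<close>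

corollary nn_integral_differentiable_image:
  fixes T :: "real ^ 'n::finite \<Rightarrow> real ^ 'n" and f :: "real ^ 'n \<Rightarrow> ennreal"
  assumes U: "open U" and T: "\<And>x. x \<in> U \<Longrightarrow> (T has_derivative T' x) (at x)"
    and inj: "inj_on T U" and cont: "continuous_on U (\<lambda>x. det (matrix (T' x)))"
    and S: "S \<in> sets borel" "S \<subseteq> U" and f [measurable]: "f \<in> borel_measurable borel"
  shows "(\<integral>\<^sup>+y\<in>T ` S. f y \<partial>lborel) = (\<integral>\<^sup>+x\<in>S. f (T x) * ennreal \<bar>det (matrix (T' x))\<bar> \<partial>lborel)"
proof -
  define D where "D = (\<lambda>x. indicator U x * \<bar>det (matrix (T' x))\<bar>)"
  have D_meas [measurable]: "D \<in> borel_measurable borel"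
    unfolding D_def
    using borel_measurable_continuous_on_indicator[OF _ continuous_on_rabs[OF cont]] U by simp
  have contT: "continuous_on U T"
    by (rule continuous_at_imp_continuous_on) (use T has_derivative_continuous in blast)
  \<comment> \<open>\<open>R\<close> agrees with \<open>T\<close> on \<open>U\<close> and is 0
    elsewhere, hence Borel on the whole space, as the image measure requires.\<close>
  define R where "R = (\<lambda>x. indicator U x *\<^sub>R T x)"
  have R_meas [measurable]: "R \<in> borel_measurable borel"
    unfolding R_def using borel_measurable_continuous_on_indicator[OF _ contT] U by simp
  have S_meas [measurable]: "S \<in> sets borel" by (rule S)
  have TS [measurable]: "T ` S \<in> sets borel" by (rule inj_open_map_image_borel[OF U contT inj S])
  have "distr (density lborel (\<lambda>x. ennreal (D x) * indicator S x)) borel R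
      = density lborel (indicator (T ` S))"
  proof (rule measure_eqI)
    fix B :: "(real ^ 'n) set" assume "B \<in> sets (distr (density lborel (\<lambda>x. ennreal (D x) * indicator S x)) borel R)"
    then have B [measurable]: "B \<in> sets borel" by simp
    have SB: "S \<inter> R -` B \<in> sets borel" "S \<inter> R -` B \<subseteq> U"
      using S measurable_sets[OF R_meas B] by auto
    have "emeasure (distr (density lborel (\<lambda>x. ennreal (D x) * indicator S x)) borel R) B
        = (\<integral>\<^sup>+x. ennreal (D x) * indicator S x * indicator (R -` B) x \<partial>lborel)"
      using measurable_sets[OF R_meas B] by (simp add: emeasure_distr emeasure_density)
    also have "\<dots> = (\<integral>\<^sup>+x\<in>S \<inter> R -` B. ennreal \<bar>det (matrix (T' x))\<bar> \<partial>lborel)"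
      using S(2) by (intro nn_integral_cong) (auto simp: D_def split: split_indicator)
    also have "\<dots> = emeasure lborel (T ` (S \<inter> R -` B))"
      by (rule emeasure_differentiable_image[OF U T inj cont SB, symmetric])
    also have "T ` (S \<inter> R -` B) = T ` S \<inter> B"
      using S(2) by (auto simp: R_def indicator_def split: if_splits)
    also have "emeasure lborel (T ` S \<inter> B) = emeasure (density lborel (indicator (T ` S))) B"
      by (simp add: emeasure_density indicator_inter_arith[symmetric])
    finally show "emeasure (distr (density lborel (\<lambda>x. ennreal (D x) * indicator S x)) borel R) B
        = emeasure (density lborel (indicator (T ` S))) B" .
  qed simp
  then have "(\<integral>\<^sup>+y. f y \<partial>density lborel (indicator (T ` S)))
      = (\<integral>\<^sup>+y. f y \<partial>distr (density lborel (\<lambda>x. ennreal (D x) * indicator S x)) borel R)"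
    by simp
  also have "\<dots> = (\<integral>\<^sup>+x. (ennreal (D x) * indicator S x) * f (R x) \<partial>lborel)"
    by (simp add: nn_integral_distr nn_integral_density)
  also have "\<dots> = (\<integral>\<^sup>+x\<in>S. f (T x) * ennreal \<bar>det (matrix (T' x))\<bar> \<partial>lborel)"
    using S(2) by (intro nn_integral_cong) (auto simp: D_def R_def mult.commute split: split_indicator)
  finally show ?thesis
    by (simp add: nn_integral_density mult.commute)
qed

section \<open>Charts and the measure of a density\<close>

lemma continuous_on_det_matrix:
  fixes M :: "'a::topological_space \<Rightarrow> real ^ 'n::finite ^ 'n"
  assumes "\<And>i j. continuous_on S (\<lambda>x. M x $ i $ j)"
  shows "continuous_on S (\<lambda>x. det (M x))"
  unfolding det_def by (intro continuous_intros assms)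

locale atlas =
  fixes A :: "('m::{second_countable_topology, t2_space}, 'n::finite) chart set"
  assumes atlas: "oriented_smooth_atlas A"
begin

lemma chart_exists: "\<exists>c\<in>A. p \<in> cdom c"
  using atlas unfolding oriented_smooth_atlas_def by blast

lemma is_chart: "c \<in> A \<Longrightarrow> is_chart c"
  using atlas unfolding oriented_smooth_atlas_def by blast

lemma chart_at: "chart_at A p \<in> A" "p \<in> cdom (chart_at A p)"
proof -
  have "chart_at A p \<in> A \<and> p \<in> cdom (chart_at A p)"
    unfolding chart_at_def by (rule someI_ex) (use chart_exists[of p] in blast)
  then show "chart_at A p \<in> A" "p \<in> cdom (chart_at A p)" by auto
qed

lemma open_cdom: "c \<in> A \<Longrightarrow> open (cdom c)"
  and open_cimg: "c \<in> A \<Longrightarrow> open (cimg c)"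
  and chart_homeomorphism: "c \<in> A \<Longrightarrow> homeomorphism (cdom c) (cimg c) (cmap c) (cinv c)"
  using is_chart unfolding is_chart_def by auto

lemma cinv_cmap: "c \<in> A \<Longrightarrow> p \<in> cdom c \<Longrightarrow> cinv c (cmap c p) = p"
  using chart_homeomorphism by (metis homeomorphism_apply1)

lemma cmap_cinv: "c \<in> A \<Longrightarrow> x \<in> cimg c \<Longrightarrow> cmap c (cinv c x) = x"
  using chart_homeomorphism by (metis homeomorphism_apply2)

lemma cinv_cdom: "c \<in> A \<Longrightarrow> x \<in> cimg c \<Longrightarrow> cinv c x \<in> cdom c"
  using chart_homeomorphism by (metis homeomorphism_image2 image_eqI)

lemma continuous_on_cmap: "c \<in> A \<Longrightarrow> continuous_on (cdom c) (cmap c)"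
  using chart_homeomorphism homeomorphism_cont1 by blast

lemma continuous_on_cinv: "c \<in> A \<Longrightarrow> continuous_on (cimg c) (cinv c)"
  using chart_homeomorphism homeomorphism_cont2 by blast

lemma inj_on_cmap: "c \<in> A \<Longrightarrow> inj_on (cmap c) (cdom c)"
  by (metis cinv_cmap inj_on_inverseI)

lemma open_cdom_preimage: "c \<in> A \<Longrightarrow> open W \<Longrightarrow> open (cdom c \<inter> cmap c -` W)"
  using continuous_on_cmap open_cdom continuous_open_preimage by blast

lemma open_cimg_preimage: "c \<in> A \<Longrightarrow> open V \<Longrightarrow> open (cimg c \<inter> cinv c -` V)"
  using continuous_on_cinv open_cimg continuous_open_preimage by blast

lemma cmap_image_eq:
  assumes "c \<in> A" "V \<subseteq> cdom c"
  shows "cmap c ` V = cimg c \<inter> cinv c -` V"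
proof (intro Set.set_eqI iffI)
  fix x assume "x \<in> cmap c ` V"
  then obtain p where "p \<in> V" "x = cmap c p" by blast
  then show "x \<in> cimg c \<inter> cinv c -` V" using assms cinv_cmap[OF assms(1)] by auto
next
  fix x assume x: "x \<in> cimg c \<inter> cinv c -` V"
  then have "x = cmap c (cinv c x)" using cmap_cinv[OF assms(1)] by simp
  then show "x \<in> cmap c ` V" using x by blast
qed

lemma cinv_image_eq:
  assumes "c \<in> A" "W \<subseteq> cimg c"
  shows "cinv c ` W = cdom c \<inter> cmap c -` W"
proof (intro Set.set_eqI iffI)
  fix p assume "p \<in> cinv c ` W"
  then obtain x where "x \<in> W" "p = cinv c x" by blast
  then show "p \<in> cdom c \<inter> cmap c -` W"
    using assms cinv_cdom[OF assms(1)] cmap_cinv[OF assms(1)] by auto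
next
  fix p assume p: "p \<in> cdom c \<inter> cmap c -` W"
  then have "p = cinv c (cmap c p)" using cinv_cmap[OF assms(1)] by simp
  then show "p \<in> cinv c ` W" using p by blast
qed

lemma open_cmap_image: "c \<in> A \<Longrightarrow> open V \<Longrightarrow> V \<subseteq> cdom c \<Longrightarrow> open (cmap c ` V)"
  by (metis cmap_image_eq open_cimg_preimage)

lemma open_cinv_image: "c \<in> A \<Longrightarrow> open W \<Longrightarrow> W \<subseteq> cimg c \<Longrightarrow> open (cinv c ` W)"
  by (simp only: cinv_image_eq open_cdom_preimage)

lemma transition_smooth:
  "c \<in> A \<Longrightarrow> d \<in> A \<Longrightarrow> smooth_on (transition c d) (cmap c ` (cdom c \<inter> cdom d))"
  using atlas unfolding oriented_smooth_atlas_def by blast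

lemma open_overlap: "c \<in> A \<Longrightarrow> d \<in> A \<Longrightarrow> open (cmap c ` (cdom c \<inter> cdom d))"
  by (simp add: open_cmap_image open_cdom open_Int)

lemma transition_apply: "c \<in> A \<Longrightarrow> p \<in> cdom c \<Longrightarrow> transition c d (cmap c p) = cmap d p"
  by (simp add: transition_def cinv_cmap)

lemma transition_derivative:
  assumes "c \<in> A" "d \<in> A" "p \<in> cdom c" "p \<in> cdom d"
  shows "(transition c d has_derivative dtransition c d (cmap c p)) (at (cmap c p))"
  unfolding dtransition_def
  by (rule smooth_on_has_derivative[OF transition_smooth[OF assms(1,2)]]) (use assms in auto)

lemma dtransition_det_pos:
  assumes "c \<in> A" "d \<in> A" "p \<in> cdom c" "p \<in> cdom d"
  shows "det (matrix (dtransition c d (cmap c p))) > 0"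
  using atlas assms unfolding oriented_smooth_atlas_def by blast

lemma linear_dtransition:
  assumes "c \<in> A" "d \<in> A" "p \<in> cdom c" "p \<in> cdom d"
  shows "linear (dtransition c d (cmap c p))"
  using transition_derivative[OF assms] has_derivative_linear by blast

lemma continuous_on_dtransition:
  assumes "c \<in> A" "d \<in> A"
  shows "continuous_on (cmap c ` (cdom c \<inter> cdom d)) (\<lambda>x. dtransition c d x v)"
  unfolding dtransition_def by (rule smooth_on_continuous_derivative[OF transition_smooth[OF assms]])

lemma continuous_on_det_dtransition:
  assumes "c \<in> A" "d \<in> A"
  shows "continuous_on (cmap c ` (cdom c \<inter> cdom d)) (\<lambda>x. det (matrix (dtransition c d x)))"
  by (rule continuous_on_det_matrix)
    (simp add: matrix_def continuous_on_dtransition[OF assms] continuous_on_component)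

lemma dtransition_inverse:
  assumes "c \<in> A" "d \<in> A" "p \<in> cdom c" "p \<in> cdom d"
  shows "dtransition d c (cmap d p) (dtransition c d (cmap c p) v) = v"
proof -
  have "(transition d c has_derivative dtransition d c (cmap d p)) (at (transition c d (cmap c p)))"
    using transition_derivative[OF assms(2,1,4,3)] assms by (simp add: transition_apply)
  from diff_chain_at[OF transition_derivative[OF assms] this]
  have 1: "(transition d c \<circ> transition c d has_derivative
      dtransition d c (cmap d p) \<circ> dtransition c d (cmap c p)) (at (cmap c p))" .
  have "(transition d c \<circ> transition c d has_derivative (\<lambda>x. x)) (at (cmap c p))"
    by (rule has_derivative_transform_within_open[OF has_derivative_ident open_overlap[OF assms(1,2)]])
      (use assms in \<open>auto simp: transition_apply\<close>)
  from has_derivative_unique[OF 1 this] show ?thesis by (metis comp_apply)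
qed

lemma chart_image_borel:
  assumes "c \<in> A" "B \<in> sets borel" "B \<subseteq> cdom c"
  shows "cmap c ` B \<in> sets borel"
  by (rule homeomorphism_image_borel[OF chart_homeomorphism])
    (use assms open_cdom open_cimg in auto)

text \<open>Both \<open>\<Omega>\<close> and \<open>sqrt (det g)\<close> are of this kind.\<close>

definition compatible_density :: "(('m, 'n) chart \<Rightarrow> real ^ 'n \<Rightarrow> real) \<Rightarrow> bool" where
  "compatible_density \<rho> \<longleftrightarrow>
     (\<forall>c\<in>A. continuous_on (cimg c) (\<rho> c) \<and> (\<forall>x\<in>cimg c. \<rho> c x \<ge> 0)) \<and>
     (\<forall>c\<in>A. \<forall>d\<in>A. \<forall>p\<in>cdom c \<inter> cdom d.
        \<rho> c (cmap c p) = \<rho> d (cmap d p) * det (matrix (dtransition c d (cmap c p))))"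

definition local_measure :: "(('m, 'n) chart \<Rightarrow> real ^ 'n \<Rightarrow> real) \<Rightarrow> ('m, 'n) chart \<Rightarrow> 'm set \<Rightarrow> ennreal"
  where "local_measure \<rho> c B = (\<integral>\<^sup>+x\<in>cmap c ` B. ennreal (\<rho> c x) \<partial>lborel)"

lemma density_measurable:
  assumes "compatible_density \<rho>" "c \<in> A"
  shows "(\<lambda>x. indicator (cimg c) x * \<rho> c x) \<in> borel_measurable borel"
  using borel_measurable_continuous_on_indicator[of "cimg c" "\<rho> c"] assms open_cimg
  by (simp add: compatible_density_def)

text \<open>The values of \<open>\<rho> c\<close> outside the chart image are arbitrary. Cutting
  them off gives a Borel density, so \<open>local_measure\<close> comes from a measure and inherits
  its countable additivity.\<close>

lemma local_measure_eq_emeasure: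
  assumes "compatible_density \<rho>" "c \<in> A" "B \<in> sets borel" "B \<subseteq> cdom c"
  shows "local_measure \<rho> c B
    = emeasure (density lborel (\<lambda>x. ennreal (indicator (cimg c) x * \<rho> c x))) (cmap c ` B)"
proof -
  have "cmap c ` B \<subseteq> cimg c" using assms(4) by auto
  then show ?thesis
    using density_measurable[OF assms(1,2)] chart_image_borel[OF assms(2-4)]
    by (auto simp: local_measure_def emeasure_density subset_iff intro!: nn_integral_cong split: split_indicator)
qed

text \<open>The change of variables along the transition produces its Jacobian, which is the factor
  in \<open>compatible_density\<close>. The orientation makes the determinant positive, so its
  absolute value is the determinant itself.\<close>

lemma local_measure_agree:
  assumes \<rho>: "compatible_density \<rho>" and cd: "c \<in> A" "d \<in> A"
    and B: "B \<in> sets borel" "B \<subseteq> cdom c" "B \<subseteq> cdom d"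
  shows "local_measure \<rho> d B = local_measure \<rho> c B"
proof -
  let ?U = "cmap c ` (cdom c \<inter> cdom d)"
  have img: "cmap d ` B = transition c d ` cmap c ` B"
    unfolding image_image by (rule image_cong) (use B transition_apply[OF cd(1), of _ d] in auto)
  have "local_measure \<rho> d B
      = (\<integral>\<^sup>+y\<in>transition c d ` cmap c ` B. ennreal (indicator (cimg d) y * \<rho> d y) \<partial>lborel)"
    unfolding local_measure_def img[symmetric]
    using B(3) by (intro nn_integral_cong) (auto split: split_indicator)
  also have "\<dots> = (\<integral>\<^sup>+x\<in>cmap c ` B. ennreal (indicator (cimg d) (transition c d x) * \<rho> d (transition c d x))
      * ennreal \<bar>det (matrix (dtransition c d x))\<bar> \<partial>lborel)"
  proof (rule nn_integral_differentiable_image[where U = ?U])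
    show "open ?U" by (rule open_overlap[OF cd])
    show "inj_on (transition c d) ?U"
      using inj_on_cmap[OF cd(2)] by (auto simp: inj_on_def transition_apply[OF cd(1)])
    show "continuous_on ?U (\<lambda>x. det (matrix (dtransition c d x)))"
      by (rule continuous_on_det_dtransition[OF cd])
    show "cmap c ` B \<in> sets borel" by (rule chart_image_borel[OF cd(1) B(1,2)])
    show "(\<lambda>y. ennreal (indicator (cimg d) y * \<rho> d y)) \<in> borel_measurable borel"
      using density_measurable[OF \<rho> cd(2)] by simp
    show "cmap c ` B \<subseteq> ?U" using B by blast
    show "(transition c d has_derivative dtransition c d x) (at x)" if "x \<in> ?U" for x
      using transition_derivative[OF cd] that by blast
  qed
  also have "\<dots> = local_measure \<rho> c B"
    unfolding local_measure_def
  proof (rule nn_integral_cong)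
    fix x
    show "ennreal (indicator (cimg d) (transition c d x) * \<rho> d (transition c d x))
      * ennreal \<bar>det (matrix (dtransition c d x))\<bar> * indicator (cmap c ` B) x
      = ennreal (\<rho> c x) * indicator (cmap c ` B) x"
    proof (cases "x \<in> cmap c ` B")
      case True
      then obtain p where p: "p \<in> B" "x = cmap c p" by auto
      with B have pcd: "p \<in> cdom c" "p \<in> cdom d" by auto
      have "\<rho> c (cmap c p) = \<rho> d (cmap d p) * det (matrix (dtransition c d (cmap c p)))"
        using \<rho> cd pcd unfolding compatible_density_def by blast
      moreover have "\<rho> d (cmap d p) \<ge> 0"
        using \<rho> cd pcd unfolding compatible_density_def by blast
      ultimately show ?thesis
        using pcd p(2) dtransition_det_pos[OF cd pcd]
        by (simp add: transition_apply[OF cd(1)] ennreal_mult'' split: split_indicator)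
    qed simp
  qed
  finally show ?thesis .
qed

definition is_density_measure :: "(('m, 'n) chart \<Rightarrow> real ^ 'n \<Rightarrow> real) \<Rightarrow> 'm measure \<Rightarrow> bool" where
  "is_density_measure \<rho> \<mu> \<longleftrightarrow> sets \<mu> = sets borel \<and>
     (\<forall>c\<in>A. \<forall>B\<in>sets borel. B \<subseteq> cdom c \<longrightarrow> emeasure \<mu> B = local_measure \<rho> c B)"

end

locale closed_manifold = atlas +
  assumes compact_M: "compact (UNIV :: 'a set)" and connected_M: "connected (UNIV :: 'a set)"
begin

text \<open>A finite subcover is made disjoint by removing from each chart domain the earlier ones.
  Every Borel set thereby splits into finitely many pieces, each inside a single chart.\<close>

lemma finite_chart_partition:
  obtains C :: "nat \<Rightarrow> ('a, 'b) chart" and P :: "nat \<Rightarrow> 'a set" and N :: nat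
  where "\<And>i. i < N \<Longrightarrow> C i \<in> A" "\<And>i. i < N \<Longrightarrow> P i \<subseteq> cdom (C i)" "\<And>i. i < N \<Longrightarrow> P i \<in> sets borel"
    "disjoint_family_on P {..<N}" "(\<Union>i<N. P i) = UNIV"
proof -
  obtain F where F: "F \<subseteq> A" "finite F" "UNIV \<subseteq> (\<Union>c\<in>F. cdom c)"
    by (rule compactE_image[OF compact_M, of A cdom]) (use open_cdom chart_exists in auto)
  obtain C where C: "bij_betw C {..<card F} F"
    using ex_bij_betw_nat_finite[OF F(2)] by (auto simp: lessThan_atLeast0)
  define P where "P = (\<lambda>i. cdom (C i) - (\<Union>j<i. cdom (C j)))"
  have CA: "C i \<in> A" if "i < card F" for i using C F(1) that by (auto simp: bij_betw_def)
  show thesis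
  proof (rule that[of "card F" C P])
    show "P i \<in> sets borel" if "i < card F" for i
      unfolding P_def using that CA open_cdom
      by (intro sets.Diff sets.countable_UN'') (auto intro: borel_open)
    show "disjoint_family_on P {..<card F}"
      unfolding disjoint_family_on_def
    proof (intro ballI impI)
      fix i j :: nat assume "i \<noteq> j"
      then consider "i < j" | "j < i" by linarith
      then show "P i \<inter> P j = {}" by cases (auto simp: P_def)
    qed
    show "(\<Union>i<card F. P i) = UNIV"
    proof -
      have "\<exists>i<card F. p \<in> P i" for p
      proof -
        obtain c where "c \<in> F" "p \<in> cdom c" using F(3) by blast
        then have "\<exists>i. i < card F \<and> p \<in> cdom (C i)" using C by (force simp: bij_betw_def image_iff)
        then obtain i where i: "i < card F" "p \<in> cdom (C i)"
            "\<And>j. j < i \<Longrightarrow> \<not> (j < card F \<and> p \<in> cdom (C j))"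
          using exists_least_iff[of "\<lambda>i. i < card F \<and> p \<in> cdom (C i)"] by auto
        then show ?thesis by (auto simp: P_def)
      qed
      then show ?thesis by auto
    qed
  qed (use CA in \<open>auto simp: P_def\<close>)
qed

text \<open>This justifies the definite description in \<open>density_measure\<close>. The measure
  is the sum of the local measures of the pieces; for a set inside one chart,
  \<open>local_measure_agree\<close> allows all pieces to be measured in that chart. Since every
  piece lies in some chart, its value is forced.\<close>

lemma density_measure_exists_unique:
  assumes \<rho>: "compatible_density \<rho>"
  shows "\<exists>!\<mu>. is_density_measure \<rho> \<mu>"
proof -
  obtain C P and N :: nat where CP: "\<And>i. i < N \<Longrightarrow> C i \<in> A" "\<And>i. i < N \<Longrightarrow> P i \<subseteq> cdom (C i)"
      "\<And>i. i < N \<Longrightarrow> P i \<in> sets borel" "disjoint_family_on P {..<N}" "(\<Union>i<N. P i) = UNIV"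
    by (rule finite_chart_partition) blast
  define \<nu> where "\<nu> = (\<lambda>c. density lborel (\<lambda>x. ennreal (indicator (cimg c) x * \<rho> c x)))"
  have lm: "local_measure \<rho> c B = emeasure (\<nu> c) (cmap c ` B)"
    if "c \<in> A" "B \<in> sets borel" "B \<subseteq> cdom c" for c B
    unfolding \<nu>_def by (rule local_measure_eq_emeasure[OF \<rho> that])
  have im: "cmap c ` B \<in> sets (\<nu> c)" if "c \<in> A" "B \<in> sets borel" "B \<subseteq> cdom c" for c B
    using chart_image_borel[OF that] by (simp add: \<nu>_def)
  have disj: "cmap c ` B \<inter> cmap c ` B' = {}" if "c \<in> A" "B \<subseteq> cdom c" "B' \<subseteq> cdom c" "B \<inter> B' = {}" for c B B'
    using inj_on_image_Int[OF inj_on_cmap[OF that(1)] that(2,3)] that(4) by simp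
  have BP: "B \<inter> P i \<in> sets borel" "B \<inter> P i \<subseteq> cdom (C i)" if "i < N" "B \<in> sets borel" for B i
    using CP(2,3)[OF that(1)] that(2) by auto
  define m where "m = (\<lambda>B. \<Sum>i<N. local_measure \<rho> (C i) (B \<inter> P i))"
  define \<mu> where "\<mu> = measure_of UNIV (sets borel) m"
  have sets_\<mu>: "sets \<mu> = sets borel"
    unfolding \<mu>_def using sets.sigma_sets_eq[of borel] by simp
  have \<mu>: "emeasure \<mu> B = m B" if "B \<in> sets borel" for B
    unfolding \<mu>_def
  proof (rule emeasure_measure_of_sigma)
    show "sigma_algebra UNIV (sets (borel :: 'a measure))"
      using sets.sigma_algebra_axioms[of borel] by simp
    show "positive (sets borel) m"
      by (simp add: positive_def m_def local_measure_def)
    show "countably_additive (sets borel) m"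
    proof (rule countably_additiveI)
      fix B :: "nat \<Rightarrow> 'a set"
      assume B: "range B \<subseteq> sets borel" "disjoint_family B" "(\<Union>i. B i) \<in> sets borel"
      have *: "(\<Sum>k. local_measure \<rho> (C i) (B k \<inter> P i)) = local_measure \<rho> (C i) ((\<Union>k. B k) \<inter> P i)"
        if i: "i < N" for i
      proof -
        have Bk: "B k \<in> sets borel" for k using B(1) by auto
        have "(\<Sum>k. local_measure \<rho> (C i) (B k \<inter> P i))
            = (\<Sum>k. emeasure (\<nu> (C i)) (cmap (C i) ` (B k \<inter> P i)))"
          using lm[OF CP(1)[OF i] BP[OF i Bk]] by simp
        also have "\<dots> = emeasure (\<nu> (C i)) (\<Union>k. cmap (C i) ` (B k \<inter> P i))"
        proof (rule suminf_emeasure)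
          show "range (\<lambda>k. cmap (C i) ` (B k \<inter> P i)) \<subseteq> sets (\<nu> (C i))"
            using im[OF CP(1)[OF i] BP[OF i Bk]] by (rule image_subsetI)
          show "disjoint_family (\<lambda>k. cmap (C i) ` (B k \<inter> P i))"
            unfolding disjoint_family_on_def
          proof (intro ballI impI)
            fix k l :: nat assume "k \<noteq> l"
            then have "B k \<inter> P i \<inter> (B l \<inter> P i) = {}"
              using B(2) unfolding disjoint_family_on_def by blast
            then show "cmap (C i) ` (B k \<inter> P i) \<inter> cmap (C i) ` (B l \<inter> P i) = {}"
              by (rule disj[OF CP(1)[OF i] BP(2)[OF i Bk] BP(2)[OF i Bk]])
          qed
        qed
        also have "(\<Union>k. cmap (C i) ` (B k \<inter> P i)) = cmap (C i) ` ((\<Union>k. B k) \<inter> P i)" by auto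
        also have "emeasure (\<nu> (C i)) \<dots> = local_measure \<rho> (C i) ((\<Union>k. B k) \<inter> P i)"
          by (rule lm[symmetric, OF CP(1)[OF i] BP[OF i B(3)]])
        finally show ?thesis .
      qed
      have "(\<Sum>k. m (B k)) = (\<Sum>i<N. \<Sum>k. local_measure \<rho> (C i) (B k \<inter> P i))"
        unfolding m_def by (rule suminf_sum) simp
      also have "\<dots> = m (\<Union>i. B i)" unfolding m_def by (intro sum.cong) (auto simp: *)
      finally show "(\<Sum>k. m (B k)) = m (\<Union>i. B i)" .
    qed
  qed (rule that)
  have split: "emeasure M B = (\<Sum>i<N. emeasure M (B \<inter> P i))"
    if "sets M = sets borel" "B \<in> sets borel" for M :: "'a measure" and B
  proof -
    have "(\<Sum>i<N. emeasure M (B \<inter> P i)) = emeasure M (\<Union>i<N. B \<inter> P i)"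
    proof (rule sum_emeasure)
      show "(\<lambda>i. B \<inter> P i) ` {..<N} \<subseteq> sets M" using that CP(3) by auto
      show "disjoint_family_on (\<lambda>i. B \<inter> P i) {..<N}"
        using CP(4) unfolding disjoint_family_on_def by blast
    qed simp
    also have "(\<Union>i<N. B \<inter> P i) = B" using CP(5) by auto
    finally show ?thesis by simp
  qed
  show ?thesis
  proof (rule ex1I)
    have "emeasure \<mu> B = local_measure \<rho> c B" if c: "c \<in> A" and B: "B \<in> sets borel" "B \<subseteq> cdom c" for c B
    proof -
      have "emeasure \<mu> B = (\<Sum>i<N. local_measure \<rho> c (B \<inter> P i))"
        unfolding \<mu>[OF B(1)] m_def
      proof (rule sum.cong)
        fix i assume "i \<in> {..<N}"
        then have i: "i < N" by simp
        show "local_measure \<rho> (C i) (B \<inter> P i) = local_measure \<rho> c (B \<inter> P i)"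
          by (rule local_measure_agree[OF \<rho> c CP(1)[OF i] BP(1)[OF i B(1)] _ BP(2)[OF i B(1)]])
            (use B(2) in blast)
      qed simp
      also have "\<dots> = (\<Sum>i<N. emeasure (\<nu> c) (cmap c ` (B \<inter> P i)))"
        using lm[OF c BP(1)[OF _ B(1)]] B(2) by (intro sum.cong) auto
      also have "\<dots> = emeasure (\<nu> c) (\<Union>i<N. cmap c ` (B \<inter> P i))"
      proof (rule sum_emeasure)
        show "(\<lambda>i. cmap c ` (B \<inter> P i)) ` {..<N} \<subseteq> sets (\<nu> c)"
        proof (rule image_subsetI)
          show "cmap c ` (B \<inter> P i) \<in> sets (\<nu> c)" if "i \<in> {..<N}" for i
            using im[OF c BP(1)[OF _ B(1)]] B(2) that by auto
        qed
        show "disjoint_family_on (\<lambda>i. cmap c ` (B \<inter> P i)) {..<N}"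
          unfolding disjoint_family_on_def
        proof (intro ballI impI)
          fix k l assume "k \<in> {..<N}" "l \<in> {..<N}" "k \<noteq> l"
          then have "B \<inter> P k \<inter> (B \<inter> P l) = {}"
            using CP(4) unfolding disjoint_family_on_def by blast
          then show "cmap c ` (B \<inter> P k) \<inter> cmap c ` (B \<inter> P l) = {}"
            using B(2) by (intro disj[OF c]) auto
        qed
      qed simp
      also have "(\<Union>i<N. cmap c ` (B \<inter> P i)) = cmap c ` B" using CP(5) by blast
      also have "emeasure (\<nu> c) \<dots> = local_measure \<rho> c B" by (rule lm[OF c B, symmetric])
      finally show ?thesis .
    qed
    then show "is_density_measure \<rho> \<mu>" by (simp add: is_density_measure_def sets_\<mu>)
    fix M assume M: "is_density_measure \<rho> M"
    then have sM: "sets M = sets borel" by (simp add: is_density_measure_def)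
    show "M = \<mu>"
    proof (rule measure_eqI)
      fix B assume "B \<in> sets M"
      then have B: "B \<in> sets borel" by (simp add: sM)
      have "emeasure M B = (\<Sum>i<N. emeasure M (B \<inter> P i))" by (rule split[OF sM B])
      also have "\<dots> = m B"
        unfolding m_def using M CP(1) BP[OF _ B] by (intro sum.cong) (auto simp: is_density_measure_def)
      finally show "emeasure M B = emeasure \<mu> B" by (simp add: \<mu>[OF B])
    qed (simp add: sM sets_\<mu>)
  qed
qed

lemma density_measure:
  assumes "compatible_density \<rho>"
  shows "sets (density_measure A \<rho>) = sets borel"
    "\<And>c B. c \<in> A \<Longrightarrow> B \<in> sets borel \<Longrightarrow> B \<subseteq> cdom c \<Longrightarrow>
       emeasure (density_measure A \<rho>) B = (\<integral>\<^sup>+x\<in>cmap c ` B. ennreal (\<rho> c x) \<partial>lborel)"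
proof -
  have eq: "density_measure A \<rho> = (THE \<mu>. is_density_measure \<rho> \<mu>)"
    unfolding density_measure_def is_density_measure_def local_measure_def ..
  have *: "is_density_measure \<rho> (density_measure A \<rho>)"
    unfolding eq by (rule theI'[OF density_measure_exists_unique[OF assms]])
  then show "sets (density_measure A \<rho>) = sets borel"
    "\<And>c B. c \<in> A \<Longrightarrow> B \<in> sets borel \<Longrightarrow> B \<subseteq> cdom c \<Longrightarrow>
       emeasure (density_measure A \<rho>) B = (\<integral>\<^sup>+x\<in>cmap c ` B. ennreal (\<rho> c x) \<partial>lborel)"
    by (simp_all add: is_density_measure_def local_measure_def)
qed

text \<open>The density is bounded on a closed ball inside a chart image, so the open ball has
  finite measure; finitely many such balls cover the manifold.\<close>

lemma density_measure_finite:
  assumes \<rho>: "compatible_density \<rho>"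
  shows "emeasure (density_measure A \<rho>) UNIV < \<infinity>"
proof -
  let ?\<mu> = "density_measure A \<rho>"
  have "\<exists>V. p \<in> V \<and> open V \<and> emeasure ?\<mu> V < \<infinity>" for p
  proof -
    obtain c where c: "c \<in> A" "p \<in> cdom c" using chart_exists by blast
    obtain r where r: "r > 0" "cball (cmap c p) r \<subseteq> cimg c"
      using open_contains_cball[THEN iffD1, OF open_cimg[OF c(1)]] c(2) by blast
    have sub: "ball (cmap c p) r \<subseteq> cimg c" using r(2) ball_subset_cball by blast
    define V where "V = cinv c ` ball (cmap c p) r"
    have V: "open V" unfolding V_def by (rule open_cinv_image[OF c(1) open_ball sub])
    have Vc: "V \<subseteq> cdom c" unfolding V_def using cinv_cdom[OF c(1)] sub by auto
    have "cmap c ` V = ball (cmap c p) r"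
      unfolding V_def image_image using cmap_cinv[OF c(1)] sub by (force simp: image_iff)
    then have "emeasure ?\<mu> V = (\<integral>\<^sup>+x\<in>ball (cmap c p) r. ennreal (\<rho> c x) \<partial>lborel)"
      using density_measure(2)[OF \<rho> c(1) _ Vc] V by simp
    also obtain b where b: "\<And>x. x \<in> cball (cmap c p) r \<Longrightarrow> \<rho> c x \<le> b"
    proof -
      have "continuous_on (cball (cmap c p) r) (\<rho> c)"
        using \<rho> c(1) r(2) continuous_on_subset unfolding compatible_density_def by blast
      then have "bounded (\<rho> c ` cball (cmap c p) r)"
        by (intro compact_imp_bounded compact_continuous_image) auto
      then obtain b where "\<forall>y\<in>\<rho> c ` cball (cmap c p) r. norm y \<le> b"
        unfolding bounded_iff by auto
      then have "\<And>x. x \<in> cball (cmap c p) r \<Longrightarrow> \<rho> c x \<le> b" by force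
      then show thesis by (rule that)
    qed
    have "(\<integral>\<^sup>+x\<in>ball (cmap c p) r. ennreal (\<rho> c x) \<partial>lborel)
        \<le> (\<integral>\<^sup>+x. ennreal b * indicator (ball (cmap c p) r) x \<partial>lborel)"
      by (intro nn_integral_mono) (auto split: split_indicator intro!: ennreal_leI b)
    also have "\<dots> = ennreal b * emeasure lborel (ball (cmap c p) r)"
      by (subst nn_integral_cmult_indicator) auto
    also have "\<dots> < \<infinity>"
      using emeasure_lborel_ball_finite[of "cmap c p" r] by (auto simp: ennreal_mult_less_top)
    finally have "emeasure ?\<mu> V < \<infinity>" .
    moreover have "p \<in> V"
      unfolding V_def using r(1) cinv_cmap[OF c] by (metis centre_in_ball image_eqI)
    ultimately show ?thesis using V by blast
  qed
  then have "\<forall>p. \<exists>V. p \<in> V \<and> open V \<and> emeasure ?\<mu> V < \<infinity>" by blast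
  then obtain V where V: "\<And>p. p \<in> V p" "\<And>p. open (V p)" "\<And>p. emeasure ?\<mu> (V p) < \<infinity>"
    using choice[of "\<lambda>p V. p \<in> V \<and> open V \<and> emeasure ?\<mu> V < \<infinity>"] by auto
  obtain F where F: "finite F" "UNIV \<subseteq> (\<Union>p\<in>F. V p)"
    by (rule compactE_image[OF compact_M, of UNIV V]) (use V in auto)
  have "emeasure ?\<mu> UNIV \<le> emeasure ?\<mu> (\<Union>p\<in>F. V p)"
    using F(2) V(2) density_measure(1)[OF \<rho>] by (intro emeasure_mono) (auto intro!: borel_open)
  also have "\<dots> \<le> (\<Sum>p\<in>F. emeasure ?\<mu> (V p))"
    using F(1) V(2) density_measure(1)[OF \<rho>] by (intro emeasure_subadditive_finite) auto
  also have "\<dots> < \<infinity>" using V(3) F(1) by (simp add: less_top)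
  finally show ?thesis .
qed

end

section \<open>The norm of a closed form\<close>

lemma det_pos_definite_nonzero:
  fixes G :: "real ^ 'n::finite ^ 'n"
  assumes "\<And>v. v \<noteq> 0 \<Longrightarrow> v \<bullet> (G *v v) > 0"
  shows "det G \<noteq> 0"
proof -
  have "\<forall>x. G *v x = 0 \<longrightarrow> x = 0"
    using assms by (metis inner_zero_right less_irrefl)
  then show ?thesis
    by (simp add: invertible_det_nz[symmetric] invertible_left_inverse matrix_left_invertible_ker)
qed

text \<open>The determinant has no zero on the segment from the identity to \<open>G\<close>.\<close>

lemma det_pos_definite:
  fixes G :: "real ^ 'n::finite ^ 'n"
  assumes pd: "\<And>v. v \<noteq> 0 \<Longrightarrow> v \<bullet> (G *v v) > 0"
  shows "det G > 0"
proof (rule ccontr)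
  assume "\<not> det G > 0"
  define H where "H = (\<lambda>t::real. (1 - t) *\<^sub>R mat 1 + t *\<^sub>R G)"
  have nz: "det (H t) \<noteq> 0" if "0 \<le> t" "t \<le> 1" for t
  proof (rule det_pos_definite_nonzero)
    fix v :: "real ^ 'n" assume "v \<noteq> 0"
    then have "v \<bullet> v > 0" "v \<bullet> (G *v v) > 0" using pd by auto
    moreover have "v \<bullet> (H t *v v) = (1 - t) * (v \<bullet> v) + t * (v \<bullet> (G *v v))"
      by (simp add: H_def matrix_vector_mult_add_rdistrib scaleR_matrix_vector_assoc[symmetric] inner_add_right)
    ultimately show "v \<bullet> (H t *v v) > 0"
      using that by (cases "t = 0") (auto intro!: add_nonneg_pos)
  qed
  have "continuous_on {0..1} (\<lambda>t. det (H t))"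
    by (rule continuous_on_det_matrix) (auto simp: H_def mat_def intro!: continuous_intros)
  moreover have "det (H 0) = 1" "det (H 1) = det G" by (simp_all add: H_def)
  ultimately have "\<exists>t\<ge>0. t \<le> 1 \<and> det (H t) = 0"
    using IVT2'[of "\<lambda>t. det (H t)" 1 0 0] \<open>\<not> det G > 0\<close> by auto
  with nz show False by blast
qed

lemma matrix_inv_mult_right:
  fixes G :: "real ^ 'n::finite ^ 'n"
  assumes "det G \<noteq> 0"
  shows "G ** matrix_inv G = mat 1"
proof -
  have "\<exists>B. G ** B = mat 1 \<and> B ** G = mat 1"
    using assms by (simp add: invertible_det_nz[symmetric] invertible_def)
  then show ?thesis unfolding matrix_inv_def by (rule someI2_ex) simp
qed

section \<open>Covectors and their norm for a scalar product\<close>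

lemma inner_covector_coords:
  fixes a :: "(real ^ 'n::finite) \<Rightarrow>\<^sub>L real"
  shows "covector_coords a \<bullet> v = blinfun_apply a v"
proof -
  have "blinfun_apply a v = blinfun_apply a (\<Sum>i\<in>UNIV. v $ i *\<^sub>R axis i 1)"
    by (metis basis_expansion scalar_mult_eq_scaleR)
  also have "\<dots> = (\<Sum>i\<in>UNIV. v $ i * blinfun_apply a (axis i 1))"
    by (simp add: blinfun.sum_right blinfun.scaleR_right)
  finally show ?thesis
    by (simp add: covector_coords_def inner_vec_def mult.commute)
qed

text \<open>The value in \<open>norm_sq_at\<close>, with the matrix and the covector detached from
  chart and point.\<close>

definition dual_norm_sq :: "real ^ 'n::finite ^ 'n \<Rightarrow> ((real ^ 'n) \<Rightarrow>\<^sub>L real) \<Rightarrow> real" where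
  "dual_norm_sq G a = covector_coords a \<bullet> (matrix_inv G *v covector_coords a)"

text \<open>Raising of the index: the vector that represents the covector for the scalar product
  with matrix \<open>G\<close>.\<close>

definition sharp :: "real ^ 'n::finite ^ 'n \<Rightarrow> ((real ^ 'n) \<Rightarrow>\<^sub>L real) \<Rightarrow> real ^ 'n" where
  "sharp G a = matrix_inv G *v covector_coords a"

lemma sharp:
  assumes "det G \<noteq> 0"
  shows "v \<bullet> (G *v sharp G a) = blinfun_apply a v"
  unfolding sharp_def matrix_vector_mul_assoc matrix_inv_mult_right[OF assms]
  by (simp add: inner_commute[of v] inner_covector_coords)

lemma sharp_unique:
  assumes "det G \<noteq> 0" "\<And>v. v \<bullet> (G *v b) = blinfun_apply a v"
  shows "b = sharp G a"
proof -
  have "v \<bullet> (G *v b) = v \<bullet> (G *v sharp G a)" for v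
    using assms sharp by metis
  then have "G *v b = G *v sharp G a" by (metis vector_eq_ldot)
  moreover have "inj ((*v) G)"
    using assms(1) by (simp add: inj_matrix_vector_mult invertible_det_nz)
  ultimately show ?thesis by (auto dest: injD)
qed

lemma dual_norm_sq_sharp: "dual_norm_sq G a = blinfun_apply a (sharp G a)"
  by (simp add: dual_norm_sq_def sharp_def inner_covector_coords)

text \<open>The value is the squared length, for \<open>G\<close>, of the representing vector, which
  is 0 only if the covector is.\<close>

lemma dual_norm_sq_pos:
  fixes a :: "(real ^ 'n::finite) \<Rightarrow>\<^sub>L real"
  assumes pd: "\<And>v. v \<noteq> 0 \<Longrightarrow> v \<bullet> (G *v v) > 0"
  shows "dual_norm_sq G a \<ge> 0" "a \<noteq> 0 \<Longrightarrow> dual_norm_sq G a > 0"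
proof -
  have eq: "dual_norm_sq G a = sharp G a \<bullet> (G *v sharp G a)"
    using sharp[OF det_pos_definite_nonzero[OF pd]] dual_norm_sq_sharp by metis
  show "dual_norm_sq G a \<ge> 0"
    unfolding eq using pd[of "sharp G a"] by (cases "sharp G a = 0") auto
  assume "a \<noteq> 0"
  have "sharp G a \<noteq> 0"
  proof
    assume "sharp G a = 0"
    then have "blinfun_apply a v = 0" for v
      using sharp[OF det_pos_definite_nonzero[OF pd], of v a] by simp
    with \<open>a \<noteq> 0\<close> show False by (metis blinfun_eqI zero_blinfun.rep_eq)
  qed
  then show "dual_norm_sq G a > 0" unfolding eq by (rule pd)
qed

text \<open>Cramer's rule writes the inverse matrix through determinants, which depend continuously
  on the entries.\<close>

lemma continuous_on_dual_norm_sq: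
  fixes G :: "'a::topological_space \<Rightarrow> real ^ 'n::finite ^ 'n"
  assumes G: "continuous_on S G" and a: "continuous_on S a" and nz: "\<And>x. x \<in> S \<Longrightarrow> det (G x) \<noteq> 0"
  shows "continuous_on S (\<lambda>x. dual_norm_sq (G x) (a x))"
proof -
  have ca: "continuous_on S (\<lambda>x. covector_coords (a x) $ i)" for i
    unfolding covector_coords_def using a by (auto intro!: continuous_intros)
  have cG: "continuous_on S (\<lambda>x. G x $ i $ j)" for i j
    using G by (intro continuous_intros)
  have "matrix_inv (G x) *v b = (\<chi> k. det (\<chi> i j. if j = k then b $ i else G x $ i $ j) / det (G x))"
    if "x \<in> S" for x b
    by (rule cramer[OF nz[OF that], THEN iffD1])
      (simp add: matrix_vector_mul_assoc matrix_inv_mult_right[OF nz[OF that]])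
  then have eq: "dual_norm_sq (G x) (a x) = (\<Sum>k\<in>UNIV. covector_coords (a x) $ k *
      (det (\<chi> i j. if j = k then covector_coords (a x) $ i else G x $ i $ j) / det (G x)))"
    if "x \<in> S" for x
    using that by (simp add: dual_norm_sq_def inner_vec_def)
  have "continuous_on S (\<lambda>x. \<Sum>k\<in>UNIV. covector_coords (a x) $ k *
      (det (\<chi> i j. if j = k then covector_coords (a x) $ i else G x $ i $ j) / det (G x)))"
  proof (intro continuous_on_sum continuous_on_mult continuous_on_divide ca continuous_on_det_matrix)
    show "continuous_on S (\<lambda>x. G x $ i $ j)" for i j by (rule cG)
    show "continuous_on S (\<lambda>x. (\<chi> i j. if j = k then covector_coords (a x) $ i else G x $ i $ j) $ i $ j)"
      for i j k
      using ca cG by (cases "j = k") auto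
  qed (use nz in auto)
  then show ?thesis by (rule continuous_on_eq) (simp add: eq)
qed

context atlas
begin

text \<open>The metric transforms by \<open>transpose D ** g d (cmap d p) ** D\<close>, so its
  determinant picks up the square of \<open>det D\<close>. The root of that square is
  \<open>det D\<close> itself because the atlas is oriented.\<close>

lemma riemannian_density_compatible:
  assumes g: "riemannian_metric A g"
  shows "compatible_density (\<lambda>c x. sqrt (det (g c x)))"
proof -
  have pd: "v \<bullet> (g c x *v v) > 0" if "c \<in> A" "x \<in> cimg c" "v \<noteq> 0" for c x v
    using g that unfolding riemannian_metric_def by blast
  have cont: "continuous_on (cimg c) (\<lambda>x. sqrt (det (g c x)))" if "c \<in> A" for c
  proof -
    have "continuous_on (cimg c) (g c)"
      using g that smooth_on_continuous unfolding riemannian_metric_def by blast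
    then show ?thesis
      by (intro continuous_on_real_sqrt continuous_on_det_matrix continuous_on_component)
  qed
  have tr: "sqrt (det (g c (cmap c p)))
      = sqrt (det (g d (cmap d p))) * det (matrix (dtransition c d (cmap c p)))"
    if cd: "c \<in> A" "d \<in> A" and p: "p \<in> cdom c" "p \<in> cdom d" for c d p
  proof -
    define D where "D = matrix (dtransition c d (cmap c p))"
    have D: "dtransition c d (cmap c p) v = D *v v" for v
      unfolding D_def using matrix_vector_mul(2)[OF linear_dtransition[OF cd p]] by metis
    have "v \<bullet> (g c (cmap c p) *v w) = v \<bullet> ((transpose D ** g d (cmap d p) ** D) *v w)" for v w
    proof -
      have "v \<bullet> (g c (cmap c p) *v w) = (D *v v) \<bullet> (g d (cmap d p) *v (D *v w))"
        using g cd p unfolding riemannian_metric_def D[symmetric] by blast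
      also have "\<dots> = v \<bullet> (transpose D *v (g d (cmap d p) *v (D *v w)))"
        by (metis dot_lmul_matrix transpose_matrix_vector transpose_transpose)
      finally show ?thesis by (simp only: matrix_vector_mul_assoc matrix_mul_assoc)
    qed
    then have "g c (cmap c p) = transpose D ** g d (cmap d p) ** D"
      by (metis matrix_eq vector_eq_ldot)
    then have "det (g c (cmap c p)) = det (g d (cmap d p)) * (det D)\<^sup>2"
      by (simp add: det_mul power2_eq_square)
    moreover have "det D > 0" unfolding D_def by (rule dtransition_det_pos[OF cd p])
    ultimately show ?thesis by (simp add: D_def[symmetric] real_sqrt_mult)
  qed
  show ?thesis
    unfolding compatible_density_def
  proof (intro conjI ballI)
    fix c x assume "c \<in> A" "x \<in> cimg c"
    then show "0 \<le> sqrt (det (g c x))" using det_pos_definite[of "g c x"] pd by force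
  qed (use cont tr in blast)+
qed

text \<open>The derivative of the transition carries the representing vector of one chart to that of
  the other, so both values are \<alpha> applied to the same tangent vector.\<close>

lemma dual_norm_sq_chart:
  assumes g: "riemannian_metric A g" and \<alpha>: "one_form A \<alpha>"
    and cd: "c \<in> A" "d \<in> A" and p: "p \<in> cdom c" "p \<in> cdom d"
  shows "dual_norm_sq (g c (cmap c p)) (\<alpha> c (cmap c p)) = dual_norm_sq (g d (cmap d p)) (\<alpha> d (cmap d p))"
proof -
  have nz: "det (g e (cmap e p)) \<noteq> 0" if "e \<in> A" "p \<in> cdom e" for e
  proof (rule det_pos_definite_nonzero)
    show "v \<bullet> (g e (cmap e p) *v v) > 0" if "v \<noteq> 0" for v
      using g that \<open>e \<in> A\<close> \<open>p \<in> cdom e\<close> unfolding riemannian_metric_def by blast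
  qed
  define T where "T = dtransition c d (cmap c p)"
  define b where "b = sharp (g c (cmap c p)) (\<alpha> c (cmap c p))"
  have \<alpha>T: "blinfun_apply (\<alpha> c (cmap c p)) v = blinfun_apply (\<alpha> d (cmap d p)) (T v)" for v
    using \<alpha> cd p unfolding one_form_def T_def by blast
  have gT: "v \<bullet> (g c (cmap c p) *v w) = T v \<bullet> (g d (cmap d p) *v T w)" for v w
    using g cd p unfolding riemannian_metric_def T_def by blast
  have "v \<bullet> (g d (cmap d p) *v T b) = blinfun_apply (\<alpha> d (cmap d p)) v" for v
  proof -
    define u where "u = dtransition d c (cmap d p) v"
    have "T u = v" unfolding T_def u_def by (rule dtransition_inverse[OF cd(2,1) p(2,1)])
    then show ?thesis
      using gT[of u b] \<alpha>T[of u] sharp[OF nz[OF cd(1) p(1)], of u "\<alpha> c (cmap c p)"] by (simp add: b_def)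
  qed
  then have "T b = sharp (g d (cmap d p)) (\<alpha> d (cmap d p))"
    by (rule sharp_unique[OF nz[OF cd(2) p(2)]])
  then show ?thesis
    unfolding dual_norm_sq_sharp b_def[symmetric] \<alpha>T by simp
qed

end

context closed_manifold
begin

text \<open>The squared pointwise norm is continuous and nonnegative, and it is positive on the
  nonempty open set where \<alpha> does not vanish in some chart; such a set is not Lebesgue
  negligible. The lemma lets the norm factor cancel in \<open>cochain_scale_tau\<close>.\<close>

lemma form_L2_norm_nonzero:
  assumes g: "riemannian_metric A g" and \<alpha>: "one_form A \<alpha>" and nz: "\<alpha> \<noteq> (\<lambda>c x. 0)"
  shows "form_L2_norm A g \<alpha> \<noteq> 0"
proof
  assume norm0: "form_L2_norm A g \<alpha> = 0"
  let ?\<rho> = "\<lambda>c x. sqrt (det (g c x))"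
  let ?f = "norm_sq_at A g \<alpha>"
  define \<mu> where "\<mu> = riemannian_measure A g"
  have comp: "compatible_density ?\<rho>" by (rule riemannian_density_compatible[OF g])
  have sets\<mu>: "sets \<mu> = sets borel"
    unfolding \<mu>_def riemannian_measure_def by (rule density_measure(1)[OF comp])
  have \<mu>c: "emeasure \<mu> B = (\<integral>\<^sup>+x\<in>cmap c ` B. ennreal (sqrt (det (g c x))) \<partial>lborel)"
    if "c \<in> A" "B \<in> sets borel" "B \<subseteq> cdom c" for c B
    unfolding \<mu>_def riemannian_measure_def by (rule density_measure(2)[OF comp that])
  have space\<mu>: "space \<mu> = UNIV" using sets_eq_imp_space_eq[OF sets\<mu>] by simp
  interpret finite_measure \<mu>
    using density_measure_finite[OF comp] space\<mu>
    by (intro finite_measureI) (auto simp: \<mu>_def riemannian_measure_def less_top)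
  have pd: "v \<bullet> (g c x *v v) > 0" if "c \<in> A" "x \<in> cimg c" "v \<noteq> 0" for c x v
    using g that unfolding riemannian_metric_def by blast
  have f_chart: "?f p = dual_norm_sq (g c (cmap c p)) (\<alpha> c (cmap c p))" if c: "c \<in> A" "p \<in> cdom c" for c p
  proof -
    have "?f p = dual_norm_sq (g (chart_at A p) (cmap (chart_at A p) p)) (\<alpha> (chart_at A p) (cmap (chart_at A p) p))"
      by (simp add: norm_sq_at_def dual_norm_sq_def Let_def)
    also have "\<dots> = dual_norm_sq (g c (cmap c p)) (\<alpha> c (cmap c p))"
      by (rule dual_norm_sq_chart[OF g \<alpha> chart_at(1) c(1) chart_at(2) c(2)])
    finally show ?thesis .
  qed
  have cont: "continuous_on UNIV ?f"
  proof -
    have "continuous_on (cdom c) ?f" if c: "c \<in> A" for c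
    proof -
      have "continuous_on (cimg c) (\<lambda>x. dual_norm_sq (g c x) (\<alpha> c x))"
      proof (rule continuous_on_dual_norm_sq)
        show "continuous_on (cimg c) (g c)"
          using g c smooth_on_continuous unfolding riemannian_metric_def by blast
        show "continuous_on (cimg c) (\<alpha> c)"
          using \<alpha> c smooth_on_continuous unfolding one_form_def by blast
        show "det (g c x) \<noteq> 0" if "x \<in> cimg c" for x
          using pd[OF c that] by (rule det_pos_definite_nonzero)
      qed
      then have "continuous_on (cdom c) (\<lambda>p. dual_norm_sq (g c (cmap c p)) (\<alpha> c (cmap c p)))"
        by (rule continuous_on_compose2[OF _ continuous_on_cmap[OF c]]) auto
      then show ?thesis by (rule continuous_on_eq) (simp add: f_chart[OF c])
    qed
    moreover have "(\<Union>c\<in>A. cdom c) = UNIV" using chart_exists by blast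
    ultimately show ?thesis
      using continuous_on_open_UN[of A cdom ?f] open_cdom by metis
  qed
  have nonneg: "?f p \<ge> 0" for p
    using f_chart[OF chart_at] dual_norm_sq_pos(1)[OF pd[OF chart_at(1)]] chart_at(2) by simp
  have "bounded (range ?f)"
    by (rule compact_imp_bounded[OF compact_continuous_image[OF cont compact_M]])
  then obtain b where b: "\<And>p. norm (?f p) \<le> b" unfolding bounded_iff by auto
  have meas: "?f \<in> borel_measurable \<mu>"
    using borel_measurable_continuous_onI[OF cont] by (simp add: measurable_cong_sets[OF sets\<mu> refl])
  \<comment> \<open>Integrability matters: the integral of a non-integrable function is 0 by
    default, and then a vanishing norm would say nothing.\<close>
  have int: "integrable \<mu> ?f"
    by (rule integrable_const_bound[OF _ meas]) (use b in auto)
  have "integral\<^sup>L \<mu> ?f = 0"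
    using norm0 unfolding form_L2_norm_def \<mu>_def by simp
  then have "AE p in \<mu>. ?f p = 0"
    using integral_nonneg_eq_0_iff_AE[OF int] nonneg by simp
  moreover have "{p \<in> space \<mu>. ?f p \<noteq> 0} \<in> sets \<mu>" using meas by measurable
  ultimately have null: "emeasure \<mu> {p. ?f p \<noteq> 0} = 0"
    using AE_iff_measurable[of "{p. ?f p \<noteq> 0}" \<mu> "\<lambda>p. ?f p = 0"] space\<mu> by simp
  \<comment> \<open>\<open>one_form\<close> sets the form to 0 off the charts, so a nonzero value is
    attained at a genuine chart point.\<close>
  obtain c x where cx: "\<alpha> c x \<noteq> 0" using nz by blast
  then have c: "c \<in> A" and x: "x \<in> cimg c" using \<alpha> unfolding one_form_def by blast+
  define V where "V = {y \<in> cimg c. \<alpha> c y \<noteq> 0}"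
  define B where "B = cinv c ` V"
  have cont\<alpha>: "continuous_on (cimg c) (\<alpha> c)"
    using \<alpha> c smooth_on_continuous unfolding one_form_def by blast
  have "open (cimg c \<inter> \<alpha> c -` (- {0}))"
    by (rule continuous_open_preimage[OF cont\<alpha> open_cimg[OF c]]) auto
  also have "cimg c \<inter> \<alpha> c -` (- {0}) = V" by (auto simp: V_def)
  finally have V: "open V" .
  have Vc: "V \<subseteq> cimg c" by (auto simp: V_def)
  have B: "open B" unfolding B_def by (rule open_cinv_image[OF c V Vc])
  have Bc: "B \<subseteq> cdom c" unfolding B_def using Vc cinv_cdom[OF c] by blast
  have BV: "cmap c ` B = V"
    unfolding B_def image_image using cmap_cinv[OF c] Vc by (simp add: subset_iff cong: image_cong_simp)
  have "B \<subseteq> {p. ?f p \<noteq> 0}"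
  proof
    fix p assume "p \<in> B"
    then have p: "p \<in> cdom c" "cmap c p \<in> V" using Bc BV by blast+
    then have "dual_norm_sq (g c (cmap c p)) (\<alpha> c (cmap c p)) > 0"
      using Vc by (intro dual_norm_sq_pos(2) pd[OF c]) (auto simp: V_def)
    then show "p \<in> {p. ?f p \<noteq> 0}" using f_chart[OF c p(1)] by simp
  qed
  then have "emeasure \<mu> B \<le> emeasure \<mu> {p. ?f p \<noteq> 0}"
    using \<open>{p \<in> space \<mu>. ?f p \<noteq> 0} \<in> sets \<mu>\<close> space\<mu> by (intro emeasure_mono) auto
  then have "emeasure \<mu> B = 0" using null by simp
  then have "(\<integral>\<^sup>+y\<in>V. ennreal (sqrt (det (g c y))) \<partial>lborel) = 0"
    using \<mu>c[OF c borel_open[OF B] Bc] BV by simp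
  then have "(\<integral>\<^sup>+y. ennreal (indicator (cimg c) y * sqrt (det (g c y))) * indicator V y \<partial>lborel) = 0"
    using Vc by (subst (asm) nn_integral_cong[where v = "\<lambda>y. ennreal (indicator (cimg c) y * sqrt (det (g c y))) * indicator V y"])
      (auto split: split_indicator)
  then have "AE y in lborel. ennreal (indicator (cimg c) y * sqrt (det (g c y))) * indicator V y = 0"
    using density_measurable[OF comp c] V by (subst (asm) nn_integral_0_iff_AE) auto
  then have "AE y in lborel. y \<notin> V"
  proof (rule AE_mp, intro AE_I2 impI)
    fix y assume "ennreal (indicator (cimg c) y * sqrt (det (g c y))) * indicator V y = 0"
    moreover have "det (g c y) > 0" if "y \<in> V"
      using that Vc by (intro det_pos_definite pd[OF c]) auto
    ultimately show "y \<notin> V" using Vc by (auto split: split_indicator_asm simp: ennreal_eq_0_iff)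
  qed
  then have "emeasure lborel V = 0"
    using AE_iff_measurable[of V lborel "\<lambda>y. y \<notin> V"] V by simp
  then have "V \<in> null_sets lebesgue"
    using V by (auto intro!: null_setsI null_sets_completionI)
  then have "negligible V" by (simp add: negligible_iff_null_sets)
  moreover have "V \<noteq> {}" using cx x by (auto simp: V_def)
  ultimately show False using open_not_negligible[OF V] by blast
qed

end

section \<open>Primitives of closed forms and integrals along continuous curves\<close>

lemma continuous_on_near:
  fixes \<gamma> :: "real \<Rightarrow> 'm::topological_space"
  assumes "continuous_on S \<gamma>" "t \<in> S" "open W" "\<gamma> t \<in> W"
  shows "\<exists>d>0. \<forall>s\<in>S. \<bar>s - t\<bar> < d \<longrightarrow> \<gamma> s \<in> W"
proof -
  obtain U where U: "open U" "t \<in> U" "\<forall>s\<in>S. s \<in> U \<longrightarrow> \<gamma> s \<in> W"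
    using assms(1)[unfolded continuous_on_topological, rule_format, OF assms(2,3,4)] by auto
  obtain d where "d > 0" "ball t d \<subseteq> U" using openE[OF U(1,2)] .
  then show ?thesis
    using U(3) by (intro exI[of _ d]) (auto simp: dist_real_def subset_iff abs_minus_commute)
qed

lemma locally_constant_on_interval:
  fixes H :: "real \<Rightarrow> 'a"
  assumes "\<And>t. t \<in> {a..b} \<Longrightarrow> \<exists>d>0. \<forall>s\<in>{a..b}. \<bar>s - t\<bar> < d \<longrightarrow> H s = H t"
    and "s \<in> {a..b}" "t \<in> {a..b}"
  shows "H s = H t"
proof -
  have "H constant_on {a..b}"
  proof (rule locally_constant_imp_constant)
    fix t assume t: "t \<in> {a..b}"
    then obtain d where d: "d > 0" "\<forall>s\<in>{a..b}. \<bar>s - t\<bar> < d \<longrightarrow> H s = H t" using assms(1) by blast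
    show "\<exists>T. openin (top_of_set {a..b}) T \<and> t \<in> T \<and> (\<forall>s\<in>T. H s = H t)"
    proof (intro exI conjI)
      show "openin (top_of_set {a..b}) ({a..b} \<inter> ball t d)" by (rule openin_open_Int) simp
      show "\<forall>s\<in>{a..b} \<inter> ball t d. H s = H t"
        using d(2) by (auto simp: dist_real_def abs_minus_commute)
    qed (use t d in auto)
  qed simp
  then show ?thesis using assms(2,3) by (auto simp: constant_on_def)
qed

context atlas
begin

section \<open>Local primitives on chart balls\<close>

lemma chart_ball_open:
  assumes "c \<in> A" "ball x r \<subseteq> cimg c"
  shows "open (cinv c ` ball x r)" "cinv c ` ball x r \<subseteq> cdom c" "cmap c ` cinv c ` ball x r = ball x r"
proof -
  show "open (cinv c ` ball x r)" by (rule open_cinv_image[OF assms(1) open_ball assms(2)])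
  show "cinv c ` ball x r \<subseteq> cdom c" using cinv_cdom[OF assms(1)] assms(2) by blast
  show "cmap c ` cinv c ` ball x r = ball x r"
    unfolding image_image using cmap_cinv[OF assms(1)] assms(2)
    by (simp add: subset_iff cong: image_cong_simp)
qed

lemma chart_ball_neighbourhood_in:
  assumes c: "c \<in> A" "p \<in> cdom c" and V: "open V" "p \<in> V"
  obtains r where "r > 0" "ball (cmap c p) r \<subseteq> cimg c"
    "cinv c ` ball (cmap c p) r \<subseteq> V" "p \<in> cinv c ` ball (cmap c p) r"
proof -
  have "open (cmap c ` (V \<inter> cdom c))"
    by (rule open_cmap_image[OF c(1)]) (use V open_cdom[OF c(1)] in auto)
  moreover have "cmap c p \<in> cmap c ` (V \<inter> cdom c)" using c V by blast
  ultimately obtain r where r: "r > 0" "ball (cmap c p) r \<subseteq> cmap c ` (V \<inter> cdom c)"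
    using openE by metis
  show thesis
  proof (rule that[OF r(1)])
    show "ball (cmap c p) r \<subseteq> cimg c" using r(2) by blast
    show "cinv c ` ball (cmap c p) r \<subseteq> V"
    proof
      fix q assume "q \<in> cinv c ` ball (cmap c p) r"
      then obtain q' where "q' \<in> V \<inter> cdom c" "q = cinv c (cmap c q')" using r(2) by blast
      then show "q \<in> V" using cinv_cmap[OF c(1)] by auto
    qed
    show "p \<in> cinv c ` ball (cmap c p) r"
      using cinv_cmap[OF c] r(1) by (metis centre_in_ball image_eqI)
  qed
qed

lemma chart_ball_neighbourhood:
  assumes "open V" "p \<in> V"
  obtains c r where "c \<in> A" "p \<in> cdom c" "r > 0" "ball (cmap c p) r \<subseteq> cimg c"
    "cinv c ` ball (cmap c p) r \<subseteq> V" "p \<in> cinv c ` ball (cmap c p) r"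
proof -
  obtain c where c: "c \<in> A" "p \<in> cdom c" using chart_exists by blast
  show thesis
    by (rule chart_ball_neighbourhood_in[OF c assms]) (rule that[OF c])
qed

text \<open>The transformation law of \<alpha> is the chain rule for the transition, so a primitive
  in one chart is a primitive in all.\<close>

lemma primitive_on_chart:
  assumes \<alpha>: "one_form A \<alpha>" and c: "c \<in> A" and V: "V \<subseteq> cdom c"
    and \<phi>: "\<And>p. p \<in> V \<Longrightarrow> (\<phi> has_derivative blinfun_apply (\<alpha> c (cmap c p))) (at (cmap c p))"
  shows "primitive_on A V \<alpha> (\<phi> \<circ> cmap c)"
  unfolding primitive_on_def
proof (intro ballI)
  fix d p assume d: "d \<in> A" and "p \<in> V \<inter> cdom d"
  then have p: "p \<in> V" "p \<in> cdom c" "p \<in> cdom d" using V by auto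
  have "(\<phi> has_derivative blinfun_apply (\<alpha> c (cmap c p))) (at (transition d c (cmap d p)))"
    using \<phi>[OF p(1)] transition_apply[OF d p(3)] by simp
  from diff_chain_at[OF transition_derivative[OF d c p(3,2)] this]
  have "(\<phi> \<circ> transition d c has_derivative
      blinfun_apply (\<alpha> c (cmap c p)) \<circ> dtransition d c (cmap d p)) (at (cmap d p))" .
  moreover have "blinfun_apply (\<alpha> c (cmap c p)) \<circ> dtransition d c (cmap d p)
      = blinfun_apply (\<alpha> d (cmap d p))"
    using \<alpha> c d p unfolding one_form_def fun_eq_iff comp_apply by (metis IntI)
  ultimately show "(\<phi> \<circ> cmap c \<circ> cinv d has_derivative blinfun_apply (\<alpha> d (cmap d p))) (at (cmap d p))"
    by (simp add: transition_def o_assoc)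
qed

lemma primitive_on_subset: "primitive_on A V \<alpha> f \<Longrightarrow> W \<subseteq> V \<Longrightarrow> primitive_on A W \<alpha> f"
  unfolding primitive_on_def by blast

lemma primitive_onD:
  "primitive_on A V \<alpha> f \<Longrightarrow> c \<in> A \<Longrightarrow> p \<in> V \<Longrightarrow> p \<in> cdom c \<Longrightarrow>
    (f \<circ> cinv c has_derivative blinfun_apply (\<alpha> c (cmap c p))) (at (cmap c p))"
  unfolding primitive_on_def by blast

lemma primitive_on_continuous:
  assumes f: "primitive_on A V \<alpha> f" and V: "open V"
  shows "continuous_on V f"
proof (rule continuous_at_imp_continuous_on, rule ballI)
  fix p assume p: "p \<in> V"
  obtain c where c: "c \<in> A" "p \<in> cdom c" using chart_exists by blast
  have 1: "isCont (f \<circ> cinv c) (cmap c p)"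
    by (rule has_derivative_continuous[OF primitive_onD[OF f c(1) p c(2)]])
  have "continuous (at p) (cmap c)"
    using continuous_on_cmap[OF c(1)] open_cdom[OF c(1)] c(2) by (simp add: continuous_on_eq_continuous_at)
  then have "isCont ((f \<circ> cinv c) \<circ> cmap c) p"
    using 1 by (rule continuous_at_compose)
  moreover have "eventually (\<lambda>q. ((f \<circ> cinv c) \<circ> cmap c) q = f q) (nhds p)"
    unfolding eventually_nhds using open_cdom[OF c(1)] c(2) cinv_cmap[OF c(1)] by (intro exI[of _ "cdom c"]) simp
  ultimately show "isCont f p" using isCont_cong by blast
qed

lemma primitive_diff_constant_chart_ball:
  assumes c: "c \<in> A" and B: "ball x r \<subseteq> cimg c"
    and f: "primitive_on A (cinv c ` ball x r) \<alpha> f" and f': "primitive_on A (cinv c ` ball x r) \<alpha> f'"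
    and p: "p \<in> cinv c ` ball x r" and q: "q \<in> cinv c ` ball x r"
  shows "f q - f' q = f p - f' p"
proof -
  obtain y z where yz: "y \<in> ball x r" "z \<in> ball x r" "p = cinv c y" "q = cinv c z" using p q by blast
  let ?h = "\<lambda>u. (f \<circ> cinv c) u - (f' \<circ> cinv c) u"
  have "(?h has_derivative (\<lambda>v. 0)) (at u within ball x r)" if u: "u \<in> ball x r" for u
  proof -
    have uc: "u \<in> cimg c" using u B by blast
    have eq: "cmap c (cinv c u) = u" by (rule cmap_cinv[OF c uc])
    have D: "(f \<circ> cinv c has_derivative blinfun_apply (\<alpha> c u)) (at u)"
      "(f' \<circ> cinv c has_derivative blinfun_apply (\<alpha> c u)) (at u)"
      using primitive_onD[OF f c _ cinv_cdom[OF c uc]] primitive_onD[OF f' c _ cinv_cdom[OF c uc]] u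
      by (simp_all add: eq)
    have "(?h has_derivative (\<lambda>v. blinfun_apply (\<alpha> c u) v - blinfun_apply (\<alpha> c u) v)) (at u)"
      by (rule has_derivative_diff[OF D])
    then show ?thesis by (simp add: has_derivative_at_withinI)
  qed
  from has_derivative_zero_unique[OF convex_ball this yz(2,1)]
  show ?thesis by (simp add: yz)
qed

text \<open>On a common chart ball, which is convex in coordinates, the difference has derivative 0.
  All choices of local primitives are compared through this lemma.\<close>

lemma primitive_diff_locally_constant:
  assumes "open V" "p \<in> V" "primitive_on A V \<alpha> f" "open V'" "p \<in> V'" "primitive_on A V' \<alpha> f'"
  shows "\<exists>W. open W \<and> p \<in> W \<and> W \<subseteq> V \<and> W \<subseteq> V' \<and> (\<forall>q\<in>W. f q - f' q = f p - f' p)"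
proof -
  have "open (V \<inter> V')" "p \<in> V \<inter> V'" using assms by auto
  then obtain c r where c: "c \<in> A" "ball (cmap c p) r \<subseteq> cimg c"
      "cinv c ` ball (cmap c p) r \<subseteq> V \<inter> V'" "p \<in> cinv c ` ball (cmap c p) r"
    by (rule chart_ball_neighbourhood)
  let ?W = "cinv c ` ball (cmap c p) r"
  have "f q - f' q = f p - f' p" if "q \<in> ?W" for q
    using that c(3,4) primitive_on_subset[OF assms(3)] primitive_on_subset[OF assms(6)]
    by (intro primitive_diff_constant_chart_ball[OF c(1,2), of \<alpha>]) blast+
  with c(3,4) chart_ball_open(1)[OF c(1,2)] show ?thesis by blast
qed

lemma closed_form_one_form: "closed_form A \<alpha> \<Longrightarrow> one_form A \<alpha>"
  by (simp add: closed_form_def)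

lemma closed_form_primitive_chart_ball:
  assumes \<alpha>: "closed_form A \<alpha>" and c: "c \<in> A" and B: "ball x r \<subseteq> cimg c"
  obtains f where "primitive_on A (cinv c ` ball x r) \<alpha> f"
proof -
  have sm: "smooth_on (\<alpha> c) (cimg c)" using \<alpha> c unfolding closed_form_def one_form_def by blast
  have "\<exists>\<phi>. \<forall>y\<in>ball x r. (\<phi> has_derivative blinfun_apply (\<alpha> c y)) (at y)"
  proof (rule poincare_ball[of x r "\<alpha> c" "\<lambda>y. frechet_derivative (\<alpha> c) (at y)"])
    show "(\<alpha> c has_derivative frechet_derivative (\<alpha> c) (at y)) (at y)" if "y \<in> ball x r" for y
      using smooth_on_has_derivative[OF sm] that B by blast
    show "continuous_on (ball x r) (\<lambda>y. frechet_derivative (\<alpha> c) (at y) v)" for v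
      using smooth_on_continuous_derivative[OF sm] B continuous_on_subset by blast
    show "blinfun_apply (frechet_derivative (\<alpha> c) (at y) v) w
        = blinfun_apply (frechet_derivative (\<alpha> c) (at y) w) v" if "y \<in> ball x r" for y v w
    proof -
      have "exterior_derivative \<alpha> c y v w = 0" using \<alpha> c B that unfolding closed_form_def by blast
      then show ?thesis by (simp add: exterior_derivative_def)
    qed
  qed blast
  then obtain \<phi> where \<phi>: "\<forall>y\<in>ball x r. (\<phi> has_derivative blinfun_apply (\<alpha> c y)) (at y)" by blast
  have "primitive_on A (cinv c ` ball x r) \<alpha> (\<phi> \<circ> cmap c)"
  proof (rule primitive_on_chart[OF closed_form_one_form[OF \<alpha>] c chart_ball_open(2)[OF c B]])
    fix p assume "p \<in> cinv c ` ball x r"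
    then have "cmap c p \<in> ball x r" using chart_ball_open(3)[OF c B] by blast
    then show "(\<phi> has_derivative blinfun_apply (\<alpha> c (cmap c p))) (at (cmap c p))" using \<phi> by blast
  qed
  then show thesis by (rule that)
qed

lemma closed_form_local_primitive:
  assumes \<alpha>: "closed_form A \<alpha>"
  obtains V f where "open V" "p \<in> V" "primitive_on A V \<alpha> f"
proof -
  obtain c r where c: "c \<in> A" "ball (cmap c p) r \<subseteq> cimg c" "p \<in> cinv c ` ball (cmap c p) r"
    by (rule chart_ball_neighbourhood[OF open_UNIV UNIV_I])
  obtain f where "primitive_on A (cinv c ` ball (cmap c p) r) \<alpha> f"
    by (rule closed_form_primitive_chart_ball[OF \<alpha> c(1,2)])
  then show thesis by (rule that[OF chart_ball_open(1)[OF c(1,2)] c(3)])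
qed

text \<open>A primitive of the form pulled back to the curve: near each time \<open>F\<close> has
  the increments of some local primitive of \<alpha>. In contrast to a derivative condition this
  makes sense for continuous curves, and in contrast to the subdivisions in
  \<open>path_integral\<close> it is local in time, so existence and uniqueness become statements
  about intervals.\<close>

definition primitive_along :: "('m, 'n) form1 \<Rightarrow> (real \<Rightarrow> 'm) \<Rightarrow> real \<Rightarrow> real \<Rightarrow> (real \<Rightarrow> real) \<Rightarrow> bool" where
  "primitive_along \<alpha> \<gamma> a b F \<longleftrightarrow> (\<forall>t\<in>{a..b}. \<exists>V f. open V \<and> \<gamma> t \<in> V \<and> primitive_on A V \<alpha> f \<and>
     (\<exists>d>0. \<forall>s\<in>{a..b}. \<bar>s - t\<bar> < d \<longrightarrow> F s - F t = f (\<gamma> s) - f (\<gamma> t)))"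

lemma primitive_alongD:
  assumes "primitive_along \<alpha> \<gamma> a b F" "t \<in> {a..b}"
  shows "\<exists>V f d. open V \<and> \<gamma> t \<in> V \<and> primitive_on A V \<alpha> f \<and> d > 0 \<and>
    (\<forall>s\<in>{a..b}. \<bar>s - t\<bar> < d \<longrightarrow> F s - F t = f (\<gamma> s) - f (\<gamma> t))"
  using bspec[OF assms(1)[unfolded primitive_along_def] assms(2)] by (elim exE conjE) (intro exI conjI)

text \<open>The witness in \<open>primitive_along\<close> may be replaced by any other local
  primitive, as both have equal increments near the point.\<close>

lemma primitive_along_any:
  assumes F: "primitive_along \<alpha> \<gamma> a b F" and \<gamma>: "continuous_on {a..b} \<gamma>" and t: "t \<in> {a..b}"
    and V: "open V" "\<gamma> t \<in> V" "primitive_on A V \<alpha> f"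
  shows "\<exists>d>0. \<forall>s\<in>{a..b}. \<bar>s - t\<bar> < d \<longrightarrow> F s - F t = f (\<gamma> s) - f (\<gamma> t)"
proof -
  obtain V0 f0 d0 where 0: "open V0" "\<gamma> t \<in> V0" "primitive_on A V0 \<alpha> f0" "d0 > 0"
      "\<forall>s\<in>{a..b}. \<bar>s - t\<bar> < d0 \<longrightarrow> F s - F t = f0 (\<gamma> s) - f0 (\<gamma> t)"
    using primitive_alongD[OF F t] by blast
  obtain W where W: "open W" "\<gamma> t \<in> W" "\<forall>q\<in>W. f q - f0 q = f (\<gamma> t) - f0 (\<gamma> t)"
    using primitive_diff_locally_constant[OF V 0(1-3)] by blast
  obtain d1 where d1: "d1 > 0" "\<forall>s\<in>{a..b}. \<bar>s - t\<bar> < d1 \<longrightarrow> \<gamma> s \<in> W"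
      using continuous_on_near[OF \<gamma> t W(1,2)] by blast
  have "F s - F t = f (\<gamma> s) - f (\<gamma> t)" if "s \<in> {a..b}" "\<bar>s - t\<bar> < min d0 d1" for s
  proof -
    have "\<gamma> s \<in> W" using d1(2) that by simp
    moreover have "F s - F t = f0 (\<gamma> s) - f0 (\<gamma> t)" using 0(5) that by simp
    ultimately show ?thesis using W(3) by force
  qed
  with 0(4) d1(1) show ?thesis by (intro exI[of _ "min d0 d1"]) simp
qed

lemma primitive_along_unique:
  assumes F: "primitive_along \<alpha> \<gamma> a b F" and G: "primitive_along \<alpha> \<gamma> a b G"
    and \<gamma>: "continuous_on {a..b} \<gamma>" and st: "s \<in> {a..b}" "t \<in> {a..b}"
  shows "F s - F t = G s - G t"
proof -
  have "F s - G s = F t - G t"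
  proof (rule locally_constant_on_interval[OF _ st, where H = "\<lambda>s. F s - G s"])
    fix t assume t: "t \<in> {a..b}"
    obtain V f d where V: "open V" "\<gamma> t \<in> V" "primitive_on A V \<alpha> f" "d > 0"
        "\<forall>s\<in>{a..b}. \<bar>s - t\<bar> < d \<longrightarrow> F s - F t = f (\<gamma> s) - f (\<gamma> t)"
      using primitive_alongD[OF F t] by blast
    obtain d' where d': "d' > 0"
        "\<forall>s\<in>{a..b}. \<bar>s - t\<bar> < d' \<longrightarrow> G s - G t = f (\<gamma> s) - f (\<gamma> t)"
      using primitive_along_any[OF G \<gamma> t V(1-3)] by blast
    show "\<exists>d>0. \<forall>s\<in>{a..b}. \<bar>s - t\<bar> < d \<longrightarrow> F s - G s = F t - G t"
    proof (intro exI[of _ "min d d'"] conjI ballI impI)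
      fix s assume "s \<in> {a..b}" "\<bar>s - t\<bar> < min d d'"
      then show "F s - G s = F t - G t" using V(5) d'(2) by force
    qed (use V d' in simp)
  qed
  then show ?thesis by simp
qed

lemma primitive_along_subinterval:
  assumes "primitive_along \<alpha> \<gamma> a b F" "a \<le> a'" "b' \<le> b"
  shows "primitive_along \<alpha> \<gamma> a' b' F"
proof -
  have sub: "{a'..b'} \<subseteq> {a..b}" using assms by auto
  show ?thesis unfolding primitive_along_def
  proof
    fix t assume "t \<in> {a'..b'}"
    with sub have "t \<in> {a..b}" by blast
    from primitive_alongD[OF assms(1) this] obtain V f d
      where "open V" "\<gamma> t \<in> V" "primitive_on A V \<alpha> f" "d > 0"
        "\<forall>s\<in>{a..b}. \<bar>s - t\<bar> < d \<longrightarrow> F s - F t = f (\<gamma> s) - f (\<gamma> t)"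
      by blast
    with sub show "\<exists>V f. open V \<and> \<gamma> t \<in> V \<and> primitive_on A V \<alpha> f \<and>
     (\<exists>d>0. \<forall>s\<in>{a'..b'}. \<bar>s - t\<bar> < d \<longrightarrow> F s - F t = f (\<gamma> s) - f (\<gamma> t))" by blast
  qed
qed

lemma primitive_along_primitive:
  assumes "open V" "primitive_on A V \<alpha> f" "\<gamma> ` {a..b} \<subseteq> V"
  shows "primitive_along \<alpha> \<gamma> a b (f \<circ> \<gamma>)"
  unfolding primitive_along_def comp_apply using assms by (blast intro: zero_less_one)

lemma primitive_along_in:
  assumes F: "primitive_along \<alpha> \<gamma> a b F" and \<gamma>: "continuous_on {a..b} \<gamma>"
    and "open V" "primitive_on A V \<alpha> f" "\<gamma> ` {a..b} \<subseteq> V" and st: "s \<in> {a..b}" "t \<in> {a..b}"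
  shows "F t - F s = f (\<gamma> t) - f (\<gamma> s)"
  using primitive_along_unique[OF F primitive_along_primitive[OF assms(3-5)] \<gamma> st(2,1)] by simp

lemma primitive_along_glue:
  assumes F: "primitive_along \<alpha> \<gamma> a b F" and G: "primitive_along \<alpha> \<gamma> b c G"
    and \<gamma>: "continuous_on {a..c} \<gamma>" and abc: "a \<le> b" "b \<le> c"
  shows "primitive_along \<alpha> \<gamma> a c (\<lambda>t. if t \<le> b then F t else F b + (G t - G b))"
  unfolding primitive_along_def
proof
  fix t assume t: "t \<in> {a..c}"
  let ?H = "\<lambda>t. if t \<le> b then F t else F b + (G t - G b)"
  have \<gamma>1: "continuous_on {a..b} \<gamma>" and \<gamma>2: "continuous_on {b..c} \<gamma>"
    using \<gamma> abc by (auto intro: continuous_on_subset)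
  have nF: "\<exists>d>0. \<forall>s\<in>{a..b}. \<bar>s - t\<bar> < d \<longrightarrow> F s - F t = f (\<gamma> s) - f (\<gamma> t)"
    if "t \<in> {a..b}" "open V" "\<gamma> t \<in> V" "primitive_on A V \<alpha> f" for V f
    by (rule primitive_along_any[OF F \<gamma>1 that])
  have nG: "\<exists>d>0. \<forall>s\<in>{b..c}. \<bar>s - t\<bar> < d \<longrightarrow> G s - G t = f (\<gamma> s) - f (\<gamma> t)"
    if "t \<in> {b..c}" "open V" "\<gamma> t \<in> V" "primitive_on A V \<alpha> f" for V f
    by (rule primitive_along_any[OF G \<gamma>2 that])
  have "\<exists>V f. open V \<and> \<gamma> t \<in> V \<and> primitive_on A V \<alpha> f"
  proof (cases "t \<le> b")
    case True
    then have "t \<in> {a..b}" using t by simp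
    from primitive_alongD[OF F this] show ?thesis by blast
  next
    case False
    then have "t \<in> {b..c}" using t by simp
    from primitive_alongD[OF G this] show ?thesis by blast
  qed
  then obtain V f where V: "open V" "\<gamma> t \<in> V" "primitive_on A V \<alpha> f" by blast
  have "\<exists>d>0. \<forall>s\<in>{a..c}. \<bar>s - t\<bar> < d \<longrightarrow> ?H s - ?H t = f (\<gamma> s) - f (\<gamma> t)"
  proof -
    consider "t < b" | "t = b" | "t > b" by linarith
    then show ?thesis
    proof cases
      case 1
      then obtain d where d: "d > 0" "\<forall>s\<in>{a..b}. \<bar>s - t\<bar> < d \<longrightarrow> F s - F t = f (\<gamma> s) - f (\<gamma> t)"
        using nF[OF _ V] t by auto
      show ?thesis
        by (intro exI[of _ "min d (b - t)"]) (use d 1 t in auto)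
    next
      case 2
      then obtain d where d: "d > 0" "\<forall>s\<in>{a..b}. \<bar>s - t\<bar> < d \<longrightarrow> F s - F t = f (\<gamma> s) - f (\<gamma> t)"
        using nF[OF _ V] t by auto
      obtain d' where d': "d' > 0" "\<forall>s\<in>{b..c}. \<bar>s - t\<bar> < d' \<longrightarrow> G s - G t = f (\<gamma> s) - f (\<gamma> t)"
        using nG[OF _ V] t 2 by auto
      show ?thesis
        by (intro exI[of _ "min d d'"]) (use d d' 2 t in auto)
    next
      case 3
      then obtain d where d: "d > 0" "\<forall>s\<in>{b..c}. \<bar>s - t\<bar> < d \<longrightarrow> G s - G t = f (\<gamma> s) - f (\<gamma> t)"
        using nG[OF _ V] t by auto
      show ?thesis
        by (intro exI[of _ "min d (t - b)"]) (use d 3 t in auto)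
    qed
  qed
  with V show "\<exists>V f. open V \<and> \<gamma> t \<in> V \<and> primitive_on A V \<alpha> f \<and>
     (\<exists>d>0. \<forall>s\<in>{a..c}. \<bar>s - t\<bar> < d \<longrightarrow> ?H s - ?H t = f (\<gamma> s) - f (\<gamma> t))" by blast
qed

text \<open>Bolzano's bisection principle: the property passes from adjacent intervals to their
  union by gluing, and on a short interval the curve stays in the domain of one local
  primitive.\<close>

lemma primitive_along_exists:
  assumes \<alpha>: "closed_form A \<alpha>" and \<gamma>: "continuous_on {a..b} \<gamma>" and "a \<le> b"
  shows "\<exists>F. primitive_along \<alpha> \<gamma> a b F"
proof -
  have "a \<le> a \<longrightarrow> b \<le> b \<longrightarrow> (\<exists>F. primitive_along \<alpha> \<gamma> a b F)"
    using \<open>a \<le> b\<close>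
  proof (induction rule: Bolzano[where P = "\<lambda>u v. a \<le> u \<longrightarrow> v \<le> b \<longrightarrow> (\<exists>F. primitive_along \<alpha> \<gamma> u v F)"])
    case (trans u v w)
    have "\<exists>F. primitive_along \<alpha> \<gamma> u w F" if "a \<le> u" "w \<le> b"
    proof -
      have "v \<le> b" "a \<le> v" using trans(3,4) that by auto
      with trans(1,2) that obtain F G where "primitive_along \<alpha> \<gamma> u v F" "primitive_along \<alpha> \<gamma> v w G"
        by blast
      moreover have "continuous_on {u..w} \<gamma>" using \<gamma> by (rule continuous_on_subset) (use that in auto)
      ultimately show ?thesis using primitive_along_glue trans(3,4) by blast
    qed
    then show ?case by blast
  next
    case (local x)
    obtain V f where V: "open V" "\<gamma> x \<in> V" "primitive_on A V \<alpha> f"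
      by (rule closed_form_local_primitive[OF \<alpha>])
    obtain d where d: "d > 0" "\<forall>s\<in>{a..b}. \<bar>s - x\<bar> < d \<longrightarrow> \<gamma> s \<in> V"
      using continuous_on_near[OF \<gamma> _ V(1,2)] local by auto
    show ?case
    proof (intro exI[of _ d] conjI allI impI d(1))
      fix u v assume uv: "u \<le> x \<and> x \<le> v \<and> v - u < d" "a \<le> u" "v \<le> b"
      have "\<gamma> ` {u..v} \<subseteq> V" using uv d(2) by auto
      then show "\<exists>F. primitive_along \<alpha> \<gamma> u v F"
        using primitive_along_primitive[OF V(1,3)] by blast
    qed
  qed
  then show ?thesis by simp
qed

text \<open>A Lebesgue number for the cover of the parameter interval by sets of times on which one
  primitive suffices gives equal steps. The subdivision supplies the existence part of the definite
  description in \<open>path_integral\<close>.\<close>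

lemma fine_subdivision:
  assumes \<alpha>: "closed_form A \<alpha>" and \<gamma>: "path \<gamma>"
  obtains k :: nat and f where "k > 0"
    "\<And>i. i < k \<Longrightarrow> \<exists>V. open V \<and> \<gamma> ` {real i / real k .. real (Suc i) / real k} \<subseteq> V \<and> primitive_on A V \<alpha> (f i)"
proof -
  have c\<gamma>: "continuous_on {0..1} \<gamma>" using \<gamma> by (simp add: path_def)
  define \<C> where "\<C> = {B. open B \<and> (\<exists>V f. open V \<and> primitive_on A V \<alpha> f \<and> \<gamma> ` (B \<inter> {0..1}) \<subseteq> V)}"
  have cov: "{0..1} \<subseteq> \<Union>\<C>"
  proof
    fix t :: real assume t: "t \<in> {0..1}"
    obtain V f where V: "open V" "\<gamma> t \<in> V" "primitive_on A V \<alpha> f"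
      by (rule closed_form_local_primitive[OF \<alpha>])
    obtain d where d: "d > 0" "\<forall>s\<in>{0..1}. \<bar>s - t\<bar> < d \<longrightarrow> \<gamma> s \<in> V"
      using continuous_on_near[OF c\<gamma> t V(1,2)] by blast
    have "\<gamma> s \<in> V" if "s \<in> ball t d" "s \<in> {0..1}" for s
      using d(2) that by (simp add: dist_real_def abs_minus_commute)
    then have "\<gamma> ` (ball t d \<inter> {0..1}) \<subseteq> V" by blast
    with V(1,3) have "ball t d \<in> \<C>" unfolding \<C>_def mem_Collect_eq by (intro conjI exI[of _ V] exI[of _ f]) auto
    then show "t \<in> \<Union>\<C>" by (rule UnionI) (use d(1) in simp)
  qed
  obtain \<delta> where \<delta>: "0 < \<delta>" "\<And>T. T \<subseteq> {0..1} \<Longrightarrow> diameter T < \<delta> \<Longrightarrow> \<exists>B\<in>\<C>. T \<subseteq> B"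
  proof (rule Lebesgue_number_lemma[of "{0..1::real}" \<C>])
    show "\<C> \<noteq> {}" using cov by force
    show "open B" if "B \<in> \<C>" for B using that by (simp add: \<C>_def)
  qed (use cov in auto)
  obtain k :: nat where k: "k > 0" "1 / real k < \<delta>"
    using \<delta>(1) by (rule nat_approx_posE) (metis that zero_less_Suc)
  have "\<exists>f V. open V \<and> \<gamma> ` {real i / real k .. real (Suc i) / real k} \<subseteq> V \<and> primitive_on A V \<alpha> f"
    if i: "i < k" for i
  proof -
    let ?T = "{real i / real k .. real (Suc i) / real k}"
    have "real (Suc i) / real k \<le> 1" using i k(1) by simp
    moreover have "0 \<le> real i / real k" by simp
    ultimately have T: "?T \<subseteq> {0..1}" by (simp del: of_nat_Suc)
    have "real i / real k \<le> real (Suc i) / real k" by (simp add: divide_right_mono)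
    moreover have "real (Suc i) / real k - real i / real k = 1 / real k"
      by (simp add: diff_divide_distrib[symmetric])
    ultimately have "diameter ?T = 1 / real k"
      using diameter_closed_interval[of "real i / real k" "real (Suc i) / real k"] by (simp del: of_nat_Suc)
    with k(2) obtain B where B: "B \<in> \<C>" "?T \<subseteq> B" using \<delta>(2)[OF T] by auto
    from B(1) have "\<exists>V f. open V \<and> primitive_on A V \<alpha> f \<and> \<gamma> ` (B \<inter> {0..1}) \<subseteq> V"
      unfolding \<C>_def mem_Collect_eq by (rule conjunct2)
    then obtain V f where V: "open V" "primitive_on A V \<alpha> f" "\<gamma> ` (B \<inter> {0..1}) \<subseteq> V" by blast
    have "\<gamma> ` ?T \<subseteq> \<gamma> ` (B \<inter> {0..1})" by (rule image_mono) (use T B(2) in simp)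
    with V(3) have "\<gamma> ` ?T \<subseteq> V" by (rule subset_trans[rotated])
    with V(1,2) show ?thesis by (intro exI[of _ f] exI[of _ V] conjI)
  qed
  then obtain f where "\<And>i. i < k \<Longrightarrow>
      \<exists>V. open V \<and> \<gamma> ` {real i / real k .. real (Suc i) / real k} \<subseteq> V \<and> primitive_on A V \<alpha> (f i)"
    by metis
  then show thesis by (rule that[OF k(1)])
qed

text \<open>On each interval of a subdivision the local primitive and \<open>F\<close> have equal
  increments, so every admissible sum telescopes to the same value.\<close>

lemma path_integral_eq:
  assumes \<alpha>: "closed_form A \<alpha>" and \<gamma>: "path \<gamma>" and F: "primitive_along \<alpha> \<gamma> 0 1 F"
  shows "path_integral A \<alpha> \<gamma> = F 1 - F 0"
  unfolding path_integral_def
proof (rule the_equality)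
  have c\<gamma>: "continuous_on {0..1} \<gamma>" using \<gamma> by (simp add: path_def)
  have chain: "(\<Sum>i<k. f i (\<gamma> (t (Suc i))) - f i (\<gamma> (t i))) = F 1 - F 0"
    if t: "t 0 = 0" "t k = 1"
      and tf: "\<And>i. i < k \<Longrightarrow> t i \<le> t (Suc i) \<and>
        (\<exists>V. open V \<and> \<gamma> ` {t i..t (Suc i)} \<subseteq> V \<and> primitive_on A V \<alpha> (f i))"
    for k :: nat and t :: "nat \<Rightarrow> real" and f
  proof -
    have t0: "0 \<le> t i" if "i \<le> k" for i
      using that
    proof (induction i)
      case (Suc i)
      then show ?case using tf[of i] by simp
    qed (simp add: t)
    have t1: "t i \<le> 1" if "i \<le> k" for i
      using that
    proof (induction rule: inc_induct)
      case (step i)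
      then show ?case using tf[of i] by simp
    qed (simp add: t)
    have "f i (\<gamma> (t (Suc i))) - f i (\<gamma> (t i)) = F (t (Suc i)) - F (t i)" if i: "i < k" for i
    proof -
      obtain V where V: "open V" "\<gamma> ` {t i..t (Suc i)} \<subseteq> V" "primitive_on A V \<alpha> (f i)"
        and le: "t i \<le> t (Suc i)" using tf[OF i] by blast
      have bd: "0 \<le> t i" "t (Suc i) \<le> 1" using t0[of i] t1[of "Suc i"] i by auto
      show ?thesis
        by (rule primitive_along_in[OF primitive_along_subinterval[OF F bd] _ V(1,3,2), symmetric])
          (use le bd in \<open>auto intro: continuous_on_subset[OF c\<gamma>]\<close>)
    qed
    then have "(\<Sum>i<k. f i (\<gamma> (t (Suc i))) - f i (\<gamma> (t i))) = (\<Sum>i<k. F (t (Suc i)) - F (t i))"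
      by (intro sum.cong) auto
    also have "\<dots> = F (t k) - F (t 0)" by (rule sum_lessThan_telescope)
    finally show ?thesis by (simp add: t)
  qed
  obtain k :: nat and f where k: "k > 0"
    "\<And>i. i < k \<Longrightarrow> \<exists>V. open V \<and> \<gamma> ` {real i / real k .. real (Suc i) / real k} \<subseteq> V \<and> primitive_on A V \<alpha> (f i)"
    using fine_subdivision[OF \<alpha> \<gamma>] by blast
  define t where "t = (\<lambda>i. real i / real k)"
  have t: "t 0 = 0" "t k = 1" using k(1) by (simp_all add: t_def)
  have tf: "t i \<le> t (Suc i) \<and>
        (\<exists>V. open V \<and> \<gamma> ` {t i..t (Suc i)} \<subseteq> V \<and> primitive_on A V \<alpha> (f i))" if "i < k" for i
    using k(2)[OF that] by (simp add: t_def divide_right_mono)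
  show "\<exists>(k::nat) t f. t 0 = 0 \<and> t k = 1 \<and>
     (\<forall>i<k. t i \<le> t (Suc i) \<and>
        (\<exists>V. open V \<and> \<gamma> ` {t i..t (Suc i)} \<subseteq> V \<and> primitive_on A V \<alpha> (f i))) \<and>
     F 1 - F 0 = (\<Sum>i<k. f i (\<gamma> (t (Suc i))) - f i (\<gamma> (t i)))"
    by (intro exI[of _ k] exI[of _ t] exI[of _ f] conjI t allI impI tf chain[OF t tf, symmetric])
  fix s
  assume "\<exists>(k::nat) t f. t 0 = 0 \<and> t k = 1 \<and>
     (\<forall>i<k. t i \<le> t (Suc i) \<and>
        (\<exists>V. open V \<and> \<gamma> ` {t i..t (Suc i)} \<subseteq> V \<and> primitive_on A V \<alpha> (f i))) \<and>
     s = (\<Sum>i<k. f i (\<gamma> (t (Suc i))) - f i (\<gamma> (t i)))"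
  then obtain k :: nat and t f where "t 0 = 0" "t k = 1"
     "\<And>i. i < k \<Longrightarrow> t i \<le> t (Suc i) \<and>
        (\<exists>V. open V \<and> \<gamma> ` {t i..t (Suc i)} \<subseteq> V \<and> primitive_on A V \<alpha> (f i))"
     "s = (\<Sum>i<k. f i (\<gamma> (t (Suc i))) - f i (\<gamma> (t i)))" by blast
  then show "s = F 1 - F 0" using chain[of t k f] by simp
qed

section \<open>Path integrals: local evaluation, concatenation, comparison with line
  integrals\<close>

lemma path_integral_primitive:
  assumes \<alpha>: "closed_form A \<alpha>" and \<gamma>: "path \<gamma>" and V: "open V" "primitive_on A V \<alpha> f" "path_image \<gamma> \<subseteq> V"
  shows "path_integral A \<alpha> \<gamma> = f (pathfinish \<gamma>) - f (pathstart \<gamma>)"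
  using path_integral_eq[OF \<alpha> \<gamma> primitive_along_primitive[OF V(1,2)]] V(3)
  by (simp add: path_image_def pathfinish_def pathstart_def)

lemma primitive_along_reparam:
  assumes F: "primitive_along \<alpha> \<gamma> a b F" and \<phi>: "continuous_on {a'..b'} \<phi>" "\<phi> ` {a'..b'} \<subseteq> {a..b}"
    and eq: "\<And>t. t \<in> {a'..b'} \<Longrightarrow> \<gamma>' t = \<gamma> (\<phi> t)"
  shows "primitive_along \<alpha> \<gamma>' a' b' (F \<circ> \<phi>)"
  unfolding primitive_along_def
proof
  fix t assume t: "t \<in> {a'..b'}"
  then have "\<phi> t \<in> {a..b}" using \<phi>(2) by blast
  then obtain V f d where V: "open V" "\<gamma> (\<phi> t) \<in> V" "primitive_on A V \<alpha> f" "d > 0"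
      "\<forall>s\<in>{a..b}. \<bar>s - \<phi> t\<bar> < d \<longrightarrow> F s - F (\<phi> t) = f (\<gamma> s) - f (\<gamma> (\<phi> t))"
    using primitive_alongD[OF F] by blast
  obtain e where e: "e > 0" "\<forall>s\<in>{a'..b'}. \<bar>s - t\<bar> < e \<longrightarrow> \<phi> s \<in> ball (\<phi> t) d"
      using continuous_on_near[OF \<phi>(1) t open_ball, of "\<phi> t" d] V(4) by auto
  have "\<forall>s\<in>{a'..b'}. \<bar>s - t\<bar> < e \<longrightarrow> (F \<circ> \<phi>) s - (F \<circ> \<phi>) t = f (\<gamma>' s) - f (\<gamma>' t)"
  proof (intro ballI impI)
    fix s assume s: "s \<in> {a'..b'}" "\<bar>s - t\<bar> < e"
    then have "\<phi> s \<in> {a..b}" using \<phi>(2) by blast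
    moreover have "\<bar>\<phi> s - \<phi> t\<bar> < d" using s e(2) by (auto simp: dist_real_def abs_minus_commute)
    ultimately show "(F \<circ> \<phi>) s - (F \<circ> \<phi>) t = f (\<gamma>' s) - f (\<gamma>' t)" using V(5) eq s(1) t by simp
  qed
  with V(1-3) e(1) eq[OF t] show "\<exists>V f. open V \<and> \<gamma>' t \<in> V \<and> primitive_on A V \<alpha> f \<and>
     (\<exists>d>0. \<forall>s\<in>{a'..b'}. \<bar>s - t\<bar> < d \<longrightarrow> (F \<circ> \<phi>) s - (F \<circ> \<phi>) t = f (\<gamma>' s) - f (\<gamma>' t))"
    by (metis (no_types, lifting))
qed

text \<open>A single primitive along the joined curve, reparametrised, serves both halves; its value
  at time 1/2 cancels.\<close>

lemma path_integral_join:
  assumes \<alpha>: "closed_form A \<alpha>" and \<gamma>: "path \<gamma>" "path \<delta>" "pathfinish \<gamma> = pathstart \<delta>"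
  shows "path_integral A \<alpha> (\<gamma> +++ \<delta>) = path_integral A \<alpha> \<gamma> + path_integral A \<alpha> \<delta>"
proof -
  have p: "path (\<gamma> +++ \<delta>)" using \<gamma> by simp
  obtain F where F: "primitive_along \<alpha> (\<gamma> +++ \<delta>) 0 1 F"
    using primitive_along_exists[OF \<alpha>, of 0 1] p by (auto simp: path_def)
  have "primitive_along \<alpha> \<gamma> 0 1 (F \<circ> (\<lambda>t. t / 2))"
    by (rule primitive_along_reparam[OF F]) (auto intro!: continuous_intros simp: joinpaths_def)
  then have 1: "path_integral A \<alpha> \<gamma> = F (1 / 2) - F 0"
    using path_integral_eq[OF \<alpha> \<gamma>(1)] by simp
  have "primitive_along \<alpha> \<delta> 0 1 (F \<circ> (\<lambda>t. (t + 1) / 2))"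
  proof (rule primitive_along_reparam[OF F])
    fix t :: real assume "t \<in> {0..1}"
    then show "\<delta> t = (\<gamma> +++ \<delta>) ((t + 1) / 2)"
      using \<gamma>(3) by (auto simp: joinpaths_def pathfinish_def pathstart_def add_divide_distrib)
  qed (auto intro!: continuous_intros)
  then have 2: "path_integral A \<alpha> \<delta> = F 1 - F (1 / 2)"
    using path_integral_eq[OF \<alpha> \<gamma>(2)] by simp
  show ?thesis using path_integral_eq[OF \<alpha> p F] 1 2 by simp
qed

lemma primitive_along_derivative:
  assumes F: "primitive_along \<alpha> \<gamma> 0 1 F" and \<gamma>: "C1_curve A \<gamma>" and t: "t \<in> {0..1}"
    and c: "c \<in> A" "\<gamma> t \<in> cdom c"
  shows "(F has_vector_derivative blinfun_apply (\<alpha> c (cmap c (\<gamma> t)))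
      (vector_derivative (cmap c \<circ> \<gamma>) (at t within {0..1}))) (at t within {0..1})"
proof -
  have c\<gamma>: "continuous_on {0..1} \<gamma>" using \<gamma> by (simp add: C1_curve_def path_def)
  obtain D where D: "(cmap c \<circ> \<gamma> has_vector_derivative D) (at t within {0..1})"
    using \<gamma> t c unfolding C1_curve_def by blast
  have vd: "vector_derivative (cmap c \<circ> \<gamma>) (at t within {0..1}) = D"
    by (rule vector_derivative_within_cbox[of 0 1 t, unfolded cbox_interval, OF _ t D]) simp
  obtain V f d where V: "open V" "\<gamma> t \<in> V" "primitive_on A V \<alpha> f" "d > 0"
      "\<forall>s\<in>{0..1}. \<bar>s - t\<bar> < d \<longrightarrow> F s - F t = f (\<gamma> s) - f (\<gamma> t)"
    using primitive_alongD[OF F t] by blast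
  obtain e where e: "e > 0" "\<forall>s\<in>{0..1}. \<bar>s - t\<bar> < e \<longrightarrow> \<gamma> s \<in> cdom c"
      using continuous_on_near[OF c\<gamma> t open_cdom[OF c(1)] c(2)] by blast
  have "(f \<circ> cinv c has_derivative blinfun_apply (\<alpha> c (cmap c (\<gamma> t)))) (at ((cmap c \<circ> \<gamma>) t))"
    using primitive_onD[OF V(3) c(1) V(2) c(2)] by simp
  from has_derivative_compose[OF D[unfolded has_vector_derivative_def] this]
  have 1: "((\<lambda>s. (f \<circ> cinv c) ((cmap c \<circ> \<gamma>) s)) has_derivative
      (\<lambda>h. blinfun_apply (\<alpha> c (cmap c (\<gamma> t))) (h *\<^sub>R D))) (at t within {0..1})" .
  have "((\<lambda>s. (f \<circ> cinv c) ((cmap c \<circ> \<gamma>) s) + (F t - f (\<gamma> t))) has_derivative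
      (\<lambda>h. blinfun_apply (\<alpha> c (cmap c (\<gamma> t))) (h *\<^sub>R D))) (at t within {0..1})"
    by (rule has_derivative_add_const[OF 1])
  then have "(F has_derivative (\<lambda>h. blinfun_apply (\<alpha> c (cmap c (\<gamma> t))) (h *\<^sub>R D))) (at t within {0..1})"
  proof (rule has_derivative_transform_within[where d = "min d e"])
    fix s assume s: "s \<in> {0..1}" "dist s t < min d e"
    then show "(f \<circ> cinv c) ((cmap c \<circ> \<gamma>) s) + (F t - f (\<gamma> t)) = F s"
      using bspec[OF V(5) s(1)] bspec[OF e(2) s(1)] cinv_cmap[OF c(1), of "\<gamma> s"] by (simp add: dist_real_def)
  qed (use V e t in auto)
  then show ?thesis
    unfolding vd has_vector_derivative_def by (simp add: blinfun.scaleR_right)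
qed

text \<open>The primitive along the curve has the integrand as its derivative at every time. The
  chart in the integrand may change abruptly with the time, but the derivative at one time can be
  computed in any chart, and the fundamental theorem for the gauge integral asks for nothing
  more.\<close>

lemma line_integral_eq_path_integral:
  assumes \<alpha>: "closed_form A \<alpha>" and \<gamma>: "C1_curve A \<gamma>"
  shows "line_integral A \<alpha> \<gamma> = path_integral A \<alpha> \<gamma>"
proof -
  have p: "path \<gamma>" using \<gamma> by (simp add: C1_curve_def)
  obtain F where F: "primitive_along \<alpha> \<gamma> 0 1 F"
    using primitive_along_exists[OF \<alpha>, of 0 1] p by (auto simp: path_def)
  let ?i = "\<lambda>t. let c = chart_at A (\<gamma> t)
     in blinfun_apply (\<alpha> c (cmap c (\<gamma> t))) (vector_derivative (cmap c \<circ> \<gamma>) (at t within {0..1}))"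
  have "(?i has_integral F 1 - F 0) {0..1}"
    by (rule fundamental_theorem_of_calculus)
      (use primitive_along_derivative[OF F \<gamma> _ chart_at] in \<open>auto simp: Let_def\<close>)
  then show ?thesis
    unfolding line_integral_def path_integral_eq[OF \<alpha> p F] by (rule integral_unique)
qed

end

section \<open>Joining points by curves of class C1\<close>

lemma has_vector_derivative_within_Un:
  fixes f :: "real \<Rightarrow> 'a::real_normed_vector"
  assumes "(f has_vector_derivative d) (at t within S)" "(f has_vector_derivative d) (at t within T)"
  shows "(f has_vector_derivative d) (at t within S \<union> T)"
  using assms unfolding has_vector_derivative_def has_derivative_within
  by (auto simp: at_within_union intro: filterlim_sup)

lemma has_vector_derivative_halves:
  fixes f :: "real \<Rightarrow> 'a::real_normed_vector"
  assumes l: "t \<le> 1/2 \<Longrightarrow> (f has_vector_derivative d) (at t within {0..1/2})"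
    and r: "1/2 \<le> t \<Longrightarrow> (f has_vector_derivative d) (at t within {1/2..1})"
  shows "(f has_vector_derivative d) (at t within {0..1})"
proof -
  \<comment> \<open>Away from the closed half the filter is trivial, and a derivative within it
    holds vacuously.\<close>
  have bot: "(f has_vector_derivative d) (at t within S)" if "closed S" "t \<notin> S" for S
  proof -
    have "at t within S = bot"
      using that by (auto simp: trivial_limit_within closed_limpt)
    then show ?thesis
      by (simp add: has_vector_derivative_def has_derivative_def bounded_linear_scaleR_left)
  qed
  have "(f has_vector_derivative d) (at t within {0..1/2})"
    by (cases "t \<le> 1/2") (auto intro: l bot)
  moreover have "(f has_vector_derivative d) (at t within {1/2..1})"
    by (cases "1/2 \<le> t") (auto intro: r bot)
  ultimately have "(f has_vector_derivative d) (at t within {0..1/2} \<union> {1/2..1})"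
    by (rule has_vector_derivative_within_Un)
  moreover have "{0..1/2} \<union> {1/2..1} = {0..1::real}" by auto
  ultimately show ?thesis by simp
qed

context atlas
begin

text \<open>With velocity 0 at both ends, curves can be concatenated without losing \<open>C\<^sup>1\<close>.\<close>

definition flat_curve :: "(real \<Rightarrow> 'm) \<Rightarrow> bool" where
  "flat_curve \<gamma> \<longleftrightarrow> path \<gamma> \<and>
     (\<forall>c\<in>A. \<exists>D. continuous_on {t\<in>{0..1}. \<gamma> t \<in> cdom c} D \<and> D 0 = 0 \<and> D 1 = 0 \<and>
        (\<forall>t\<in>{0..1}. \<gamma> t \<in> cdom c \<longrightarrow>
           ((cmap c \<circ> \<gamma>) has_vector_derivative D t) (at t within {0..1})))"

lemma flat_curve_C1: "flat_curve \<gamma> \<Longrightarrow> C1_curve A \<gamma>"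
  unfolding flat_curve_def C1_curve_def by (elim conjE) (intro conjI, assumption, meson)

text \<open>The parameter \<open>t\<^sup>2 * (3 - 2 * t)\<close> runs from 0 to 1 and has derivative
  \<open>6 * t * (1 - t)\<close>, which vanishes at both ends. A straight segment in a chart is thus
  traversed with velocity 0 at its end points.\<close>

lemma flat_curve_segment:
  assumes c: "c \<in> A" and B: "ball x0 r \<subseteq> cimg c" and xy: "x \<in> ball x0 r" "y \<in> ball x0 r"
  shows "flat_curve (\<lambda>t. cinv c (x + (t\<^sup>2 * (3 - 2 * t)) *\<^sub>R (y - x)))"
proof -
  define z where "z = (\<lambda>t::real. x + (t\<^sup>2 * (3 - 2 * t)) *\<^sub>R (y - x))"
  have z: "z t \<in> ball x0 r" if "t \<in> {0..1}" for t
  proof -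
    have "t\<^sup>2 * (3 - 2 * t) \<ge> 0" using that by simp
    \<comment> \<open>The factorisation shows that the parameter is at most 1, so the point stays on
      the segment.\<close>
    moreover have "1 - t\<^sup>2 * (3 - 2 * t) = (1 - t)\<^sup>2 * (1 + 2 * t)" by algebra
    then have "t\<^sup>2 * (3 - 2 * t) \<le> 1" using that by (smt (verit) mult_nonneg_nonneg zero_le_power2 atLeastAtMost_iff)
    moreover have "z t = (1 - t\<^sup>2 * (3 - 2 * t)) *\<^sub>R x + (t\<^sup>2 * (3 - 2 * t)) *\<^sub>R y"
      by (simp add: z_def algebra_simps)
    ultimately show ?thesis using convexD_alt[OF convex_ball xy] by simp
  qed
  then have zc: "z t \<in> cimg c" if "t \<in> {0..1}" for t using that B by blast
  have z_cont: "continuous_on S z" for S unfolding z_def by (intro continuous_intros)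
  have z_der: "(z has_vector_derivative (6 * t * (1 - t)) *\<^sub>R (y - x)) (at t within S)" for t S
    unfolding z_def has_vector_derivative_def
    by (auto intro!: derivative_eq_intros simp: algebra_simps power2_eq_square)
  have "path (\<lambda>t. cinv c (z t))"
    unfolding path_def by (rule continuous_on_compose2[OF continuous_on_cinv[OF c] z_cont]) (use zc in blast)
  moreover have "\<exists>D. continuous_on {t\<in>{0..1}. cinv c (z t) \<in> cdom d} D \<and> D 0 = 0 \<and> D 1 = 0 \<and>
        (\<forall>t\<in>{0..1}. cinv c (z t) \<in> cdom d \<longrightarrow>
           ((cmap d \<circ> (\<lambda>t. cinv c (z t))) has_vector_derivative D t) (at t within {0..1}))" if d: "d \<in> A" for d
  proof (intro exI conjI ballI impI)
    let ?D = "\<lambda>t. (6 * t * (1 - t)) *\<^sub>R dtransition c d (z t) (y - x)"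
    have mem: "z t \<in> cmap c ` (cdom c \<inter> cdom d)" if "t \<in> {0..1}" "cinv c (z t) \<in> cdom d" for t
      using cmap_cinv[OF c zc] cinv_cdom[OF c zc] that by (metis IntI imageI)
    show "continuous_on {t\<in>{0..1}. cinv c (z t) \<in> cdom d} ?D"
    proof (intro continuous_intros)
      show "continuous_on {t \<in> {0..1}. cinv c (z t) \<in> cdom d} (\<lambda>t. dtransition c d (z t) (y - x))"
        by (rule continuous_on_compose2[OF continuous_on_dtransition[OF c d] z_cont]) (use mem in blast)
    qed
    fix t :: real assume t: "t \<in> {0..1}" "cinv c (z t) \<in> cdom d"
    have eq: "cmap c (cinv c (z t)) = z t" by (rule cmap_cinv[OF c zc[OF t(1)]])
    have "(transition c d has_derivative dtransition c d (z t)) (at (z t))"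
      using transition_derivative[OF c d cinv_cdom[OF c zc[OF t(1)]] t(2)] by (simp only: eq)
    from has_derivative_compose[OF z_der[unfolded has_vector_derivative_def] this]
    have "((\<lambda>s. transition c d (z s)) has_derivative
        (\<lambda>h. dtransition c d (z t) (h *\<^sub>R (6 * t * (1 - t)) *\<^sub>R (y - x)))) (at t within {0..1})" .
    moreover have "linear (dtransition c d (z t))"
      using linear_dtransition[OF c d cinv_cdom[OF c zc[OF t(1)]] t(2)] by (simp only: eq)
    ultimately show "((cmap d \<circ> (\<lambda>t. cinv c (z t))) has_vector_derivative ?D t) (at t within {0..1})"
      by (simp add: has_vector_derivative_def transition_def o_def linear_cmul)
  qed auto
  ultimately show ?thesis unfolding flat_curve_def z_def by blast
qed

lemma flat_curve_join:
  assumes \<gamma>: "flat_curve \<gamma>" and \<delta>: "flat_curve \<delta>" and ends: "pathfinish \<gamma> = pathstart \<delta>"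
  shows "flat_curve (\<gamma> +++ \<delta>)"
  unfolding flat_curve_def
proof (intro conjI ballI)
  show "path (\<gamma> +++ \<delta>)" using \<gamma> \<delta> ends by (simp add: flat_curve_def)
  fix c assume c: "c \<in> A"
  obtain D where D: "continuous_on {t\<in>{0..1}. \<gamma> t \<in> cdom c} D" "D 0 = 0" "D 1 = 0"
      "\<forall>t\<in>{0..1}. \<gamma> t \<in> cdom c \<longrightarrow> ((cmap c \<circ> \<gamma>) has_vector_derivative D t) (at t within {0..1})"
    using \<gamma> c unfolding flat_curve_def by blast
  obtain E where E: "continuous_on {t\<in>{0..1}. \<delta> t \<in> cdom c} E" "E 0 = 0" "E 1 = 0"
      "\<forall>t\<in>{0..1}. \<delta> t \<in> cdom c \<longrightarrow> ((cmap c \<circ> \<delta>) has_vector_derivative E t) (at t within {0..1})"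
    using \<delta> c unfolding flat_curve_def by blast
  let ?\<eta> = "\<gamma> +++ \<delta>"
  let ?D = "\<lambda>t. if t \<le> 1/2 then 2 *\<^sub>R D (2 * t) else 2 *\<^sub>R E (2 * t - 1)"
  have \<eta>1: "?\<eta> t = \<gamma> (2 * t)" if "t \<le> 1/2" for t using that by (simp add: joinpaths_def)
  have \<eta>2: "?\<eta> t = \<delta> (2 * t - 1)" if "t \<ge> 1/2" for t
  proof (cases "2 * t = 1")
    case True
    show ?thesis using ends by (simp add: joinpaths_def pathfinish_def pathstart_def True)
  qed (use that in \<open>simp add: joinpaths_def\<close>)
  show "\<exists>D. continuous_on {t\<in>{0..1}. ?\<eta> t \<in> cdom c} D \<and> D 0 = 0 \<and> D 1 = 0 \<and>
        (\<forall>t\<in>{0..1}. ?\<eta> t \<in> cdom c \<longrightarrow>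
           ((cmap c \<circ> ?\<eta>) has_vector_derivative D t) (at t within {0..1}))"
  proof (intro exI conjI ballI impI)
    show "continuous_on {t\<in>{0..1}. ?\<eta> t \<in> cdom c} ?D"
    proof (rule continuous_on_cases_le)
      show "continuous_on {t \<in> {t \<in> {0..1}. ?\<eta> t \<in> cdom c}. t \<le> 1/2} (\<lambda>t. 2 *\<^sub>R D (2 * t))"
        by (intro continuous_intros continuous_on_compose2[OF D(1)]) (use \<eta>1 in auto)
      show "continuous_on {t \<in> {t \<in> {0..1}. ?\<eta> t \<in> cdom c}. 1/2 \<le> t} (\<lambda>t. 2 *\<^sub>R E (2 * t - 1))"
        by (intro continuous_intros continuous_on_compose2[OF E(1)]) (use \<eta>2 in auto)
      show "2 *\<^sub>R D (2 * t) = 2 *\<^sub>R E (2 * t - 1)" if "t = 1/2" for t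
        using D(3) E(2) by (simp add: that)
    qed (rule continuous_on_id)
    show "?D 0 = 0" "?D 1 = 0" using D E by auto
    fix t :: real assume t: "t \<in> {0..1}" "?\<eta> t \<in> cdom c"
    show "((cmap c \<circ> ?\<eta>) has_vector_derivative ?D t) (at t within {0..1})"
    proof (rule has_vector_derivative_halves)
      assume t1: "t \<le> 1/2"
      have im: "(\<lambda>t. 2 * t) ` {0..1/2} = {0..1::real}"
        by (auto simp: image_iff intro!: bexI[of _ "_ / 2"])
      have "((cmap c \<circ> \<gamma>) has_vector_derivative D (2 * t)) (at (2 * t) within (\<lambda>t. 2 * t) ` {0..1/2})"
        unfolding im using D(4) t t1 \<eta>1[OF t1] by auto
      moreover have "((\<lambda>t. 2 * t) has_vector_derivative 2) (at t within {0..1/2})"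
        by (auto intro!: derivative_eq_intros)
      ultimately have "((cmap c \<circ> \<gamma>) \<circ> (\<lambda>t. 2 * t) has_vector_derivative 2 *\<^sub>R D (2 * t)) (at t within {0..1/2})"
        by (intro vector_diff_chain_within)
      then have "((cmap c \<circ> ?\<eta>) has_vector_derivative 2 *\<^sub>R D (2 * t)) (at t within {0..1/2})"
        by (rule has_vector_derivative_transform[rotated 2]) (use t t1 \<eta>1 in auto)
      then show "((cmap c \<circ> ?\<eta>) has_vector_derivative ?D t) (at t within {0..1/2})"
        using t1 by simp
    next
      assume t2: "1/2 \<le> t"
      have im: "(\<lambda>t. 2 * t - 1) ` {1/2..1} = {0..1::real}"
        by (auto simp: image_iff add_divide_distrib intro!: bexI[of _ "(_ + 1) / 2"])
      have "((cmap c \<circ> \<delta>) has_vector_derivative E (2 * t - 1)) (at (2 * t - 1) within (\<lambda>t. 2 * t - 1) ` {1/2..1})"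
        unfolding im using E(4) t t2 \<eta>2[OF t2] by auto
      moreover have "((\<lambda>t. 2 * t - 1) has_vector_derivative 2) (at t within {1/2..1})"
        by (auto intro!: derivative_eq_intros)
      ultimately have "((cmap c \<circ> \<delta>) \<circ> (\<lambda>t. 2 * t - 1) has_vector_derivative 2 *\<^sub>R E (2 * t - 1)) (at t within {1/2..1})"
        by (intro vector_diff_chain_within)
      then have "((cmap c \<circ> ?\<eta>) has_vector_derivative 2 *\<^sub>R E (2 * t - 1)) (at t within {1/2..1})"
        by (rule has_vector_derivative_transform[rotated 2]) (use t t2 \<eta>2 in auto)
      moreover have "?D t = 2 *\<^sub>R E (2 * t - 1)"
      proof (cases "2 * t = 1")
        case True
        show ?thesis using D(3) E(2) by (simp add: True)
      qed (use t2 in simp)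
      ultimately show "((cmap c \<circ> ?\<eta>) has_vector_derivative ?D t) (at t within {1/2..1})"
        by simp
    qed
  qed
qed

lemma chart_ball_path:
  assumes c: "c \<in> A" and B: "ball x0 r \<subseteq> cimg c" and pq: "p \<in> cinv c ` ball x0 r" "q \<in> cinv c ` ball x0 r"
  obtains \<gamma> where "path \<gamma>" "pathstart \<gamma> = p" "pathfinish \<gamma> = q" "path_image \<gamma> \<subseteq> cinv c ` ball x0 r"
proof -
  obtain x y where xy: "x \<in> ball x0 r" "y \<in> ball x0 r" "p = cinv c x" "q = cinv c y" using pq by blast
  have sub: "path_image (linepath x y) \<subseteq> ball x0 r"
    using closed_segment_subset[OF xy(1,2) convex_ball] by simp
  show thesis
  proof (rule that[of "cinv c \<circ> linepath x y"])
    show "path (cinv c \<circ> linepath x y)"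
      by (rule path_continuous_image[OF path_linepath])
        (rule continuous_on_subset[OF continuous_on_cinv[OF c]], use sub B in blast)
    show "path_image (cinv c \<circ> linepath x y) \<subseteq> cinv c ` ball x0 r"
      using sub by (simp add: path_image_compose image_mono)
  qed (simp_all add: xy pathstart_compose pathfinish_compose)
qed

end

context closed_manifold
begin

text \<open>Flat curves concatenate, and any two points of a chart ball are joined by one, so
  connectedness applies. The relation asks for curves in both directions, which makes it symmetric
  without reversing a curve.\<close>

lemma C1_curve_exists:
  obtains \<gamma> where "C1_curve A \<gamma>" "pathstart \<gamma> = p" "pathfinish \<gamma> = q"
proof -
  define R where "R = (\<lambda>p q. \<exists>\<gamma>. flat_curve \<gamma> \<and> pathstart \<gamma> = p \<and> pathfinish \<gamma> = q)"
  have R_trans: "R p s" if "R p q" "R q s" for p q s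
  proof -
    obtain \<gamma> \<delta> where "flat_curve \<gamma>" "pathstart \<gamma> = p" "pathfinish \<gamma> = q"
        "flat_curve \<delta>" "pathstart \<delta> = q" "pathfinish \<delta> = s"
      using \<open>R p q\<close> \<open>R q s\<close> unfolding R_def by auto
    then show ?thesis
      unfolding R_def using flat_curve_join[of \<gamma> \<delta>] by (intro exI[of _ "\<gamma> +++ \<delta>"]) simp
  qed
  have loc: "\<exists>T. openin (top_of_set UNIV) T \<and> a \<in> T \<and> (\<forall>x\<in>T. R a x \<and> R x a)" for a
  proof -
    obtain c r where c: "c \<in> A" "ball (cmap c a) r \<subseteq> cimg c" "a \<in> cinv c ` ball (cmap c a) r"
      by (rule chart_ball_neighbourhood[OF open_UNIV UNIV_I])
    let ?W = "cinv c ` ball (cmap c a) r"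
    have "R x y" if xy: "x \<in> ?W" "y \<in> ?W" for x y
    proof -
      obtain u v where uv: "u \<in> ball (cmap c a) r" "v \<in> ball (cmap c a) r" "x = cinv c u" "y = cinv c v"
        using xy by blast
      show ?thesis unfolding R_def
        by (intro exI[of _ "\<lambda>t. cinv c (u + (t\<^sup>2 * (3 - 2 * t)) *\<^sub>R (v - u))"] conjI
          flat_curve_segment[OF c(1,2) uv(1,2)]) (simp_all add: pathstart_def pathfinish_def uv)
    qed
    then show ?thesis using chart_ball_open(1)[OF c(1,2)] c(3) by (intro exI[of _ ?W]) auto
  qed
  have "R p q \<and> R q p"
  proof (rule connected_equivalence_relation[OF connected_M, where R = "\<lambda>x y. R x y \<and> R y x"])
    show "\<exists>T. openin (top_of_set UNIV) T \<and> a \<in> T \<and> (\<forall>x\<in>T. R a x \<and> R x a)" for a by (rule loc)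
  qed (use R_trans in blast)+
  then show thesis unfolding R_def using that flat_curve_C1 by auto
qed

end

section \<open>Displacement and the group of volume preserving homeomorphisms\<close>

lemma openin_compact_open_subbasis:
  assumes "compact K" "open U"
  shows "openin compact_open_topology {h. h ` K \<subseteq> U}"
  unfolding compact_open_topology_def
  by (rule topology_generated_by_Basis) (use assms in blast)

lemma topspace_compact_open [simp]:
  "topspace (compact_open_topology :: ('a::topological_space \<Rightarrow> 'b::topological_space) topology) = UNIV"
proof -
  have "UNIV = {h :: 'a \<Rightarrow> 'b. h ` {} \<subseteq> UNIV}" by simp
  then have "UNIV \<in> {{h :: 'a \<Rightarrow> 'b. h ` K \<subseteq> U} | K U. compact K \<and> open U}"
    using compact_empty open_UNIV by blast
  then show ?thesis
    unfolding compact_open_topology_def topology_generated_by_topspace by blast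
qed

lemma connectedin_locally_constant:
  assumes C: "connectedin X C" and xy: "x \<in> C" "y \<in> C"
    and loc: "\<And>z. z \<in> C \<Longrightarrow> \<exists>N. openin X N \<and> z \<in> N \<and> (\<forall>w\<in>N \<inter> C. f w = f z)"
  shows "f x = f y"
proof -
  let ?Y = "subtopology X C"
  have top: "topspace ?Y = C" using connectedin_subset_topspace[OF C] by auto
  have conn: "connected_space ?Y" using C by (simp add: connectedin_def)
  have op: "openin ?Y {w \<in> C. P (f w)}" for P
  proof (subst openin_subopen, rule ballI)
    fix z assume z: "z \<in> {w \<in> C. P (f w)}"
    then obtain N where N: "openin X N" "z \<in> N" "\<forall>w\<in>N \<inter> C. f w = f z" using loc by blast
    have "openin ?Y (N \<inter> C)" using N(1) by (auto simp: openin_subtopology)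
    moreover have "N \<inter> C \<subseteq> {w \<in> C. P (f w)}" using N(3) z by auto
    ultimately show "\<exists>T. openin ?Y T \<and> z \<in> T \<and> T \<subseteq> {w \<in> C. P (f w)}" using N(2) z by blast
  qed
  have "openin ?Y {w \<in> C. f w = f y}" by (rule op)
  moreover have "closedin ?Y {w \<in> C. f w = f y}"
  proof -
    have "C - {w \<in> C. f w = f y} = {w \<in> C. f w \<noteq> f y}" by auto
    then show ?thesis unfolding closedin_def top using op[of "\<lambda>v. v \<noteq> f y"] by auto
  qed
  ultimately have "{w \<in> C. f w = f y} = {} \<or> {w \<in> C. f w = f y} = C"
    using conn[unfolded connected_space_clopen_in] top by blast
  then show ?thesis using xy by blast
qed

context atlas
begin

text \<open>Deforming \<open>h\<^sub>0\<close> to a nearby \<open>h\<close> changes the integral along \<open>h\<^sub>0 \<circ> \<gamma>\<close> only by a term that depends on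
  the end points of \<open>\<gamma>\<close>.\<close>

lemma primitive_along_deformation:
  fixes h0 :: "'m \<Rightarrow> 'm" and \<gamma> :: "real \<Rightarrow> 'm" and f :: "'m \<Rightarrow> 'm \<Rightarrow> real"
  assumes W: "\<And>p. open (W p)" "\<And>p. p \<in> W p" "\<And>p. primitive_on A (W p) \<alpha> (f p)"
    and h0: "continuous_on UNIV h0" and \<gamma>: "continuous_on {a..b} \<gamma>" and ab: "a \<le> b"
  defines "E \<equiv> \<lambda>h t. f (h0 (\<gamma> t)) (h (\<gamma> t)) - f (h0 (\<gamma> t)) (h0 (\<gamma> t))"
  shows "\<exists>N. openin compact_open_topology N \<and> h0 \<in> N \<and> (\<forall>h\<in>N. continuous_on UNIV h \<longrightarrow>
      (\<forall>F F0. primitive_along \<alpha> (h \<circ> \<gamma>) a b F \<longrightarrow> primitive_along \<alpha> (h0 \<circ> \<gamma>) a b F0 \<longrightarrow>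
        (F b - F a) - (F0 b - F0 a) = E h b - E h a))"
proof -
  define P where "P = (\<lambda>u v. \<exists>N. openin compact_open_topology N \<and> h0 \<in> N \<and> (\<forall>h\<in>N. continuous_on UNIV h \<longrightarrow>
      (\<forall>F F0. primitive_along \<alpha> (h \<circ> \<gamma>) u v F \<longrightarrow> primitive_along \<alpha> (h0 \<circ> \<gamma>) u v F0 \<longrightarrow>
        (F v - F u) - (F0 v - F0 u) = E h v - E h u)))"
  have comp_cont: "continuous_on {u..v} (h \<circ> \<gamma>)"
    if "continuous_on UNIV h" "a \<le> u" "v \<le> b" for h :: "'m \<Rightarrow> 'm" and u v
    by (rule continuous_on_compose[OF continuous_on_subset[OF \<gamma>] continuous_on_subset[OF that(1)]])
      (use that in auto)
  \<comment> \<open>Bisection again: on adjacent intervals the end point terms \<open>E\<close>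
    telescope, and the two neighbourhoods are intersected.\<close>
  have "a \<le> a \<longrightarrow> b \<le> b \<longrightarrow> P a b"
    using ab
  proof (induction rule: Bolzano[where P = "\<lambda>u v. a \<le> u \<longrightarrow> v \<le> b \<longrightarrow> P u v"])
    case (trans u v w)
    have "P u w" if uw: "a \<le> u" "w \<le> b"
    proof -
      have "v \<le> b" "a \<le> v" using trans(3,4) uw by auto
      with trans(1,2) uw have "P u v" "P v w" by auto
      obtain N where N: "openin compact_open_topology N" "h0 \<in> N"
        "\<And>h F F0. h \<in> N \<Longrightarrow> continuous_on UNIV h \<Longrightarrow> primitive_along \<alpha> (h \<circ> \<gamma>) u v F \<Longrightarrow>
          primitive_along \<alpha> (h0 \<circ> \<gamma>) u v F0 \<Longrightarrow> (F v - F u) - (F0 v - F0 u) = E h v - E h u"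
        using \<open>P u v\<close> unfolding P_def by auto
      obtain N' where N': "openin compact_open_topology N'" "h0 \<in> N'"
        "\<And>h F F0. h \<in> N' \<Longrightarrow> continuous_on UNIV h \<Longrightarrow> primitive_along \<alpha> (h \<circ> \<gamma>) v w F \<Longrightarrow>
          primitive_along \<alpha> (h0 \<circ> \<gamma>) v w F0 \<Longrightarrow> (F w - F v) - (F0 w - F0 v) = E h w - E h v"
        using \<open>P v w\<close> unfolding P_def by auto
      show ?thesis unfolding P_def
      proof (intro exI[of _ "N \<inter> N'"] conjI ballI impI allI)
        fix h F F0
        assume h: "h \<in> N \<inter> N'" "continuous_on UNIV h"
          and F: "primitive_along \<alpha> (h \<circ> \<gamma>) u w F" and F0: "primitive_along \<alpha> (h0 \<circ> \<gamma>) u w F0"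
        have "(F v - F u) - (F0 v - F0 u) = E h v - E h u"
          by (rule N(3)) (use h trans(3,4) primitive_along_subinterval[OF F] primitive_along_subinterval[OF F0] in auto)
        moreover have "(F w - F v) - (F0 w - F0 v) = E h w - E h v"
          by (rule N'(3)) (use h trans(3,4) primitive_along_subinterval[OF F] primitive_along_subinterval[OF F0] in auto)
        ultimately show "(F w - F u) - (F0 w - F0 u) = E h w - E h u" by simp
      qed (use N N' in auto)
    qed
    then show ?case by blast
  next
    case (local x)
    define q where "q = h0 (\<gamma> x)"
    have "x \<in> {a..b}" using local by simp
    then obtain d where d: "d > 0" "\<forall>s\<in>{a..b}. \<bar>s - x\<bar> < d \<longrightarrow> (h0 \<circ> \<gamma>) s \<in> W q"
      using continuous_on_near[OF comp_cont[OF h0 order_refl order_refl], of x "W q"] W(1,2) by (auto simp: q_def)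
    have "P u v" if uv: "u \<le> x \<and> x \<le> v \<and> v - u < d" "a \<le> u" "v \<le> b" for u v
    proof -
      have K: "compact (\<gamma> ` {u..v})"
        by (rule compact_continuous_image[OF continuous_on_subset[OF \<gamma>]]) (use uv in auto)
      have h0K: "h0 (\<gamma> s) \<in> W q" if "s \<in> {u..v}" for s using d(2) that uv by auto
      \<comment> \<open>On a short interval one primitive \<open>f q\<close> serves all times,
        whereas \<open>E\<close> uses the primitive chosen at the image of the time itself. The two
        differ by a constant near that image.\<close>
      have nE: "\<exists>N. openin compact_open_topology N \<and> h0 \<in> N \<and>
          (\<forall>h\<in>N. f q (h (\<gamma> s)) - f q (h0 (\<gamma> s)) = E h s)" if s: "s \<in> {u..v}" for s
      proof -
        obtain V where V: "open V" "h0 (\<gamma> s) \<in> V"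
            "\<forall>y\<in>V. f q y - f (h0 (\<gamma> s)) y = f q (h0 (\<gamma> s)) - f (h0 (\<gamma> s)) (h0 (\<gamma> s))"
          using primitive_diff_locally_constant[OF W(1)[of q] h0K[OF s] W(3)[of q] W(1,2,3)[of "h0 (\<gamma> s)"]]
          by blast
        show ?thesis
        proof (intro exI[of _ "{h. h ` {\<gamma> s} \<subseteq> V}"] conjI ballI)
          show "openin compact_open_topology {h. h ` {\<gamma> s} \<subseteq> V}"
            by (rule openin_compact_open_subbasis) (use V in auto)
          fix h assume "h \<in> {h. h ` {\<gamma> s} \<subseteq> V}"
          then have "h (\<gamma> s) \<in> V" by simp
          then show "f q (h (\<gamma> s)) - f q (h0 (\<gamma> s)) = E h s" using V(3) unfolding E_def by force
        qed (use V in auto)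
      qed
      obtain Nu where Nu: "openin compact_open_topology Nu" "h0 \<in> Nu"
          "\<forall>h\<in>Nu. f q (h (\<gamma> u)) - f q (h0 (\<gamma> u)) = E h u" using nE[of u] uv by auto
      obtain Nv where Nv: "openin compact_open_topology Nv" "h0 \<in> Nv"
          "\<forall>h\<in>Nv. f q (h (\<gamma> v)) - f q (h0 (\<gamma> v)) = E h v" using nE[of v] uv by auto
      \<comment> \<open>The curve maps the interval to a compact set, so this is a subbasic open
        set. It keeps the whole deformed piece of curve in the domain of \<open>f q\<close>.\<close>
      define N1 where "N1 = {h :: 'm \<Rightarrow> 'm. h ` \<gamma> ` {u..v} \<subseteq> W q}"
      have N1: "openin compact_open_topology N1" "h0 \<in> N1"
        unfolding N1_def using openin_compact_open_subbasis[OF K W(1)] h0K by auto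
      show ?thesis unfolding P_def
      proof (intro exI[of _ "N1 \<inter> Nu \<inter> Nv"] conjI ballI impI allI)
        fix h F F0
        assume h: "h \<in> N1 \<inter> Nu \<inter> Nv" "continuous_on UNIV h"
          and F: "primitive_along \<alpha> (h \<circ> \<gamma>) u v F" and F0: "primitive_along \<alpha> (h0 \<circ> \<gamma>) u v F0"
        have "F v - F u = f q ((h \<circ> \<gamma>) v) - f q ((h \<circ> \<gamma>) u)"
          by (rule primitive_along_in[OF F comp_cont[OF h(2) uv(2,3)] W(1,3)])
            (use h(1) uv in \<open>auto simp: N1_def\<close>)
        moreover have "F0 v - F0 u = f q ((h0 \<circ> \<gamma>) v) - f q ((h0 \<circ> \<gamma>) u)"
          by (rule primitive_along_in[OF F0 comp_cont[OF h0 uv(2,3)] W(1,3)])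
            (use h0K uv in auto)
        moreover have "f q (h (\<gamma> u)) - f q (h0 (\<gamma> u)) = E h u" "f q (h (\<gamma> v)) - f q (h0 (\<gamma> v)) = E h v"
          using h(1) Nu(3) Nv(3) by auto
        ultimately show "(F v - F u) - (F0 v - F0 u) = E h v - E h u" by simp
      qed (use N1 Nu Nv in auto)
    qed
    then show ?case using d(1) by blast
  qed
  then show ?thesis unfolding P_def by simp
qed

text \<open>The correction terms of \<open>primitive_along_deformation\<close> involve only the
  common end points, so they cancel in the difference of the two curves.\<close>

lemma path_integral_difference_locally_constant:
  fixes h0 :: "'m \<Rightarrow> 'm"
  assumes \<alpha>: "closed_form A \<alpha>" and h0: "continuous_on UNIV h0" and \<gamma>: "path \<gamma>" "path \<delta>"
    and ends: "pathstart \<gamma> = pathstart \<delta>" "pathfinish \<gamma> = pathfinish \<delta>"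
  shows "\<exists>N. openin compact_open_topology N \<and> h0 \<in> N \<and> (\<forall>h\<in>N. continuous_on UNIV h \<longrightarrow>
      path_integral A \<alpha> (h \<circ> \<gamma>) - path_integral A \<alpha> (h \<circ> \<delta>)
      = path_integral A \<alpha> (h0 \<circ> \<gamma>) - path_integral A \<alpha> (h0 \<circ> \<delta>))"
proof -
  have "\<forall>p. \<exists>Wf. open (fst Wf) \<and> p \<in> fst Wf \<and> primitive_on A (fst Wf) \<alpha> (snd Wf)"
  proof
    fix p
    obtain V f where "open V" "p \<in> V" "primitive_on A V \<alpha> f" by (rule closed_form_local_primitive[OF \<alpha>])
    then show "\<exists>Wf. open (fst Wf) \<and> p \<in> fst Wf \<and> primitive_on A (fst Wf) \<alpha> (snd Wf)"
      by (intro exI[of _ "(V, f)"]) simp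
  qed
  from choice[OF this] obtain Wf where Wf: "\<forall>p. open (fst (Wf p)) \<and> p \<in> fst (Wf p) \<and> primitive_on A (fst (Wf p)) \<alpha> (snd (Wf p))"
    by blast
  define f where "f = snd \<circ> Wf"
  have W: "open (fst (Wf p))" "p \<in> fst (Wf p)" "primitive_on A (fst (Wf p)) \<alpha> (f p)" for p
    using Wf by (auto simp: f_def)
  have key: "\<exists>N. openin compact_open_topology N \<and> h0 \<in> N \<and> (\<forall>h\<in>N. continuous_on UNIV h \<longrightarrow>
      path_integral A \<alpha> (h \<circ> \<gamma>) - path_integral A \<alpha> (h0 \<circ> \<gamma>)
      = (f (h0 (pathfinish \<gamma>)) (h (pathfinish \<gamma>)) - f (h0 (pathfinish \<gamma>)) (h0 (pathfinish \<gamma>)))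
      - (f (h0 (pathstart \<gamma>)) (h (pathstart \<gamma>)) - f (h0 (pathstart \<gamma>)) (h0 (pathstart \<gamma>))))"
    if \<gamma>: "path \<gamma>" for \<gamma>
  proof -
    obtain N where N: "openin compact_open_topology N" "h0 \<in> N"
        "\<And>h F F0. h \<in> N \<Longrightarrow> continuous_on UNIV h \<Longrightarrow> primitive_along \<alpha> (h \<circ> \<gamma>) 0 1 F \<Longrightarrow>
          primitive_along \<alpha> (h0 \<circ> \<gamma>) 0 1 F0 \<Longrightarrow> (F 1 - F 0) - (F0 1 - F0 0)
          = (f (h0 (\<gamma> 1)) (h (\<gamma> 1)) - f (h0 (\<gamma> 1)) (h0 (\<gamma> 1)))
          - (f (h0 (\<gamma> 0)) (h (\<gamma> 0)) - f (h0 (\<gamma> 0)) (h0 (\<gamma> 0)))"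
      using primitive_along_deformation[OF W h0 \<gamma>[unfolded path_def] zero_le_one] by auto
    have pc: "path (h \<circ> \<gamma>)" if "continuous_on UNIV h" for h :: "'m \<Rightarrow> 'm"
      using path_continuous_image[OF \<gamma>] continuous_on_subset[OF that] by blast
    show ?thesis
    proof (intro exI[of _ N] conjI N(1,2) ballI impI)
      fix h assume h: "h \<in> N" "continuous_on UNIV h"
      obtain F where F: "primitive_along \<alpha> (h \<circ> \<gamma>) 0 1 F"
        using primitive_along_exists[OF \<alpha> pc[OF h(2), unfolded path_def] zero_le_one] by blast
      obtain F0 where F0: "primitive_along \<alpha> (h0 \<circ> \<gamma>) 0 1 F0"
        using primitive_along_exists[OF \<alpha> pc[OF h0, unfolded path_def] zero_le_one] by blast
      show "path_integral A \<alpha> (h \<circ> \<gamma>) - path_integral A \<alpha> (h0 \<circ> \<gamma>)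
      = (f (h0 (pathfinish \<gamma>)) (h (pathfinish \<gamma>)) - f (h0 (pathfinish \<gamma>)) (h0 (pathfinish \<gamma>)))
      - (f (h0 (pathstart \<gamma>)) (h (pathstart \<gamma>)) - f (h0 (pathstart \<gamma>)) (h0 (pathstart \<gamma>)))"
        using N(3)[OF h F F0] path_integral_eq[OF \<alpha> pc[OF h(2)] F] path_integral_eq[OF \<alpha> pc[OF h0] F0]
        by (simp add: pathstart_def pathfinish_def)
    qed
  qed
  obtain N where N: "openin compact_open_topology N" "h0 \<in> N" "\<And>h. h \<in> N \<Longrightarrow> continuous_on UNIV h \<Longrightarrow>
      path_integral A \<alpha> (h \<circ> \<gamma>) - path_integral A \<alpha> (h0 \<circ> \<gamma>)
      = (f (h0 (pathfinish \<gamma>)) (h (pathfinish \<gamma>)) - f (h0 (pathfinish \<gamma>)) (h0 (pathfinish \<gamma>)))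
      - (f (h0 (pathstart \<gamma>)) (h (pathstart \<gamma>)) - f (h0 (pathstart \<gamma>)) (h0 (pathstart \<gamma>)))"
    using key[OF \<gamma>(1)] by auto
  obtain M where M: "openin compact_open_topology M" "h0 \<in> M" "\<And>h. h \<in> M \<Longrightarrow> continuous_on UNIV h \<Longrightarrow>
      path_integral A \<alpha> (h \<circ> \<delta>) - path_integral A \<alpha> (h0 \<circ> \<delta>)
      = (f (h0 (pathfinish \<delta>)) (h (pathfinish \<delta>)) - f (h0 (pathfinish \<delta>)) (h0 (pathfinish \<delta>)))
      - (f (h0 (pathstart \<delta>)) (h (pathstart \<delta>)) - f (h0 (pathstart \<delta>)) (h0 (pathstart \<delta>)))"
    using key[OF \<gamma>(2)] by auto
  show ?thesis
  proof (intro exI[of _ "N \<inter> M"] conjI ballI impI)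
    fix h assume "h \<in> N \<inter> M" "continuous_on UNIV h"
    then show "path_integral A \<alpha> (h \<circ> \<gamma>) - path_integral A \<alpha> (h \<circ> \<delta>)
      = path_integral A \<alpha> (h0 \<circ> \<gamma>) - path_integral A \<alpha> (h0 \<circ> \<delta>)"
      using N(3)[of h] M(3)[of h] ends by simp
  qed (use N M in auto)
qed

lemma volume_form_compatible: "volume_form A \<Omega> \<Longrightarrow> compatible_density \<Omega>"
  unfolding volume_form_def compatible_density_def
  using smooth_on_continuous by (metis less_imp_le)

end

locale volume_manifold = closed_manifold A for A :: "('m::{second_countable_topology, t2_space}, 'n::finite) chart set" +
  fixes \<Omega> :: "('m, 'n) chart \<Rightarrow> real ^ 'n \<Rightarrow> real"
  assumes volume_form: "volume_form A \<Omega>" and total_volume: "emeasure (density_measure A \<Omega>) UNIV = 1"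
begin

definition \<mu> :: "'m measure" where "\<mu> = density_measure A \<Omega>"

abbreviation G :: "('m \<Rightarrow> 'm) set" where "G \<equiv> Homeo0 A \<Omega>"

lemmas compatible_volume = volume_form_compatible[OF volume_form]

lemma sets_\<mu> [simp]: "sets \<mu> = sets borel"
  unfolding \<mu>_def by (rule density_measure(1)[OF compatible_volume])

lemma space_\<mu> [simp]: "space \<mu> = UNIV"
  using sets_eq_imp_space_eq[OF sets_\<mu>] by simp

sublocale finite_measure_\<mu>: finite_measure \<mu>
  by (rule finite_measureI) (simp add: \<mu>_def[symmetric] total_volume[folded \<mu>_def])

lemma measure_\<mu>_UNIV: "measure \<mu> UNIV = 1"
  using total_volume by (simp add: \<mu>_def measure_def)

lemma continuous_measurable: "continuous_on UNIV h \<Longrightarrow> h \<in> measurable \<mu> \<mu>"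
  using borel_measurable_continuous_onI by (simp add: measurable_cong_sets[OF sets_\<mu> sets_\<mu>])

lemma continuous_measurable_real: "continuous_on UNIV (f :: 'm \<Rightarrow> real) \<Longrightarrow> f \<in> borel_measurable \<mu>"
  using borel_measurable_continuous_onI by (simp add: measurable_cong_sets[OF sets_\<mu> refl])

lemma continuous_integrable:
  fixes f :: "'m \<Rightarrow> real"
  assumes "continuous_on UNIV f"
  shows "integrable \<mu> f"
proof -
  have "bounded (range f)"
    by (rule compact_imp_bounded[OF compact_continuous_image[OF assms compact_M]])
  then obtain b where "\<forall>p. norm (f p) \<le> b" unfolding bounded_iff by auto
  then show ?thesis
    by (intro finite_measure_\<mu>.integrable_const_bound[of f b] continuous_measurable_real[OF assms]) auto
qed

section \<open>The identity component as a set closed under composition\<close>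

lemma Homeo_vol_continuous: "h \<in> Homeo_vol A \<Omega> \<Longrightarrow> continuous_on UNIV h"
  by (auto simp: Homeo_vol_def homeomorphism_def)

lemma Homeo_vol_distr: "h \<in> Homeo_vol A \<Omega> \<Longrightarrow> distr \<mu> \<mu> h = \<mu>"
  by (simp add: Homeo_vol_def \<mu>_def)

lemma Homeo_vol_comp:
  assumes "h \<in> Homeo_vol A \<Omega>" "k \<in> Homeo_vol A \<Omega>"
  shows "h \<circ> k \<in> Homeo_vol A \<Omega>"
proof -
  have "distr \<mu> \<mu> (h \<circ> k) = distr (distr \<mu> \<mu> k) \<mu> h"
    using assms by (intro distr_distr[symmetric] continuous_measurable Homeo_vol_continuous)
  also have "\<dots> = \<mu>" using assms by (simp add: Homeo_vol_distr)
  finally have "distr \<mu> \<mu> (h \<circ> k) = \<mu>" .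
  moreover obtain h' k' where "homeomorphism UNIV UNIV h h'" "homeomorphism UNIV UNIV k k'"
    using assms unfolding Homeo_vol_def by blast
  then have "\<exists>g. homeomorphism UNIV UNIV (h \<circ> k) g" using homeomorphism_compose by blast
  ultimately show ?thesis by (simp add: Homeo_vol_def \<mu>_def)
qed

lemma id_Homeo_vol: "id \<in> Homeo_vol A \<Omega>"
proof -
  have "distr \<mu> \<mu> id = \<mu>" by (simp add: id_def)
  then show ?thesis unfolding Homeo_vol_def \<mu>_def using homeomorphism_ident[of UNIV] by (auto simp: id_def)
qed

abbreviation "HV \<equiv> subtopology compact_open_topology (Homeo_vol A \<Omega>)"

lemma id_G: "id \<in> G"
  unfolding Homeo0_def using id_Homeo_vol by (simp add: connected_component_of_refl)

lemma G_subset: "G \<subseteq> Homeo_vol A \<Omega>"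
  unfolding Homeo0_def using connected_component_in_topspace[of HV id] by auto

lemma G_continuous: "h \<in> G \<Longrightarrow> continuous_on UNIV h"
  using G_subset Homeo_vol_continuous by blast

lemma connectedin_G: "connectedin HV G"
  unfolding Homeo0_def by (rule connectedin_connected_component_of)

text \<open>A connected set that meets the component can be added to it. Every membership in
  \<open>G\<close> other than that of \<open>id\<close> is obtained this way, for composites and for
  local twists.\<close>

lemma connectedin_subset_G: "connectedin HV T \<Longrightarrow> T \<inter> G \<noteq> {} \<Longrightarrow> T \<subseteq> G"
proof
  fix h assume T: "connectedin HV T" "T \<inter> G \<noteq> {}" "h \<in> T"
  then have "connectedin HV (T \<union> G)" using connectedin_G connectedin_Un by blast
  then have "connected_component_of HV id h"
    unfolding connected_component_of_def using T(3) id_G by (intro exI[of _ "T \<union> G"] conjI) simp_all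
  then show "h \<in> G" by (simp add: Homeo0_def)
qed

text \<open>Left composition with \<open>h\<close> is continuous for the compact-open topology. It
  carries the connected set \<open>G\<close> to a connected set that contains \<open>h\<close>,
  which therefore stays in \<open>G\<close>.\<close>

lemma G_comp:
  assumes h: "h \<in> G" and k: "k \<in> G"
  shows "h \<circ> k \<in> G"
proof -
  have hv: "h \<in> Homeo_vol A \<Omega>" using h G_subset by blast
  have cm: "continuous_map HV compact_open_topology (\<lambda>k. h \<circ> k)"
    unfolding compact_open_topology_def
  proof (rule continuous_on_generated_topo)
    fix U :: "('m \<Rightarrow> 'm) set" assume "U \<in> {{h. h ` K \<subseteq> U} |K U. compact K \<and> open U}"
    then obtain K V where KV: "U = {h. h ` K \<subseteq> V}" "compact K" "open V" by blast
    have "open (h -` V)" by (rule open_vimage[OF KV(3) Homeo_vol_continuous[OF hv]])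
    from openin_compact_open_subbasis[OF KV(2) this]
    have "openin HV ({k. k ` K \<subseteq> h -` V} \<inter> Homeo_vol A \<Omega>)" by (auto simp: openin_subtopology)
    moreover have "(\<lambda>k. h \<circ> k) -` U \<inter> topspace HV = {k. k ` K \<subseteq> h -` V} \<inter> Homeo_vol A \<Omega>"
      unfolding KV(1) by auto
    ultimately show "openin (subtopology (topology_generated_by {{h. h ` K \<subseteq> U} |K U. compact K \<and> open U}) (Homeo_vol A \<Omega>))
        ((\<lambda>k. h \<circ> k) -` U \<inter> topspace (subtopology (topology_generated_by {{h. h ` K \<subseteq> U} |K U. compact K \<and> open U}) (Homeo_vol A \<Omega>)))"
      unfolding compact_open_topology_def by simp
  next
    show "(\<lambda>k. h \<circ> k) ` topspace (subtopology (topology_generated_by {{h. h ` K \<subseteq> U} |K U. compact K \<and> open U}) (Homeo_vol A \<Omega>))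
        \<subseteq> \<Union> {{h. h ` K \<subseteq> U} |K U. compact K \<and> open U}"
      using topspace_compact_open[where 'a = 'm and 'b = 'm] unfolding compact_open_topology_def by auto
  qed
  have "continuous_map HV HV (\<lambda>k. h \<circ> k)"
    unfolding continuous_map_in_subtopology
    by (intro conjI cm funcsetI Homeo_vol_comp[OF hv]) simp
  then have "connectedin HV ((\<lambda>k. h \<circ> k) ` G)"
    by (rule connectedin_continuous_map_image[OF _ connectedin_G])
  moreover have "h \<circ> id \<in> (\<lambda>k. h \<circ> k) ` G" using id_G by (rule imageI)
  then have "(\<lambda>k. h \<circ> k) ` G \<inter> G \<noteq> {}" using h by auto
  ultimately show ?thesis using connectedin_subset_G k by blast
qed

text \<open>\<open>G\<close> is a connected component, so no path of homeomorphisms from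
  \<open>id\<close> to \<open>h\<close> is at hand. Constancy of a locally constant function on a
  connected set replaces deformation along an isotopy.\<close>

lemma homotopy_invariance:
  assumes \<alpha>: "closed_form A \<alpha>" and h: "h \<in> G" and \<gamma>: "path \<gamma>" "path \<delta>"
    and ends: "pathstart \<gamma> = pathstart \<delta>" "pathfinish \<gamma> = pathfinish \<delta>"
  shows "path_integral A \<alpha> (h \<circ> \<gamma>) - path_integral A \<alpha> \<gamma> = path_integral A \<alpha> (h \<circ> \<delta>) - path_integral A \<alpha> \<delta>"
proof -
  let ?d = "\<lambda>h. path_integral A \<alpha> (h \<circ> \<gamma>) - path_integral A \<alpha> (h \<circ> \<delta>)"
  have "?d h = ?d id"
  proof (rule connectedin_locally_constant[OF connectedin_G h id_G])
    fix k assume k: "k \<in> G"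
    obtain N where N: "openin compact_open_topology N" "k \<in> N" "\<forall>h\<in>N. continuous_on UNIV h \<longrightarrow> ?d h = ?d k"
      using path_integral_difference_locally_constant[OF \<alpha> G_continuous[OF k] \<gamma> ends] by blast
    have "openin HV (N \<inter> Homeo_vol A \<Omega>)" using N(1) by (auto simp: openin_subtopology)
    moreover have "k \<in> N \<inter> Homeo_vol A \<Omega>" using N(2) k G_subset by blast
    moreover have "\<forall>w\<in>N \<inter> Homeo_vol A \<Omega> \<inter> G. ?d w = ?d k" using N(3) G_continuous by blast
    ultimately show "\<exists>N. openin HV N \<and> k \<in> N \<and> (\<forall>w\<in>N \<inter> G. ?d w = ?d k)"
      by (intro exI[of _ "N \<inter> Homeo_vol A \<Omega>"] conjI)
  qed
  then show ?thesis by simp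
qed

lemma path_comp: "continuous_on UNIV h \<Longrightarrow> path \<gamma> \<Longrightarrow> path (h \<circ> \<gamma>)" for h :: "'m \<Rightarrow> 'm"
  using path_continuous_image continuous_on_subset by blast

lemma displacement_eq:
  assumes \<alpha>: "closed_form A \<alpha>" and h: "h \<in> G" and \<gamma>: "path \<gamma>"
  shows "displacement A \<alpha> h (pathstart \<gamma>) (pathfinish \<gamma>) = path_integral A \<alpha> (h \<circ> \<gamma>) - path_integral A \<alpha> \<gamma>"
  unfolding displacement_def
proof (rule the_equality)
  have val: "path_integral A \<alpha> (h \<circ> \<delta>) - line_integral A \<alpha> \<delta> = path_integral A \<alpha> (h \<circ> \<gamma>) - path_integral A \<alpha> \<gamma>"
    if "C1_curve A \<delta>" "pathstart \<delta> = pathstart \<gamma>" "pathfinish \<delta> = pathfinish \<gamma>" for \<delta>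
    using homotopy_invariance[OF \<alpha> h _ \<gamma> that(2,3)] line_integral_eq_path_integral[OF \<alpha> that(1)] that(1)
    by (simp add: C1_curve_def)
  obtain \<delta> where "C1_curve A \<delta>" "pathstart \<delta> = pathstart \<gamma>" "pathfinish \<delta> = pathfinish \<gamma>"
    by (rule C1_curve_exists)
  with val show "\<exists>\<delta>. C1_curve A \<delta> \<and> pathstart \<delta> = pathstart \<gamma> \<and> pathfinish \<delta> = pathfinish \<gamma> \<and>
     path_integral A \<alpha> (h \<circ> \<gamma>) - path_integral A \<alpha> \<gamma> = path_integral A \<alpha> (h \<circ> \<delta>) - line_integral A \<alpha> \<delta>"
    by metis
  fix r
  assume "\<exists>\<delta>. C1_curve A \<delta> \<and> pathstart \<delta> = pathstart \<gamma> \<and> pathfinish \<delta> = pathfinish \<gamma> \<and>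
     r = path_integral A \<alpha> (h \<circ> \<delta>) - line_integral A \<alpha> \<delta>"
  then show "r = path_integral A \<alpha> (h \<circ> \<gamma>) - path_integral A \<alpha> \<gamma>" using val by blast
qed

lemma path_exists:
  obtains \<gamma> :: "real \<Rightarrow> 'm" where "path \<gamma>" "pathstart \<gamma> = p" "pathfinish \<gamma> = q"
proof -
  obtain \<gamma> where "C1_curve A \<gamma>" "pathstart \<gamma> = p" "pathfinish \<gamma> = q" by (rule C1_curve_exists)
  then show thesis by (intro that[of \<gamma>]) (simp_all add: C1_curve_def)
qed

lemma displacement_add:
  assumes \<alpha>: "closed_form A \<alpha>" and h: "h \<in> G"
  shows "displacement A \<alpha> h x z = displacement A \<alpha> h x y + displacement A \<alpha> h y z"
proof -
  obtain \<gamma> where \<gamma>: "path \<gamma>" "pathstart \<gamma> = x" "pathfinish \<gamma> = y" by (rule path_exists)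
  obtain \<delta> where \<delta>: "path \<delta>" "pathstart \<delta> = y" "pathfinish \<delta> = z" by (rule path_exists)
  note hc = G_continuous[OF h]
  have p: "path (\<gamma> +++ \<delta>)" using \<gamma> \<delta> by simp
  have "displacement A \<alpha> h x z = path_integral A \<alpha> (h \<circ> (\<gamma> +++ \<delta>)) - path_integral A \<alpha> (\<gamma> +++ \<delta>)"
    using displacement_eq[OF \<alpha> h p] \<gamma> \<delta> by simp
  also have "path_integral A \<alpha> (h \<circ> (\<gamma> +++ \<delta>)) = path_integral A \<alpha> (h \<circ> \<gamma>) + path_integral A \<alpha> (h \<circ> \<delta>)"
    unfolding path_compose_join
    by (rule path_integral_join[OF \<alpha>]) (use \<gamma> \<delta> in \<open>auto intro: path_comp[OF hc] simp: pathfinish_compose pathstart_compose\<close>)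
  also have "path_integral A \<alpha> (\<gamma> +++ \<delta>) = path_integral A \<alpha> \<gamma> + path_integral A \<alpha> \<delta>"
    by (rule path_integral_join[OF \<alpha>]) (use \<gamma> \<delta> in auto)
  finally show ?thesis
    using displacement_eq[OF \<alpha> h \<gamma>(1), unfolded \<gamma>(2,3)] displacement_eq[OF \<alpha> h \<delta>(1), unfolded \<delta>(2,3)]
    by linarith
qed

text \<open>The curve from \<open>k x\<close> to \<open>k y\<close> used for \<open>h\<close> is the
  image under \<open>k\<close> of the curve used for \<open>k\<close>, so its own integral
  cancels.\<close>

lemma displacement_comp:
  assumes \<alpha>: "closed_form A \<alpha>" and h: "h \<in> G" and k: "k \<in> G"
  shows "displacement A \<alpha> (h \<circ> k) x y = displacement A \<alpha> h (k x) (k y) + displacement A \<alpha> k x y"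
proof -
  obtain \<gamma> where \<gamma>: "path \<gamma>" "pathstart \<gamma> = x" "pathfinish \<gamma> = y" by (rule path_exists)
  have kp: "path (k \<circ> \<gamma>)" by (rule path_comp[OF G_continuous[OF k] \<gamma>(1)])
  show ?thesis
    using displacement_eq[OF \<alpha> G_comp[OF h k] \<gamma>(1)] displacement_eq[OF \<alpha> k \<gamma>(1)] displacement_eq[OF \<alpha> h kp] \<gamma>(2,3)
    by (simp add: pathfinish_compose pathstart_compose o_assoc)
qed

lemma displacement_local:
  assumes \<alpha>: "closed_form A \<alpha>" and h: "h \<in> G" and \<gamma>: "path \<gamma>" "pathstart \<gamma> = x" "pathfinish \<gamma> = y"
    and V: "open V" "primitive_on A V \<alpha> f" "path_image \<gamma> \<subseteq> V"
    and V': "open V'" "primitive_on A V' \<alpha> f'" "h ` path_image \<gamma> \<subseteq> V'"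
  shows "displacement A \<alpha> h x y = (f' (h y) - f' (h x)) - (f y - f x)"
  using displacement_eq[OF \<alpha> h \<gamma>(1)] path_integral_primitive[OF \<alpha> \<gamma>(1) V]
    path_integral_primitive[OF \<alpha> path_comp[OF G_continuous[OF h] \<gamma>(1)] V'(1,2)] V'(3) \<gamma>(2,3)
  by (simp add: path_image_compose pathfinish_compose pathstart_compose)

text \<open>Near \<open>y\<close>, additivity reduces the increment to a curve inside a small chart
  ball, where local primitives of \<alpha> at \<open>y\<close> and at \<open>h y\<close> express
  it.\<close>

lemma displacement_continuous:
  assumes \<alpha>: "closed_form A \<alpha>" and h: "h \<in> G"
  shows "continuous_on UNIV (displacement A \<alpha> h x)"
proof (rule continuous_at_imp_continuous_on, rule ballI)
  fix y
  obtain V f where V: "open V" "y \<in> V" "primitive_on A V \<alpha> f"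
    by (rule closed_form_local_primitive[OF \<alpha>])
  obtain V' f' where V': "open V'" "h y \<in> V'" "primitive_on A V' \<alpha> f'"
    by (rule closed_form_local_primitive[OF \<alpha>])
  note hc = G_continuous[OF h]
  have "open (V \<inter> h -` V')" "y \<in> V \<inter> h -` V'"
    using V V' open_vimage[OF V'(1) hc] by auto
  then obtain c r where c: "c \<in> A" "ball (cmap c y) r \<subseteq> cimg c"
      "cinv c ` ball (cmap c y) r \<subseteq> V \<inter> h -` V'" "y \<in> cinv c ` ball (cmap c y) r"
    by (rule chart_ball_neighbourhood)
  define B where "B = cinv c ` ball (cmap c y) r"
  have B: "open B" "y \<in> B" "B \<subseteq> V" "h ` B \<subseteq> V'"
    using c(3,4) chart_ball_open(1)[OF c(1,2)] by (auto simp: B_def)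
  have eq: "displacement A \<alpha> h x z = displacement A \<alpha> h x y + ((f' (h z) - f' (h y)) - (f z - f y))" if z: "z \<in> B" for z
  proof -
    obtain \<gamma> where \<gamma>: "path \<gamma>" "pathstart \<gamma> = y" "pathfinish \<gamma> = z" "path_image \<gamma> \<subseteq> B"
      unfolding B_def by (rule chart_ball_path[OF c(1,2,4) z[unfolded B_def]])
    have "path_image \<gamma> \<subseteq> V" "h ` path_image \<gamma> \<subseteq> V'" using \<gamma>(4) B(3,4) by blast+
    then have "displacement A \<alpha> h y z = (f' (h z) - f' (h y)) - (f z - f y)"
      by (intro displacement_local[OF \<alpha> h \<gamma>(1-3) V(1,3) _ V'(1,3)])
    then show ?thesis using displacement_add[OF \<alpha> h, of x z y] by simp
  qed
  have "continuous_on B f" using primitive_on_continuous[OF V(3,1)] B(3) continuous_on_subset by blast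
  moreover have "continuous_on B (\<lambda>z. f' (h z))"
    by (rule continuous_on_compose2[OF primitive_on_continuous[OF V'(3,1)] continuous_on_subset[OF hc]]) (use B(4) in auto)
  ultimately have "continuous_on B (\<lambda>z. displacement A \<alpha> h x y + ((f' (h z) - f' (h y)) - (f z - f y)))"
    by (intro continuous_intros)
  then have "continuous_on B (displacement A \<alpha> h x)"
    by (rule continuous_on_eq) (simp add: eq)
  then show "isCont (displacement A \<alpha> h x) y"
    using B(1,2) by (simp add: continuous_on_eq_continuous_at)
qed

end

section \<open>Cocycles of closed forms\<close>

text \<open>The kernel condition stays inside the conclusion: the homomorphism is wanted in every
  dimension, while the condition is established only from dimension 2 on.\<close>

lemma induced_hom_Mod:
  assumes K: "comm_group K" and L: "comm_group L" and N: "subgroup N K" and M: "subgroup M L"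
    and T: "T \<in> hom K L" and TN: "T ` N \<subseteq> M"
  shows "\<exists>\<iota>\<in>hom (K Mod N) (L Mod M). (\<forall>a\<in>carrier K. \<iota> (N #>\<^bsub>K\<^esub> a) = M #>\<^bsub>L\<^esub> T a) \<and>
    ((\<forall>a\<in>carrier K. T a \<in> M \<longrightarrow> a \<in> N) \<longrightarrow> inj_on \<iota> (carrier (K Mod N)))"
proof -
  interpret K: comm_group K by (rule K)
  interpret L: comm_group L by (rule L)
  interpret T: group_hom K L T by unfold_locales (rule T)
  interpret N: normal N K by (rule K.subgroup_imp_normal[OF N])
  interpret M: normal M L by (rule L.subgroup_imp_normal[OF M])
  define \<iota> where "\<iota> = (\<lambda>X. M #>\<^bsub>L\<^esub> T (SOME a. a \<in> X))"
  have \<iota>: "\<iota> (N #>\<^bsub>K\<^esub> a) = M #>\<^bsub>L\<^esub> T a" if a: "a \<in> carrier K" for a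
  proof -
    define b where "b = (SOME b. b \<in> N #>\<^bsub>K\<^esub> a)"
    have "b \<in> N #>\<^bsub>K\<^esub> a" unfolding b_def by (rule someI[of _ a]) (rule K.rcos_self[OF a N])
    then obtain n where n: "n \<in> N" "b = n \<otimes>\<^bsub>K\<^esub> a" by (auto simp: r_coset_def)
    then have "T b = T n \<otimes>\<^bsub>L\<^esub> T a" using a by simp
    moreover have "T n \<in> M" using TN n(1) by blast
    ultimately have "T b \<in> M #>\<^bsub>L\<^esub> T a" by (auto simp: r_coset_def)
    then have "M #>\<^bsub>L\<^esub> T a = M #>\<^bsub>L\<^esub> T b" using a by (intro L.repr_independence M) auto
    then show ?thesis by (simp add: \<iota>_def b_def)
  qed
  have rep: "\<exists>a\<in>carrier K. X = N #>\<^bsub>K\<^esub> a" if "X \<in> carrier (K Mod N)" for X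
    using that by (auto simp: carrier_FactGroup)
  have "\<iota> \<in> hom (K Mod N) (L Mod M)"
  proof (rule homI)
    fix X assume "X \<in> carrier (K Mod N)"
    then obtain a where a: "a \<in> carrier K" "X = N #>\<^bsub>K\<^esub> a" using rep by blast
    then show "\<iota> X \<in> carrier (L Mod M)" by (simp add: \<iota> carrier_FactGroup)
  next
    fix X Y assume "X \<in> carrier (K Mod N)" "Y \<in> carrier (K Mod N)"
    then obtain a b where ab: "a \<in> carrier K" "X = N #>\<^bsub>K\<^esub> a" "b \<in> carrier K" "Y = N #>\<^bsub>K\<^esub> b" using rep by metis
    then show "\<iota> (X \<otimes>\<^bsub>K Mod N\<^esub> Y) = \<iota> X \<otimes>\<^bsub>L Mod M\<^esub> \<iota> Y"
      by (simp add: \<iota> N.rcos_sum M.rcos_sum)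
  qed
  moreover have "inj_on \<iota> (carrier (K Mod N))" if ker: "\<forall>a\<in>carrier K. T a \<in> M \<longrightarrow> a \<in> N"
  proof (rule inj_onI)
    fix X Y assume XY: "X \<in> carrier (K Mod N)" "Y \<in> carrier (K Mod N)" "\<iota> X = \<iota> Y"
    then obtain a b where ab: "a \<in> carrier K" "X = N #>\<^bsub>K\<^esub> a" "b \<in> carrier K" "Y = N #>\<^bsub>K\<^esub> b" using rep by metis
    have "T a \<in> M #>\<^bsub>L\<^esub> T b" using XY(3) ab \<iota> L.rcos_self[OF _ M, of "T a"] by simp
    then obtain m where m: "m \<in> M" "T a = m \<otimes>\<^bsub>L\<^esub> T b" by (auto simp: r_coset_def)
    have "T (a \<otimes>\<^bsub>K\<^esub> inv\<^bsub>K\<^esub> b) = T a \<otimes>\<^bsub>L\<^esub> inv\<^bsub>L\<^esub> T b" using ab by simp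
    also have "\<dots> = m" using m ab M.subset by (simp add: L.m_assoc subset_iff)
    finally have "a \<otimes>\<^bsub>K\<^esub> inv\<^bsub>K\<^esub> b \<in> N" using ker ab m(1) by simp
    then have "(a \<otimes>\<^bsub>K\<^esub> inv\<^bsub>K\<^esub> b) \<otimes>\<^bsub>K\<^esub> b \<in> N #>\<^bsub>K\<^esub> b" by (auto simp: r_coset_def)
    then have "a \<in> N #>\<^bsub>K\<^esub> b" using ab by (simp add: K.m_assoc)
    then show "X = Y" using ab K.repr_independence[OF _ _ N] by metis
  qed
  ultimately show ?thesis using \<iota> by blast
qed

context atlas
begin

section \<open>Closed forms as a group, exact forms as a subgroup\<close>

lemma closed_formD:
  assumes "closed_form A \<alpha>" "c \<in> A"
  shows "smooth_on (\<alpha> c) (cimg c)"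
  using assms unfolding closed_form_def one_form_def by blast

lemma exterior_derivative_add:
  assumes "(\<alpha> c) differentiable (at x)" "(\<beta> c) differentiable (at x)"
  shows "exterior_derivative (\<lambda>c x. \<alpha> c x + \<beta> c x) c x v w
    = exterior_derivative \<alpha> c x v w + exterior_derivative \<beta> c x v w"
proof -
  have "frechet_derivative (\<lambda>x. \<alpha> c x + \<beta> c x) (at x)
      = (\<lambda>v. frechet_derivative (\<alpha> c) (at x) v + frechet_derivative (\<beta> c) (at x) v)"
    using assms by (intro frechet_derivative_at[symmetric] has_derivative_add) (simp_all add: frechet_derivative_works[symmetric])
  then show ?thesis by (simp add: exterior_derivative_def blinfun.add_left)
qed

lemma exterior_derivative_minus:
  assumes "(\<alpha> c) differentiable (at x)"
  shows "exterior_derivative (\<lambda>c x. - \<alpha> c x) c x v w = - exterior_derivative \<alpha> c x v w"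
proof -
  have "frechet_derivative (\<lambda>x. - \<alpha> c x) (at x) = (\<lambda>v. - frechet_derivative (\<alpha> c) (at x) v)"
    using assms by (intro frechet_derivative_at[symmetric] has_derivative_minus) (simp_all add: frechet_derivative_works[symmetric])
  then show ?thesis by (simp add: exterior_derivative_def blinfun.minus_left)
qed

lemma one_form_add:
  assumes \<alpha>: "one_form A \<alpha>" and \<beta>: "one_form A \<beta>"
  shows "one_form A (\<lambda>c x. \<alpha> c x + \<beta> c x)"
  unfolding one_form_def
proof (intro conjI ballI allI impI)
  fix c assume "c \<in> A"
  then show "smooth_on (\<lambda>x. \<alpha> c x + \<beta> c x) (cimg c)"
    using \<alpha> \<beta> unfolding one_form_def by (intro smooth_on_add open_cimg) blast+
next
  fix c d p v assume *: "c \<in> A" "d \<in> A" "p \<in> cdom c \<inter> cdom d"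
  have "blinfun_apply (\<gamma> c (cmap c p)) v = blinfun_apply (\<gamma> d (cmap d p)) (dtransition c d (cmap c p) v)"
    if "one_form A \<gamma>" for \<gamma>
    using that * unfolding one_form_def by blast
  from this[OF \<alpha>] this[OF \<beta>]
  show "blinfun_apply (\<alpha> c (cmap c p) + \<beta> c (cmap c p)) v
      = blinfun_apply (\<alpha> d (cmap d p) + \<beta> d (cmap d p)) (dtransition c d (cmap c p) v)"
    by (simp only: blinfun.add_left)
next
  fix c x assume *: "c \<notin> A \<or> x \<notin> cimg c"
  have "\<gamma> c x = 0" if "one_form A \<gamma>" for \<gamma> using that * unfolding one_form_def by blast
  from this[OF \<alpha>] this[OF \<beta>] show "\<alpha> c x + \<beta> c x = 0" by simp
qed

lemma one_form_minus:
  assumes \<alpha>: "one_form A \<alpha>"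
  shows "one_form A (\<lambda>c x. - \<alpha> c x)"
  unfolding one_form_def
proof (intro conjI ballI allI impI)
  fix c assume "c \<in> A"
  then show "smooth_on (\<lambda>x. - \<alpha> c x) (cimg c)"
    using \<alpha> unfolding one_form_def by (intro smooth_on_minus open_cimg) blast+
next
  fix c d p v assume "c \<in> A" "d \<in> A" "p \<in> cdom c \<inter> cdom d"
  then have "blinfun_apply (\<alpha> c (cmap c p)) v = blinfun_apply (\<alpha> d (cmap d p)) (dtransition c d (cmap c p) v)"
    using \<alpha> unfolding one_form_def by blast
  then show "blinfun_apply (- \<alpha> c (cmap c p)) v
      = blinfun_apply (- \<alpha> d (cmap d p)) (dtransition c d (cmap c p) v)"
    by (simp only: blinfun.minus_left)
next
  fix c x assume "c \<notin> A \<or> x \<notin> cimg c"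
  then have "\<alpha> c x = 0" using \<alpha> unfolding one_form_def by blast
  then show "- \<alpha> c x = 0" by simp
qed

lemma exterior_derivative_closed:
  "closed_form A \<alpha> \<Longrightarrow> c \<in> A \<Longrightarrow> x \<in> cimg c \<Longrightarrow> exterior_derivative \<alpha> c x v w = 0"
  unfolding closed_form_def by blast

lemma closed_form_add:
  assumes "closed_form A \<alpha>" "closed_form A \<beta>"
  shows "closed_form A (\<lambda>c x. \<alpha> c x + \<beta> c x)"
  unfolding closed_form_def
proof (intro conjI ballI allI)
  show "one_form A (\<lambda>c x. \<alpha> c x + \<beta> c x)" using assms one_form_add closed_form_one_form by blast
  fix c x v w assume "c \<in> A" "x \<in> cimg c"
  then show "exterior_derivative (\<lambda>c x. \<alpha> c x + \<beta> c x) c x v w = 0"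
    using smooth_on_differentiable[OF closed_formD[OF assms(1)]] smooth_on_differentiable[OF closed_formD[OF assms(2)]]
    by (simp add: exterior_derivative_add exterior_derivative_closed[OF assms(1)] exterior_derivative_closed[OF assms(2)]
      del: image_iff)
qed

lemma closed_form_minus:
  assumes "closed_form A \<alpha>"
  shows "closed_form A (\<lambda>c x. - \<alpha> c x)"
  unfolding closed_form_def
proof (intro conjI ballI allI)
  show "one_form A (\<lambda>c x. - \<alpha> c x)" using assms one_form_minus closed_form_one_form by blast
  fix c x v w assume "c \<in> A" "x \<in> cimg c"
  then show "exterior_derivative (\<lambda>c x. - \<alpha> c x) c x v w = 0"
    using smooth_on_differentiable[OF closed_formD[OF assms]]
    by (simp add: exterior_derivative_minus exterior_derivative_closed[OF assms] del: image_iff)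
qed

lemma closed_form_zero: "closed_form A (\<lambda>c x. 0)"
  by (simp add: closed_form_def one_form_def exterior_derivative_def)

lemma comm_group_closed_forms: "comm_group (closed_forms A)"
proof (rule comm_groupI)
  fix \<alpha> assume \<alpha>: "\<alpha> \<in> carrier (closed_forms A)"
  then have "(\<lambda>c x. - \<alpha> c x) \<in> carrier (closed_forms A)" using closed_form_minus by (simp add: closed_forms_def)
  then show "\<exists>\<beta>\<in>carrier (closed_forms A). \<beta> \<otimes>\<^bsub>closed_forms A\<^esub> \<alpha> = \<one>\<^bsub>closed_forms A\<^esub>"
    by (rule bexI[rotated]) (simp add: closed_forms_def)
qed (auto simp: closed_forms_def closed_form_add closed_form_zero ac_simps)

text \<open>The second derivatives of a primitive are symmetric in every chart.\<close>

lemma exact_form_closed: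
  assumes "exact_form A \<alpha>"
  shows "closed_form A \<alpha>"
proof -
  obtain f where \<alpha>: "one_form A \<alpha>" and f: "primitive_on A UNIV \<alpha> f"
    using assms unfolding exact_form_def by blast
  have "exterior_derivative \<alpha> c x v w = 0" if c: "c \<in> A" and x: "x \<in> cimg c" for c x v w
  proof -
    have sm: "smooth_on (\<alpha> c) (cimg c)" using \<alpha> c unfolding one_form_def by blast
    have "blinfun_apply (frechet_derivative (\<alpha> c) (at x) v) w = blinfun_apply (frechet_derivative (\<alpha> c) (at x) w) v"
    proof (rule symmetric_second_derivative[OF open_cimg[OF c] x _ smooth_on_has_derivative[OF sm x]])
      fix y assume y: "y \<in> cimg c"
      show "(f \<circ> cinv c has_derivative blinfun_apply (\<alpha> c y)) (at y)"
        using primitive_onD[OF f c UNIV_I cinv_cdom[OF c y]] by (simp only: cmap_cinv[OF c y])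
    qed
    then show ?thesis by (simp add: exterior_derivative_def)
  qed
  then show ?thesis using \<alpha> by (simp add: closed_form_def)
qed

lemma primitive_on_add:
  "primitive_on A V \<alpha> f \<Longrightarrow> primitive_on A V \<beta> g \<Longrightarrow> primitive_on A V (\<lambda>c x. \<alpha> c x + \<beta> c x) (\<lambda>p. f p + g p)"
  unfolding primitive_on_def o_def
  by (intro ballI, drule (1) bspec, drule (1) bspec, drule (1) bspec, drule (1) bspec)
    (simp add: plus_blinfun.rep_eq has_derivative_add)

lemma primitive_on_minus:
  "primitive_on A V \<alpha> f \<Longrightarrow> primitive_on A V (\<lambda>c x. - \<alpha> c x) (\<lambda>p. - f p)"
  unfolding primitive_on_def o_def
  by (intro ballI, drule (1) bspec, drule (1) bspec) (simp add: uminus_blinfun.rep_eq has_derivative_minus)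

lemma primitive_on_zero: "primitive_on A V (\<lambda>c x. 0) (\<lambda>p. k)"
  unfolding primitive_on_def o_def by (simp add: zero_blinfun.rep_eq)

lemma smooth_function_primitive:
  assumes \<alpha>: "one_form A \<alpha>" and f: "primitive_on A UNIV \<alpha> f"
  shows "smooth_function A f"
  unfolding smooth_function_def
proof
  fix c assume c: "c \<in> A"
  show "smooth_on (f \<circ> cinv c) (cimg c)"
  proof (rule smooth_on_primitive[OF open_cimg[OF c]])
    show "smooth_on (\<alpha> c) (cimg c)" using \<alpha> c unfolding one_form_def by blast
    fix y assume y: "y \<in> cimg c"
    show "(f \<circ> cinv c has_derivative blinfun_apply (\<alpha> c y)) (at y)"
      using primitive_onD[OF f c UNIV_I cinv_cdom[OF c y]] by (simp only: cmap_cinv[OF c y])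
  qed
qed

text \<open>Smoothness of a primitive follows from that of the form. So a potential that a
  coboundary gives only as a continuous function proves exactness as soon as its differential is
  \<alpha>.\<close>

lemma exact_form_iff: "exact_form A \<alpha> \<longleftrightarrow> one_form A \<alpha> \<and> (\<exists>f. primitive_on A UNIV \<alpha> f)"
  unfolding exact_form_def using smooth_function_primitive by blast

lemma subgroup_exact_forms: "subgroup (exact_forms A) (closed_forms A)"
proof -
  interpret comm_group "closed_forms A" by (rule comm_group_closed_forms)
  show ?thesis
  proof (rule subgroupI)
    show "exact_forms A \<subseteq> carrier (closed_forms A)"
      using exact_form_closed by (auto simp: exact_forms_def closed_forms_def)
    have "exact_form A (\<lambda>c x. 0)"
      unfolding exact_form_iff using closed_form_zero closed_form_one_form primitive_on_zero by blast
    then show "exact_forms A \<noteq> {}" by (auto simp: exact_forms_def)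
  next
    fix \<alpha> assume "\<alpha> \<in> exact_forms A"
    then have \<alpha>: "exact_form A \<alpha>" by (simp add: exact_forms_def)
    have "inv\<^bsub>closed_forms A\<^esub> \<alpha> = (\<lambda>c x. - \<alpha> c x)"
      by (rule inv_equality) (use closed_form_minus[OF exact_form_closed[OF \<alpha>]] exact_form_closed[OF \<alpha>] in \<open>auto simp: closed_forms_def\<close>)
    moreover have "exact_form A (\<lambda>c x. - \<alpha> c x)"
      using \<alpha> one_form_minus primitive_on_minus unfolding exact_form_iff by blast
    ultimately show "inv\<^bsub>closed_forms A\<^esub> \<alpha> \<in> exact_forms A" by (simp add: exact_forms_def)
  next
    fix \<alpha> \<beta> assume "\<alpha> \<in> exact_forms A" "\<beta> \<in> exact_forms A"
    then show "\<alpha> \<otimes>\<^bsub>closed_forms A\<^esub> \<beta> \<in> exact_forms A"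
      using one_form_add primitive_on_add unfolding exact_forms_def exact_form_iff closed_forms_def
      by (simp, blast)
  qed
qed

lemma path_integral_add:
  assumes \<alpha>: "closed_form A \<alpha>" and \<beta>: "closed_form A \<beta>" and \<gamma>: "path \<gamma>"
  shows "path_integral A (\<lambda>c x. \<alpha> c x + \<beta> c x) \<gamma> = path_integral A \<alpha> \<gamma> + path_integral A \<beta> \<gamma>"
proof -
  note c\<gamma> = \<gamma>[unfolded path_def]
  obtain F where F: "primitive_along \<alpha> \<gamma> 0 1 F" using primitive_along_exists[OF \<alpha> c\<gamma> zero_le_one] by blast
  obtain H where H: "primitive_along \<beta> \<gamma> 0 1 H" using primitive_along_exists[OF \<beta> c\<gamma> zero_le_one] by blast
  have "primitive_along (\<lambda>c x. \<alpha> c x + \<beta> c x) \<gamma> 0 1 (\<lambda>t. F t + H t)"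
    unfolding primitive_along_def
  proof
    fix t :: real assume t: "t \<in> {0..1}"
    obtain V f d where V: "open V" "\<gamma> t \<in> V" "primitive_on A V \<alpha> f" "d > 0"
        "\<forall>s\<in>{0..1}. \<bar>s - t\<bar> < d \<longrightarrow> F s - F t = f (\<gamma> s) - f (\<gamma> t)"
      using primitive_alongD[OF F t] by blast
    obtain W h e where W: "open W" "\<gamma> t \<in> W" "primitive_on A W \<beta> h" "e > 0"
        "\<forall>s\<in>{0..1}. \<bar>s - t\<bar> < e \<longrightarrow> H s - H t = h (\<gamma> s) - h (\<gamma> t)"
      using primitive_alongD[OF H t] by blast
    have "primitive_on A (V \<inter> W) (\<lambda>c x. \<alpha> c x + \<beta> c x) (\<lambda>p. f p + h p)"
      by (intro primitive_on_add primitive_on_subset[OF V(3)] primitive_on_subset[OF W(3)]) auto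
    moreover have "\<forall>s\<in>{0..1}. \<bar>s - t\<bar> < min d e \<longrightarrow> (F s + H s) - (F t + H t) = (f (\<gamma> s) + h (\<gamma> s)) - (f (\<gamma> t) + h (\<gamma> t))"
      using V(5) W(5) by force
    ultimately show "\<exists>V f. open V \<and> \<gamma> t \<in> V \<and> primitive_on A V (\<lambda>c x. \<alpha> c x + \<beta> c x) f \<and>
     (\<exists>d>0. \<forall>s\<in>{0..1}. \<bar>s - t\<bar> < d \<longrightarrow> (F s + H s) - (F t + H t) = f (\<gamma> s) - f (\<gamma> t))"
      using V(1,2,4) W(1,2,4) by (intro exI[of _ "V \<inter> W"] exI[of _ "\<lambda>p. f p + h p"] conjI exI[of _ "min d e"]) auto
  qed
  from path_integral_eq[OF closed_form_add[OF \<alpha> \<beta>] \<gamma> this] show ?thesis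
    using path_integral_eq[OF \<alpha> \<gamma> F] path_integral_eq[OF \<beta> \<gamma> H] by simp
qed

end

context volume_manifold
begin

section \<open>From displacements to cocycles\<close>

lemma displacement_form_add:
  assumes \<alpha>: "closed_form A \<alpha>" and \<beta>: "closed_form A \<beta>" and h: "h \<in> G"
  shows "displacement A (\<lambda>c x. \<alpha> c x + \<beta> c x) h x y = displacement A \<alpha> h x y + displacement A \<beta> h x y"
proof -
  obtain \<gamma> where \<gamma>: "path \<gamma>" "pathstart \<gamma> = x" "pathfinish \<gamma> = y" by (rule path_exists)
  note hp = path_comp[OF G_continuous[OF h] \<gamma>(1)]
  show ?thesis
    using displacement_eq[OF closed_form_add[OF \<alpha> \<beta>] h \<gamma>(1), unfolded \<gamma>(2,3)]
      displacement_eq[OF \<alpha> h \<gamma>(1), unfolded \<gamma>(2,3)] displacement_eq[OF \<beta> h \<gamma>(1), unfolded \<gamma>(2,3)]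
      path_integral_add[OF \<alpha> \<beta> \<gamma>(1)] path_integral_add[OF \<alpha> \<beta> hp]
    by linarith
qed

lemma displacement_exact:
  assumes \<alpha>: "closed_form A \<alpha>" and f: "primitive_on A UNIV \<alpha> f" and h: "h \<in> G"
  shows "displacement A \<alpha> h x y = (f (h y) - f (h x)) - (f y - f x)"
proof -
  obtain \<gamma> where \<gamma>: "path \<gamma>" "pathstart \<gamma> = x" "pathfinish \<gamma> = y" by (rule path_exists)
  show ?thesis by (rule displacement_local[OF \<alpha> h \<gamma> open_UNIV f _ open_UNIV f]) auto
qed

text \<open>\<open>tau\<close> before the division by the norm of the form; in contrast to
  \<open>tau\<close> it is additive in \<alpha>.\<close>

definition mean_displacement :: "('m, 'n) form1 \<Rightarrow> ('m \<Rightarrow> 'm) \<Rightarrow> 'm \<Rightarrow> real" where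
  "mean_displacement \<alpha> h z = (\<integral>y. displacement A \<alpha> h z y \<partial>\<mu>)"

lemma displacement_integrable: "closed_form A \<alpha> \<Longrightarrow> h \<in> G \<Longrightarrow> integrable \<mu> (displacement A \<alpha> h x)"
  by (intro continuous_integrable displacement_continuous)

text \<open>Additivity in the end points, with total mass 1 to pull the constant out of the
  integral. Read backwards it recovers the displacement from its mean, which is where the
  injectivity argument starts.\<close>

lemma mean_displacement_diff:
  assumes "closed_form A \<alpha>" "h \<in> G"
  shows "mean_displacement \<alpha> h z = mean_displacement \<alpha> h x - displacement A \<alpha> h x z"
proof -
  have "displacement A \<alpha> h z y = displacement A \<alpha> h x y - displacement A \<alpha> h x z" for y
    using displacement_add[OF assms, of x y z] by simp
  then have "mean_displacement \<alpha> h z = (\<integral>y. displacement A \<alpha> h x y - displacement A \<alpha> h x z \<partial>\<mu>)"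
    unfolding mean_displacement_def by (intro Bochner_Integration.integral_cong) auto
  also have "\<dots> = mean_displacement \<alpha> h x - displacement A \<alpha> h x z"
    unfolding mean_displacement_def using displacement_integrable[OF assms, of x]
    by (subst Bochner_Integration.integral_diff) (simp_all add: measure_\<mu>_UNIV)
  finally show ?thesis .
qed

lemma mean_displacement_continuous:
  assumes "closed_form A \<alpha>" "h \<in> G"
  shows "continuous_on UNIV (mean_displacement \<alpha> h)"
proof -
  fix x
  have "mean_displacement \<alpha> h = (\<lambda>z. mean_displacement \<alpha> h x - displacement A \<alpha> h x z)"
    using mean_displacement_diff[OF assms] by (rule ext)
  moreover have "continuous_on UNIV \<dots>" by (intro continuous_intros displacement_continuous assms)
  ultimately show ?thesis by metis
qed

lemma integral_G_invariant:
  assumes "k \<in> G" "continuous_on UNIV (f :: 'm \<Rightarrow> real)"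
  shows "(\<integral>y. f (k y) \<partial>\<mu>) = (\<integral>y. f y \<partial>\<mu>)"
proof -
  have "(\<integral>y. f y \<partial>\<mu>) = (\<integral>y. f y \<partial>distr \<mu> \<mu> k)"
    using Homeo_vol_distr G_subset assms(1) by (metis subsetD)
  also have "\<dots> = (\<integral>y. f (k y) \<partial>\<mu>)"
    by (rule integral_distr) (intro continuous_measurable G_continuous continuous_measurable_real assms)+
  finally show ?thesis ..
qed

lemma mean_displacement_cocycle:
  assumes \<alpha>: "closed_form A \<alpha>" and h: "h \<in> G" and k: "k \<in> G"
  shows "mean_displacement \<alpha> (h \<circ> k) z = mean_displacement \<alpha> h (k z) + mean_displacement \<alpha> k z"
proof -
  have c: "continuous_on UNIV (\<lambda>y. displacement A \<alpha> h (k z) (k y))"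
    by (rule continuous_on_compose2[OF displacement_continuous[OF \<alpha> h] G_continuous[OF k]]) simp
  have "mean_displacement \<alpha> (h \<circ> k) z
      = (\<integral>y. displacement A \<alpha> h (k z) (k y) + displacement A \<alpha> k z y \<partial>\<mu>)"
    by (simp add: mean_displacement_def displacement_comp[OF \<alpha> h k])
  also have "\<dots> = (\<integral>y. displacement A \<alpha> h (k z) (k y) \<partial>\<mu>) + mean_displacement \<alpha> k z"
    unfolding mean_displacement_def
    by (rule Bochner_Integration.integral_add[OF continuous_integrable[OF c] displacement_integrable[OF \<alpha> k]])
  also have "(\<integral>y. displacement A \<alpha> h (k z) (k y) \<partial>\<mu>) = mean_displacement \<alpha> h (k z)"
    unfolding mean_displacement_def by (rule integral_G_invariant[OF k displacement_continuous[OF \<alpha> h]])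
  finally show ?thesis .
qed

definition cocycle_of :: "('m, 'n) form1 \<Rightarrow> 'm cochain1" where
  "cocycle_of \<alpha> = (\<lambda>h\<in>G. mean_displacement \<alpha> h)"

lemma cocycle_iff: "F \<in> carrier (cocycles1 G) \<longleftrightarrow> F \<in> extensional G \<and> (\<forall>h\<in>G. continuous_on UNIV (F h)) \<and>
    (\<forall>h\<in>G. \<forall>k\<in>G. \<forall>z. F (h \<circ> k) z = F h (k z) + F k z)"
proof -
  have "coboundary1 F h k = (\<lambda>z. 0) \<longleftrightarrow> (\<forall>z. F (h \<circ> k) z = F h (k z) + F k z)" for h k
    by (auto simp: coboundary1_def fun_eq_iff algebra_simps)
  then show ?thesis by (auto simp: cocycles1_def cochains1_def cont_funs_def PiE_def Pi_def)
qed

lemma restrict_cocycle: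
  assumes "\<And>h. h \<in> G \<Longrightarrow> continuous_on UNIV (F h)"
    "\<And>h k z. h \<in> G \<Longrightarrow> k \<in> G \<Longrightarrow> F (h \<circ> k) z = F h (k z) + F k z"
  shows "restrict F G \<in> carrier (cocycles1 G)"
  using assms G_comp by (auto simp: cocycle_iff)

lemma scaled_cocycle:
  assumes "closed_form A \<alpha>"
  shows "(\<lambda>h\<in>G. \<lambda>z. r * mean_displacement \<alpha> h z) \<in> carrier (cocycles1 G)"
  by (rule restrict_cocycle)
    (auto intro!: continuous_intros mean_displacement_continuous assms
      simp: mean_displacement_cocycle[OF assms] distrib_left)

lemma cocycle_of_carrier: "closed_form A \<alpha> \<Longrightarrow> cocycle_of \<alpha> \<in> carrier (cocycles1 G)"
  using scaled_cocycle[of \<alpha> 1] by (simp add: cocycle_of_def eta_contract_eq)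

lemma tau_cochain_eq: "tau_cochain A \<Omega> g \<alpha> = (\<lambda>h\<in>G. \<lambda>z. 1 / form_L2_norm A g \<alpha> * mean_displacement \<alpha> h z)"
  by (simp add: tau_cochain_def tau_def mean_displacement_def \<mu>_def fun_eq_iff restrict_def)

lemma tau_cochain_carrier: "closed_form A \<alpha> \<Longrightarrow> tau_cochain A \<Omega> g \<alpha> \<in> carrier (cocycles1 G)"
  unfolding tau_cochain_eq by (rule scaled_cocycle)

lemma mean_displacement_add:
  assumes "closed_form A \<alpha>" "closed_form A \<beta>" "h \<in> G"
  shows "mean_displacement (\<lambda>c x. \<alpha> c x + \<beta> c x) h z = mean_displacement \<alpha> h z + mean_displacement \<beta> h z"
  unfolding mean_displacement_def displacement_form_add[OF assms]
  by (rule Bochner_Integration.integral_add) (intro displacement_integrable assms)+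

text \<open>The integrals of \<open>f\<close> and of its composite with \<open>h\<close> cancel by
  invariance. The remaining sign makes the cocycle the coboundary of \<open>- f\<close>.\<close>

lemma mean_displacement_exact:
  assumes \<alpha>: "closed_form A \<alpha>" and f: "primitive_on A UNIV \<alpha> f" and h: "h \<in> G"
  shows "mean_displacement \<alpha> h z = f z - f (h z)"
proof -
  have cf: "continuous_on UNIV f" by (rule primitive_on_continuous[OF f open_UNIV])
  have cfh: "continuous_on UNIV (\<lambda>y. f (h y))" by (rule continuous_on_compose2[OF cf G_continuous[OF h]]) simp
  have "mean_displacement \<alpha> h z = (\<integral>y. (f (h y) - f y) + (f z - f (h z)) \<partial>\<mu>)"
    unfolding mean_displacement_def displacement_exact[OF assms] by (simp add: algebra_simps)
  also have "\<dots> = ((\<integral>y. f (h y) \<partial>\<mu>) - (\<integral>y. f y \<partial>\<mu>)) + (f z - f (h z))"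
    using continuous_integrable[OF cf] continuous_integrable[OF cfh]
    by (simp add: measure_\<mu>_UNIV)
  finally show ?thesis using integral_G_invariant[OF h cf] by simp
qed

lemma mean_displacement_zero: "h \<in> G \<Longrightarrow> mean_displacement (\<lambda>c x. 0) h z = 0"
  by (simp add: mean_displacement_exact[OF closed_form_zero primitive_on_zero[where k = 0]])

text \<open>For nonzero \<alpha> the norm is nonzero and cancels; for \<alpha> = 0 both sides
  vanish.\<close>

lemma cochain_scale_tau:
  assumes g: "riemannian_metric A g" and \<alpha>: "closed_form A \<alpha>"
  shows "cochain_scale G (form_L2_norm A g \<alpha>) (tau_cochain A \<Omega> g \<alpha>) = cocycle_of \<alpha>"
proof (cases "\<alpha> = (\<lambda>c x. 0)")
  case True
  show ?thesis
    unfolding cochain_scale_def tau_cochain_eq cocycle_of_def True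
    by (rule restrict_ext) (simp add: fun_eq_iff mean_displacement_zero)
next
  case False
  then have "form_L2_norm A g \<alpha> \<noteq> 0" by (rule form_L2_norm_nonzero[OF g closed_form_one_form[OF \<alpha>]])
  then show ?thesis
    by (auto simp: cochain_scale_def tau_cochain_eq cocycle_of_def restrict_def fun_eq_iff)
qed

section \<open>Cocycles as a group, coboundaries as a subgroup\<close>

lemma mult_cocycles: "F \<otimes>\<^bsub>cocycles1 G\<^esub> H = (\<lambda>h\<in>G. \<lambda>z. F h z + H h z)"
  and one_cocycles: "\<one>\<^bsub>cocycles1 G\<^esub> = (\<lambda>h\<in>G. \<lambda>z. 0)"
  by (simp_all add: cocycles1_def)

lemma comm_group_cocycles: "comm_group (cocycles1 G)"
proof (rule comm_groupI)
  fix F assume F: "F \<in> carrier (cocycles1 G)"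
  then have "(\<lambda>h\<in>G. \<lambda>z. - F h z) \<in> carrier (cocycles1 G)"
    by (intro restrict_cocycle) (auto simp: cocycle_iff intro!: continuous_intros)
  moreover have "(\<lambda>h\<in>G. \<lambda>z. - F h z) \<otimes>\<^bsub>cocycles1 G\<^esub> F = \<one>\<^bsub>cocycles1 G\<^esub>"
    unfolding mult_cocycles one_cocycles by (rule restrict_ext) simp
  ultimately show "\<exists>H\<in>carrier (cocycles1 G). H \<otimes>\<^bsub>cocycles1 G\<^esub> F = \<one>\<^bsub>cocycles1 G\<^esub>" by blast
next
  fix F H assume "F \<in> carrier (cocycles1 G)" "H \<in> carrier (cocycles1 G)"
  then show "F \<otimes>\<^bsub>cocycles1 G\<^esub> H \<in> carrier (cocycles1 G)"
    unfolding mult_cocycles by (intro restrict_cocycle) (auto simp: cocycle_iff intro!: continuous_intros)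
next
  show "\<one>\<^bsub>cocycles1 G\<^esub> \<in> carrier (cocycles1 G)"
    unfolding one_cocycles by (rule restrict_cocycle) auto
next
  fix F assume "F \<in> carrier (cocycles1 G)"
  then have "F \<in> extensional G" by (simp add: cocycle_iff)
  then have "restrict F G = F" by (rule extensional_restrict)
  moreover have "\<one>\<^bsub>cocycles1 G\<^esub> \<otimes>\<^bsub>cocycles1 G\<^esub> F = restrict F G"
    unfolding mult_cocycles one_cocycles by (rule restrict_ext) simp
  ultimately show "\<one>\<^bsub>cocycles1 G\<^esub> \<otimes>\<^bsub>cocycles1 G\<^esub> F = F" by simp
next
  fix F H K
  show "F \<otimes>\<^bsub>cocycles1 G\<^esub> H \<otimes>\<^bsub>cocycles1 G\<^esub> K = F \<otimes>\<^bsub>cocycles1 G\<^esub> (H \<otimes>\<^bsub>cocycles1 G\<^esub> K)"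
    unfolding mult_cocycles by (rule restrict_ext) (simp add: add.assoc)
  show "F \<otimes>\<^bsub>cocycles1 G\<^esub> H = H \<otimes>\<^bsub>cocycles1 G\<^esub> F"
    unfolding mult_cocycles by (simp add: add.commute)
qed

lemma coboundary_cocycle:
  assumes f: "f \<in> cont_funs"
  shows "coboundary0 G f \<in> carrier (cocycles1 G)"
  unfolding coboundary0_def
proof (rule restrict_cocycle)
  fix h assume "h \<in> G"
  then show "continuous_on UNIV (\<lambda>z. f (h z) - f z)"
    using f by (intro continuous_intros continuous_on_compose2[of UNIV f UNIV h] G_continuous)
      (auto simp: cont_funs_def)
qed simp

lemma subgroup_coboundaries: "subgroup (coboundaries1 G) (cocycles1 G)"
proof -
  interpret comm_group "cocycles1 G" by (rule comm_group_cocycles)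
  show ?thesis
  proof (rule subgroupI)
    show "coboundaries1 G \<subseteq> carrier (cocycles1 G)" using coboundary_cocycle by (auto simp: coboundaries1_def)
    show "coboundaries1 G \<noteq> {}" by (auto simp: coboundaries1_def cont_funs_def intro: continuous_on_const)
  next
    fix F assume "F \<in> coboundaries1 G"
    then obtain f where f: "f \<in> cont_funs" "F = coboundary0 G f" by (auto simp: coboundaries1_def)
    then have f': "(\<lambda>z. - f z) \<in> cont_funs" by (auto simp: cont_funs_def intro: continuous_intros)
    have "inv\<^bsub>cocycles1 G\<^esub> F = coboundary0 G (\<lambda>z. - f z)"
    proof (rule inv_equality)
      show "coboundary0 G (\<lambda>z. - f z) \<otimes>\<^bsub>cocycles1 G\<^esub> F = \<one>\<^bsub>cocycles1 G\<^esub>"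
        unfolding mult_cocycles one_cocycles f(2) coboundary0_def by (rule restrict_ext) simp
    qed (use f f' coboundary_cocycle in auto)
    then show "inv\<^bsub>cocycles1 G\<^esub> F \<in> coboundaries1 G" using f' by (auto simp: coboundaries1_def)
  next
    fix F F' assume "F \<in> coboundaries1 G" "F' \<in> coboundaries1 G"
    then obtain f f' where f: "f \<in> cont_funs" "F = coboundary0 G f" "f' \<in> cont_funs" "F' = coboundary0 G f'"
      by (auto simp: coboundaries1_def)
    then have "(\<lambda>z. f z + f' z) \<in> cont_funs" by (auto simp: cont_funs_def intro: continuous_intros)
    moreover have "F \<otimes>\<^bsub>cocycles1 G\<^esub> F' = coboundary0 G (\<lambda>z. f z + f' z)"
      unfolding mult_cocycles f coboundary0_def by (rule restrict_ext) (simp add: fun_eq_iff)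
    ultimately show "F \<otimes>\<^bsub>cocycles1 G\<^esub> F' \<in> coboundaries1 G" by (auto simp: coboundaries1_def)
  qed
qed

lemma cocycle_of_hom: "cocycle_of \<in> hom (closed_forms A) (cocycles1 G)"
proof (rule homI)
  fix \<alpha> assume "\<alpha> \<in> carrier (closed_forms A)"
  then show "cocycle_of \<alpha> \<in> carrier (cocycles1 G)" by (simp add: closed_forms_def cocycle_of_carrier)
next
  fix \<alpha> \<beta> assume "\<alpha> \<in> carrier (closed_forms A)" "\<beta> \<in> carrier (closed_forms A)"
  then show "cocycle_of (\<alpha> \<otimes>\<^bsub>closed_forms A\<^esub> \<beta>) = cocycle_of \<alpha> \<otimes>\<^bsub>cocycles1 G\<^esub> cocycle_of \<beta>"
    by (auto simp: closed_forms_def cocycles1_def cocycle_of_def restrict_def fun_eq_iff mean_displacement_add)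
qed

lemma cocycle_of_exact: "cocycle_of ` exact_forms A \<subseteq> coboundaries1 G"
proof
  fix F assume "F \<in> cocycle_of ` exact_forms A"
  then obtain \<alpha> where \<alpha>: "exact_form A \<alpha>" "F = cocycle_of \<alpha>" by (auto simp: exact_forms_def)
  then obtain f where f: "primitive_on A UNIV \<alpha> f" unfolding exact_form_iff by blast
  have "F = coboundary0 G (\<lambda>z. - f z)"
    by (auto simp: \<alpha>(2) cocycle_of_def coboundary0_def restrict_def fun_eq_iff
      mean_displacement_exact[OF exact_form_closed[OF \<alpha>(1)] f])
  moreover have "(\<lambda>z. - f z) \<in> cont_funs"
    using primitive_on_continuous[OF f open_UNIV] by (auto simp: cont_funs_def intro: continuous_intros)
  ultimately show "F \<in> coboundaries1 G" by (auto simp: coboundaries1_def)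
qed

end

section \<open>Measure preserving twists of Euclidean space\<close>

text \<open>The reflection along \<open>a\<close> conjugates the transvection \<open>v \<mapsto> v + (b \<bullet> v) a\<close> to its inverse.\<close>

lemma abs_det_transvection:
  fixes a b :: "real ^ 'n::finite"
  assumes ab: "b \<bullet> a = 0"
  shows "\<bar>det (matrix (\<lambda>v. v + (b \<bullet> v) *\<^sub>R a))\<bar> = 1"
proof -
  define L where "L = (\<lambda>v. v + (b \<bullet> v) *\<^sub>R a)"
  define L' where "L' = (\<lambda>v. v - (b \<bullet> v) *\<^sub>R a)"
  \<comment> \<open>For \<open>a = 0\<close> the quotient is 0 by default and \<open>Q\<close> is
    the identity.\<close>
  define Q where "Q = (\<lambda>v. v - (2 * (a \<bullet> v) / (a \<bullet> a)) *\<^sub>R a)"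
  have lin: "linear L" "linear L'" "linear Q"
    unfolding L_def L'_def Q_def
    by (auto intro!: linearI simp: inner_add_right algebra_simps add_divide_distrib)
  have "norm (Q v) = norm v" for v
  proof (cases "a = 0")
    case False
    then have "Q v \<bullet> Q v = v \<bullet> v"
      by (simp add: Q_def inner_diff_left inner_diff_right inner_commute[of v a] field_simps power2_eq_square)
    then show ?thesis by (simp add: norm_eq)
  qed (simp add: Q_def)
  then have "orthogonal_transformation Q" using lin by (simp add: orthogonal_transformation)
  then have dQ: "\<bar>det (matrix Q)\<bar> = 1" by (rule orthogonal_transformation_det)
  have L'L: "L' \<circ> L = id" by (auto simp: L_def L'_def fun_eq_iff inner_add_right ab)
  have "Q \<circ> L \<circ> Q = L'"
  proof
    fix v
    show "(Q \<circ> L \<circ> Q) v = L' v"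
    proof (cases "a = 0")
      case False
      then have Qa: "Q a = - a" by (simp add: Q_def algebra_simps flip: scaleR_2)
      define t where "t = 2 * (a \<bullet> v) / (a \<bullet> a)"
      have Qv: "Q v = v - t *\<^sub>R a" by (simp add: Q_def t_def)
      then have "Q (Q v) = Q v - t *\<^sub>R Q a" by (simp add: linear_diff[OF lin(3)] linear_cmul[OF lin(3)])
      then have QQ: "Q (Q v) = v" by (simp add: Qv Qa)
      have "b \<bullet> Q v = b \<bullet> v" by (simp add: Q_def inner_diff_right ab)
      then show ?thesis
        by (simp add: L_def L'_def linear_add[OF lin(3)] linear_cmul[OF lin(3)] QQ Qa)
    qed (simp add: Q_def L_def L'_def)
  qed
  then have "det (matrix L') = det (matrix Q) * det (matrix L) * det (matrix Q)"
    using lin by (metis (no_types, lifting) det_mul linear_compose matrix_compose)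
  then have "\<bar>det (matrix L')\<bar> = \<bar>det (matrix L)\<bar>" using dQ by (simp add: abs_mult)
  \<comment> \<open>\<open>L'\<close> is also the inverse of \<open>L\<close>; two numbers of equal
    absolute value with product 1 have absolute value 1.\<close>
  moreover have "det (matrix L') * det (matrix L) = 1"
    using L'L lin by (metis det_I det_mul matrix_compose matrix_id_mat_1)
  then have "\<bar>det (matrix L')\<bar> * \<bar>det (matrix L)\<bar> = 1" by (simp add: abs_mult[symmetric])
  ultimately have "\<bar>det (matrix L)\<bar>\<^sup>2 = 1" by (simp add: power2_eq_square)
  then show ?thesis by (simp add: L_def abs_square_eq_1)
qed

locale plane =
  fixes e f :: "real ^ 'n::finite"
  assumes orthonormal: "e \<bullet> e = 1" "f \<bullet> f = 1" "e \<bullet> f = 0"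
begin

definition proj :: "real ^ 'n \<Rightarrow> real ^ 'n" where "proj x = (x \<bullet> e) *\<^sub>R e + (x \<bullet> f) *\<^sub>R f"

text \<open>The orthogonal projection to the plane followed by the quarter turn that takes
  \<open>e\<close> to \<open>f\<close>.\<close>

definition turn :: "real ^ 'n \<Rightarrow> real ^ 'n" where "turn x = (x \<bullet> e) *\<^sub>R f - (x \<bullet> f) *\<^sub>R e"

text \<open>The rotation by \<open>\<theta>\<close> in the plane, written as a perturbation of the
  identity so that the orthogonal complement is visibly fixed.\<close>

definition rot :: "real \<Rightarrow> real ^ 'n \<Rightarrow> real ^ 'n" where
  "rot \<theta> x = x + (cos \<theta> - 1) *\<^sub>R proj x + sin \<theta> *\<^sub>R turn x"

lemma inner_ef [simp]: "e \<bullet> e = 1" "f \<bullet> f = 1" "e \<bullet> f = 0" "f \<bullet> e = 0"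
  using orthonormal by (auto simp: inner_commute)

lemma linear_proj: "linear proj" and linear_turn: "linear turn" and linear_rot: "linear (rot \<theta>)"
  unfolding proj_def turn_def rot_def by (auto intro!: linearI simp: inner_add_left algebra_simps)

lemma bounded_linear_proj: "bounded_linear proj" and bounded_linear_turn: "bounded_linear turn"
  using linear_proj linear_turn by (simp_all add: linear_conv_bounded_linear)

lemma proj_proj: "proj (proj x) = proj x" and proj_turn: "proj (turn x) = turn x"
  and turn_proj: "turn (proj x) = turn x" and turn_turn: "turn (turn x) = - proj x"
  by (simp_all add: proj_def turn_def inner_add_left inner_diff_left)

lemma inner_turn: "x \<bullet> turn x = 0" and proj_inner_turn: "proj x \<bullet> turn x = 0"
  and proj_inner: "x \<bullet> proj x = proj x \<bullet> proj x" and turn_inner: "turn x \<bullet> turn x = proj x \<bullet> proj x"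
  by (simp_all add: proj_def turn_def inner_add_left inner_add_right inner_diff_left inner_diff_right
    inner_commute[of e x] inner_commute[of f x])

lemma rot_rot: "rot \<theta> (rot \<phi> x) = rot (\<theta> + \<phi>) x"
proof -
  note lin = linear_add[OF linear_proj] linear_cmul[OF linear_proj] linear_add[OF linear_turn] linear_cmul[OF linear_turn]
  show ?thesis
    unfolding rot_def lin proj_proj proj_turn turn_proj turn_turn cos_add sin_add
    by (simp add: algebra_simps)
qed

lemma rot_0 [simp]: "rot 0 x = x" by (simp add: rot_def)

lemma norm_rot [simp]: "norm (rot \<theta> x) = norm x"
proof -
  have "(x + c *\<^sub>R proj x + s *\<^sub>R turn x) \<bullet> (x + c *\<^sub>R proj x + s *\<^sub>R turn x)
      = x \<bullet> x + (2 * c + c\<^sup>2 + s\<^sup>2) * (proj x \<bullet> proj x)" for c s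
    by (simp add: inner_add_left inner_add_right inner_commute[of "turn x" x] inner_commute[of "turn x" "proj x"]
      inner_commute[of "proj x" x] inner_turn proj_inner_turn proj_inner turn_inner algebra_simps power2_eq_square)
  then have "rot \<theta> x \<bullet> rot \<theta> x = x \<bullet> x + (2 * (cos \<theta> - 1) + (cos \<theta> - 1)\<^sup>2 + (sin \<theta>)\<^sup>2) * (proj x \<bullet> proj x)"
    by (simp only: rot_def)
  also have "2 * (cos \<theta> - 1) + (cos \<theta> - 1)\<^sup>2 + (sin \<theta>)\<^sup>2 = 0"
    using sin_cos_squared_add[of \<theta>] by (simp add: power2_eq_square algebra_simps)
  finally show ?thesis by (simp add: norm_eq)
qed

lemma continuous_on_rot:
  fixes S :: "'a::t2_space set"
  assumes "continuous_on S g" "continuous_on S h"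
  shows "continuous_on S (\<lambda>x. rot (g x) (h x))"
  unfolding rot_def proj_def turn_def by (intro continuous_intros assms)

text \<open>Constant on spheres about \<open>q\<close>, zero outside the ball, and linear in
  \<open>\<kappa>\<close>, so that twists form a one-parameter group. The square of the norm is used
  because it is smooth at the centre as well.\<close>

definition angle :: "real ^ 'n \<Rightarrow> real \<Rightarrow> real \<Rightarrow> real ^ 'n \<Rightarrow> real" where
  "angle q R \<kappa> x = \<kappa> * max 0 (R\<^sup>2 - (norm (x - q))\<^sup>2)"

definition twist :: "real ^ 'n \<Rightarrow> real \<Rightarrow> real \<Rightarrow> real ^ 'n \<Rightarrow> real ^ 'n" where
  "twist q R \<kappa> x = q + rot (angle q R \<kappa> x) (x - q)"

lemma norm_twist [simp]: "norm (twist q R \<kappa> x - q) = norm (x - q)"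
  by (simp add: twist_def)

text \<open>A twist preserves the distance from \<open>q\<close>, so the second angle can be read
  off at the original point and the angles add. In particular the twist with
  \<open>- \<kappa>\<close> is the inverse.\<close>

lemma twist_comp: "twist q R \<kappa> (twist q R \<kappa>' x) = twist q R (\<kappa> + \<kappa>') x"
proof -
  have "angle q R \<kappa> (twist q R \<kappa>' x) = angle q R \<kappa> x" by (simp add: angle_def)
  then have "twist q R \<kappa> (twist q R \<kappa>' x) = q + rot (angle q R \<kappa> x) (twist q R \<kappa>' x - q)"
    by (simp add: twist_def[of q R \<kappa>])
  also have "\<dots> = q + rot (angle q R \<kappa> x + angle q R \<kappa>' x) (x - q)"
    by (simp add: twist_def[of q R \<kappa>'] rot_rot)
  also have "angle q R \<kappa> x + angle q R \<kappa>' x = angle q R (\<kappa> + \<kappa>') x"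
    by (simp add: angle_def distrib_right)
  finally show ?thesis by (simp add: twist_def)
qed

lemma twist_0 [simp]: "twist q R 0 x = x" by (simp add: twist_def angle_def)

lemma twist_centre [simp]: "twist q R \<kappa> q = q" by (simp add: twist_def rot_def proj_def turn_def)

lemma twist_outside: "R \<ge> 0 \<Longrightarrow> x \<notin> ball q R \<Longrightarrow> twist q R \<kappa> x = x"
  by (simp add: twist_def angle_def dist_norm norm_minus_commute power_mono)

lemma twist_ball: "twist q R \<kappa> x \<in> ball q R \<longleftrightarrow> x \<in> ball q R"
  using norm_twist[of q R \<kappa> x] by (simp add: dist_norm norm_minus_commute)

lemma inj_twist: "inj (twist q R \<kappa>)"
  by (rule inj_on_inverseI[of _ "twist q R (- \<kappa>)"]) (simp add: twist_comp)

lemma continuous_on_twist: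
  fixes S :: "'a::t2_space set"
  assumes "continuous_on S g" "continuous_on S h"
  shows "continuous_on S (\<lambda>x. twist q R (g x) (h x))"
  unfolding twist_def angle_def by (intro continuous_intros continuous_on_rot assms)

text \<open>The derivative of the twist inside the ball, with the rotation factored out; this is
  possible because \<open>turn\<close> commutes with the rotations. What remains is a transvection
  in the direction \<open>turn (x - q)\<close>, which is orthogonal to \<open>x - q\<close>, so the
  determinant has absolute value 1.\<close>

definition dtwist :: "real ^ 'n \<Rightarrow> real \<Rightarrow> real \<Rightarrow> real ^ 'n \<Rightarrow> real ^ 'n \<Rightarrow> real ^ 'n" where
  "dtwist q R \<kappa> x v = rot (\<kappa> * (R\<^sup>2 - (norm (x - q))\<^sup>2)) (v + ((x - q) \<bullet> v) *\<^sub>R (- (2 * \<kappa>)) *\<^sub>R turn (x - q))"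

lemma twist_has_derivative:
  assumes x: "x \<in> ball q R"
  shows "(twist q R \<kappa> has_derivative dtwist q R \<kappa> x) (at x)"
proof -
  \<comment> \<open>Inside the ball the cutoff in \<open>angle\<close> is inactive, which leaves a
    polynomial.\<close>
  define \<theta> where "\<theta> = (\<lambda>x. \<kappa> * (R\<^sup>2 - (x - q) \<bullet> (x - q)))"
  define T where "T = (\<lambda>x. q + (x - q + (cos (\<theta> x) - 1) *\<^sub>R proj (x - q) + sin (\<theta> x) *\<^sub>R turn (x - q)))"
  have d\<theta>: "(\<theta> has_derivative (\<lambda>v. - (2 * \<kappa>) * ((x - q) \<bullet> v))) (at x)"
    unfolding \<theta>_def by (auto intro!: derivative_eq_intros simp: inner_commute algebra_simps)
  note dp = bounded_linear.has_derivative[OF bounded_linear_proj] bounded_linear.has_derivative[OF bounded_linear_turn]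
  have "(T has_derivative (\<lambda>v. v + ((cos (\<theta> x) - 1) *\<^sub>R proj v + (- sin (\<theta> x) * (- (2 * \<kappa>) * ((x - q) \<bullet> v))) *\<^sub>R proj (x - q))
      + (sin (\<theta> x) *\<^sub>R turn v + (cos (\<theta> x) * (- (2 * \<kappa>) * ((x - q) \<bullet> v))) *\<^sub>R turn (x - q)))) (at x)"
    unfolding T_def by (auto intro!: derivative_eq_intros d\<theta> dp simp: mult_ac)
  also have "(\<lambda>v. v + ((cos (\<theta> x) - 1) *\<^sub>R proj v + (- sin (\<theta> x) * (- (2 * \<kappa>) * ((x - q) \<bullet> v))) *\<^sub>R proj (x - q))
      + (sin (\<theta> x) *\<^sub>R turn v + (cos (\<theta> x) * (- (2 * \<kappa>) * ((x - q) \<bullet> v))) *\<^sub>R turn (x - q))) = dtwist q R \<kappa> x"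
  proof
    fix v
    note lin = linear_add[OF linear_proj] linear_cmul[OF linear_proj] linear_add[OF linear_turn] linear_cmul[OF linear_turn]
    have "\<kappa> * (R\<^sup>2 - (norm (x - q))\<^sup>2) = \<theta> x" by (simp add: \<theta>_def power2_norm_eq_inner)
    then show "v + ((cos (\<theta> x) - 1) *\<^sub>R proj v + (- sin (\<theta> x) * (- (2 * \<kappa>) * ((x - q) \<bullet> v))) *\<^sub>R proj (x - q))
      + (sin (\<theta> x) *\<^sub>R turn v + (cos (\<theta> x) * (- (2 * \<kappa>) * ((x - q) \<bullet> v))) *\<^sub>R turn (x - q)) = dtwist q R \<kappa> x v"
      unfolding dtwist_def rot_def lin proj_turn turn_turn
      by (simp add: scaleR_diff_left scaleR_add_right scaleR_diff_right)
        (simp add: algebra_simps)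
  qed
  finally have "(T has_derivative dtwist q R \<kappa> x) (at x)" .
  then show ?thesis
  proof (rule has_derivative_transform_within_open[OF _ open_ball x])
    fix y assume "y \<in> ball q R"
    then have "norm (y - q) < R" by (simp add: dist_norm norm_minus_commute)
    then have "(norm (y - q))\<^sup>2 \<le> R\<^sup>2" by (simp add: power_mono)
    then have "angle q R \<kappa> y = \<theta> y" by (simp add: angle_def \<theta>_def power2_norm_eq_inner max_def)
    then show "T y = twist q R \<kappa> y" by (simp add: T_def twist_def rot_def)
  qed
qed

lemma abs_det_dtwist: "\<bar>det (matrix (dtwist q R \<kappa> x))\<bar> = 1"
proof -
  define \<theta> where "\<theta> = \<kappa> * (R\<^sup>2 - (norm (x - q))\<^sup>2)"
  define L where "L = (\<lambda>v. v + ((x - q) \<bullet> v) *\<^sub>R (- (2 * \<kappa>)) *\<^sub>R turn (x - q))"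
  have "dtwist q R \<kappa> x = rot \<theta> \<circ> L" by (simp add: fun_eq_iff dtwist_def \<theta>_def L_def)
  moreover have "linear L" unfolding L_def by (auto intro!: linearI simp: inner_add_right algebra_simps)
  ultimately have "det (matrix (dtwist q R \<kappa> x)) = det (matrix (rot \<theta>)) * det (matrix L)"
    using matrix_compose[OF _ linear_rot[of \<theta>], of L] by (simp add: det_mul)
  moreover have "\<bar>det (matrix (rot \<theta>))\<bar> = 1"
    by (rule orthogonal_transformation_det) (simp add: orthogonal_transformation linear_rot)
  moreover have "\<bar>det (matrix L)\<bar> = 1"
    unfolding L_def by (rule abs_det_transvection) (simp add: inner_turn)
  ultimately show ?thesis by (simp add: abs_mult)
qed

text \<open>Inside the open ball the Jacobian has absolute value 1, and on the complement the twist
  is the identity. The bounding sphere, where the angle has a kink, falls into the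
  complement.\<close>

lemma emeasure_twist_image:
  assumes R: "R \<ge> 0" and B: "B \<in> sets borel"
  shows "emeasure lborel (twist q R \<kappa> ` B) = emeasure lborel B" "twist q R \<kappa> ` B \<in> sets borel"
proof -
  have vi: "twist q R \<kappa> ` S = twist q R (- \<kappa>) -` S" for S
    by (auto simp: twist_comp image_iff intro!: bexI[of _ "twist q R (- \<kappa>) _"])
  have m: "twist q R (- \<kappa>) \<in> borel_measurable borel"
    by (intro borel_measurable_continuous_onI continuous_on_twist continuous_on_const continuous_on_id)
  have meas: "twist q R \<kappa> ` S \<in> sets borel" if "S \<in> sets borel" for S
    using measurable_sets[OF m that] by (simp add: vi)
  then show "twist q R \<kappa> ` B \<in> sets borel" using B by blast
  let ?U = "ball q R"
  have U: "B \<inter> ?U \<in> sets borel" "B - ?U \<in> sets borel" using B by auto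
  have "emeasure lborel (twist q R \<kappa> ` (B \<inter> ?U)) = (\<integral>\<^sup>+x\<in>B \<inter> ?U. ennreal \<bar>det (matrix (dtwist q R \<kappa> x))\<bar> \<partial>lborel)"
  proof (rule emeasure_differentiable_image[where U = ?U])
    show "inj_on (twist q R \<kappa>) ?U" using inj_twist by (rule inj_on_subset) simp
    show "continuous_on ?U (\<lambda>x. det (matrix (dtwist q R \<kappa> x)))"
    proof (rule continuous_on_det_matrix)
      fix i j
      have "continuous_on ?U (\<lambda>x. dtwist q R \<kappa> x (axis j 1))"
        unfolding dtwist_def turn_def by (intro continuous_on_rot continuous_intros)
      then show "continuous_on ?U (\<lambda>x. matrix (dtwist q R \<kappa> x) $ i $ j)"
        by (simp add: matrix_def continuous_on_component)
    qed
  qed (use U twist_has_derivative in auto)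
  also have "\<dots> = emeasure lborel (B \<inter> ?U)" by (simp only: abs_det_dtwist) (use U in simp)
  finally have 1: "emeasure lborel (twist q R \<kappa> ` (B \<inter> ?U)) = emeasure lborel (B \<inter> ?U)" .
  have 2: "twist q R \<kappa> ` (B - ?U) = B - ?U"
    using twist_outside[OF R] by (simp cong: image_cong_simp)
  have split: "emeasure lborel (S \<union> T) = emeasure lborel S + emeasure lborel T"
    if "S \<in> sets borel" "T \<in> sets borel" "S \<inter> T = {}" for S T :: "(real ^ 'n) set"
    using that by (intro plus_emeasure[symmetric]) auto
  have "twist q R \<kappa> ` B = twist q R \<kappa> ` (B \<inter> ?U) \<union> (B - ?U)"
    using 2 by (metis Int_Diff_Un image_Un)
  moreover have "twist q R \<kappa> ` (B \<inter> ?U) \<inter> (B - ?U) = {}" by (auto simp: twist_ball simp del: mem_ball)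
  ultimately have "emeasure lborel (twist q R \<kappa> ` B) = emeasure lborel (twist q R \<kappa> ` (B \<inter> ?U)) + emeasure lborel (B - ?U)"
    using split[OF meas[OF U(1)] U(2)] by simp
  also have "\<dots> = emeasure lborel ((B \<inter> ?U) \<union> (B - ?U))" unfolding 1 by (rule split[OF U, symmetric]) auto
  finally show "emeasure lborel (twist q R \<kappa> ` B) = emeasure lborel B" by (simp add: Int_Diff_Un)
qed

end

text \<open>Here dimension at least 2 enters: the line through \<open>e\<close> is not the whole
  space, so it has an orthogonal direction.\<close>

lemma plane_exists:
  fixes e :: "real ^ 'n::finite"
  assumes n: "CARD('n) \<ge> 2" and e: "norm e = 1"
  obtains f where "plane e f"
proof -
  have "DIM(real ^ 'n) \<ge> 2" using n by simp
  moreover have "dim {e} \<le> 1" using dim_le_card'[of "{e}"] by simp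
  ultimately have "dim {e} < DIM(real ^ 'n)" by linarith
  then obtain f where "f \<noteq> 0" "\<And>y. y \<in> span {e} \<Longrightarrow> orthogonal f y"
    by (rule orthogonal_to_subspace_exists) blast
  then have f: "f \<noteq> 0" "orthogonal e f" by (auto simp: orthogonal_commute span_base)
  show thesis
    by (rule that[of "(1 / norm f) *\<^sub>R f"]) (unfold_locales, use e f in
      \<open>auto simp: orthogonal_def norm_eq_1 power2_norm_eq_inner[symmetric] power2_eq_square\<close>)
qed

text \<open>The half turn in the plane spanned by \<open>w' - w\<close> and \<open>f\<close> exchanges \<open>w\<close> and \<open>w'\<close>.\<close>

lemma twist_moves:
  fixes w w' :: "real ^ 'n::finite"
  assumes n: "CARD('n) \<ge> 2" and R: "norm (w' - w) / 2 < R"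
  obtains e f \<kappa> where "plane e f" "plane.twist e f ((1/2) *\<^sub>R (w + w')) R \<kappa> w = w'"
proof (cases "w = w'")
  case True
  \<comment> \<open>There is no direction \<open>w' - w\<close> to normalise; any plane will do with
    parameter 0.\<close>
  have "norm (axis (undefined :: 'n) (1 :: real)) = 1" by (rule norm_axis_1)
  then obtain f where f: "plane (axis undefined 1) (f :: real ^ 'n)" by (rule plane_exists[OF n])
  show thesis by (rule that[OF f, of 0]) (simp add: plane.twist_0[OF f] True)
next
  case False
  define e where "e = (1 / norm (w' - w)) *\<^sub>R (w' - w)"
  have ne: "norm e = 1" using False by (simp add: e_def)
  obtain f where f: "plane e f" by (rule plane_exists[OF n ne])
  interpret plane e f by (rule f)
  define q where "q = (1/2) *\<^sub>R (w + w')"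
  define s where "s = norm (w' - w) / 2"
  have "s *\<^sub>R e = (1/2) *\<^sub>R (w' - w)" using False by (simp add: s_def e_def)
  then have wq: "w - q = - s *\<^sub>R e" and w'q: "w' = q + s *\<^sub>R e"
    by (simp_all add: q_def vec_eq_iff) (simp_all add: field_simps)
  have s: "0 \<le> s" "s < R" using R by (auto simp: s_def)
  then have pos: "R\<^sup>2 - s\<^sup>2 > 0" by (simp add: power_strict_mono)
  \<comment> \<open>Both points have distance \<open>s\<close> from the midpoint \<open>q\<close>,
    and this value makes the angle at that distance equal to \<open>pi\<close>.\<close>
  define \<kappa> where "\<kappa> = pi / (R\<^sup>2 - s\<^sup>2)"
  have "norm (w - q) = s" using wq ne s by simp
  then have "angle q R \<kappa> w = pi" using pos by (simp add: angle_def \<kappa>_def max_def)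
  then have "twist q R \<kappa> w = q + rot pi (w - q)" by (simp add: twist_def)
  also have "\<dots> = w'" unfolding wq w'q by (simp add: rot_def proj_def turn_def vec_eq_iff)
  finally show thesis using that[OF f] by (simp add: q_def)
qed

section \<open>Straightening a density\<close>

text \<open>Replacing the coordinate \<open>x\<^sub>k\<close> by the integral of \<open>\<rho>\<close> along the \<open>k\<close>-th direction turns the
  measure with density \<open>\<rho>\<close> into Lebesgue measure.\<close>

lemma straighten_density:
  fixes \<rho> :: "real ^ 'n::finite \<Rightarrow> real" and x0 :: "real ^ 'n"
  assumes D: "\<And>x. x \<in> ball x0 r \<Longrightarrow> (\<rho> has_derivative D x) (at x)"
    and contD: "\<And>v. continuous_on (ball x0 r) (\<lambda>x. D x v)"
    and pos: "\<And>x. x \<in> ball x0 r \<Longrightarrow> \<rho> x > 0"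
  obtains \<Phi> :: "real ^ 'n \<Rightarrow> real ^ 'n" where "continuous_on (ball x0 r) \<Phi>" "inj_on \<Phi> (ball x0 r)"
    "\<And>S. S \<in> sets borel \<Longrightarrow> S \<subseteq> ball x0 r \<Longrightarrow> emeasure lborel (\<Phi> ` S) = (\<integral>\<^sup>+x\<in>S. ennreal (\<rho> x) \<partial>lborel)"
proof -
  define k where "k = (undefined :: 'n)"
  define e where "e = (axis k 1 :: real ^ 'n)"
  have ek: "e $ k = 1" "i \<noteq> k \<Longrightarrow> e $ i = 0" for i by (simp_all add: e_def axis_def)
  let ?B = "ball x0 r"
  \<comment> \<open>Coordinate \<open>k\<close> moves from its value at \<open>x0\<close> (for
    \<open>t = 0\<close>) to its value at \<open>x\<close> (for \<open>t = 1\<close>). No component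
    gets farther from that of \<open>x0\<close> than it is at \<open>x\<close>, so the point stays
    in the ball.\<close>
  define p where "p = (\<lambda>x (t::real). x - ((1 - t) * (x $ k - x0 $ k)) *\<^sub>R e)"
  have p: "p x t \<in> ?B" if "x \<in> ?B" "t \<in> {0..1}" for x t
  proof -
    have "norm (p x t - x0) \<le> norm (x - x0)"
    proof (rule norm_le_componentwise_cart)
      fix i
      show "norm ((p x t - x0) $ i) \<le> norm ((x - x0) $ i)"
      proof (cases "i = k")
        case True
        have "(p x t - x0) $ k = t * (x $ k - x0 $ k)" by (simp add: p_def ek algebra_simps)
        then show ?thesis using that(2) True by (simp add: abs_mult mult_left_le_one_le)
      qed (simp add: p_def ek)
    qed
    then show ?thesis using that(1) by (simp add: dist_norm norm_minus_commute)
  qed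
  have cont\<rho>: "continuous_on ?B \<rho>"
    by (rule continuous_at_imp_continuous_on) (use D has_derivative_continuous in blast)
  \<comment> \<open>Integrated over \<open>t\<close>, this is the integral of \<open>\<rho>\<close>
    in direction \<open>k\<close> from \<open>x0 $ k\<close> to \<open>x $ k\<close>, rescaled to a
    fixed interval so that differentiation under the integral applies.\<close>
  define f where "f = (\<lambda>x t. (x $ k - x0 $ k) * \<rho> (p x t))"
  define f' where "f' = (\<lambda>x t v. v $ k * \<rho> (p x t) + (x $ k - x0 $ k) * D (p x t) (v - ((1 - t) * v $ k) *\<^sub>R e))"
  have df: "((\<lambda>x. f x t) has_derivative f' x t) (at x)" if x: "x \<in> ?B" and t: "t \<in> {0..1}" for x t
  proof -
    have "((\<lambda>x. p x t) has_derivative (\<lambda>v. v - ((1 - t) * v $ k) *\<^sub>R e)) (at x)"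
      unfolding p_def by (auto intro!: derivative_eq_intros bounded_linear.has_derivative[OF bounded_linear_vec_nth])
    from has_derivative_compose[OF this D[OF p[OF x t]]]
    have 1: "((\<lambda>x. \<rho> (p x t)) has_derivative (\<lambda>v. D (p x t) (v - ((1 - t) * v $ k) *\<^sub>R e))) (at x)" .
    have 2: "((\<lambda>x. x $ k - x0 $ k) has_derivative (\<lambda>v. v $ k)) (at x)"
      by (auto intro!: derivative_eq_intros bounded_linear.has_derivative[OF bounded_linear_vec_nth])
    show ?thesis
      unfolding f_def f'_def using has_derivative_mult[OF 2 1] by (simp add: add.commute)
  qed
  define fx where "fx = (\<lambda>x t. Blinfun (f' x t))"
  have fx: "blinfun_apply (fx x t) = f' x t" if "x \<in> ?B" "t \<in> {0..1}" for x t
    unfolding fx_def by (rule bounded_linear_Blinfun_apply[OF has_derivative_bounded_linear[OF df[OF that]]])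
  have cp: "continuous_on (?B \<times> cbox 0 1) (\<lambda>z. p (fst z) (snd z))"
    unfolding p_def by (intro continuous_intros)
  have pB: "p (fst z) (snd z) \<in> ?B" if "z \<in> ?B \<times> cbox 0 1" for z
    using p[of "fst z" "snd z"] that by (auto simp: mem_Times_iff)
  have Dlin: "D y (v - a *\<^sub>R w) = D y v - a * D y w" if "y \<in> ?B" for y v a w
    using has_derivative_linear[OF D[OF that]] by (simp add: linear_diff linear_cmul)
  have cfx: "continuous_on (?B \<times> cbox 0 1) (\<lambda>z. fx (fst z) (snd z))"
  proof (rule continuous_on_blinfun_componentwise)
    fix v :: "real ^ 'n"
    have cD: "continuous_on (?B \<times> cbox 0 1) (\<lambda>z. D (p (fst z) (snd z)) w)" for w
      by (rule continuous_on_compose2[OF contD cp]) (use pB in blast)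
    have c\<rho>: "continuous_on (?B \<times> cbox 0 1) (\<lambda>z. \<rho> (p (fst z) (snd z)))"
      by (rule continuous_on_compose2[OF cont\<rho> cp]) (use pB in blast)
    have "continuous_on (?B \<times> cbox 0 1) (\<lambda>z. v $ k * \<rho> (p (fst z) (snd z)) + (fst z $ k - x0 $ k) *
        (D (p (fst z) (snd z)) v - ((1 - snd z) * v $ k) * D (p (fst z) (snd z)) e))"
      by (intro continuous_intros cD c\<rho>)
    then show "continuous_on (?B \<times> cbox 0 1) (\<lambda>z. blinfun_apply (fx (fst z) (snd z)) v)"
    proof (rule continuous_on_eq)
      fix z assume z: "z \<in> ?B \<times> cbox (0::real) 1"
      then have "fst z \<in> ?B" "snd z \<in> {0..1}" by (auto simp: mem_Times_iff)
      then show "v $ k * \<rho> (p (fst z) (snd z)) + (fst z $ k - x0 $ k) *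
        (D (p (fst z) (snd z)) v - ((1 - snd z) * v $ k) * D (p (fst z) (snd z)) e)
        = blinfun_apply (fx (fst z) (snd z)) v"
        by (simp only: fx f'_def Dlin[OF pB[OF z]])
    qed
  qed
  define \<Psi> where "\<Psi> = (\<lambda>x. integral (cbox 0 1) (f x))"
  define \<Psi>' where "\<Psi>' = (\<lambda>x. integral (cbox 0 1) (fx x))"
  have d\<Psi>: "(\<Psi> has_derivative blinfun_apply (\<Psi>' x)) (at x)" if x: "x \<in> ?B" for x
  proof -
    have "(\<Psi> has_derivative blinfun_apply (\<Psi>' x)) (at x within ?B)"
      unfolding \<Psi>_def \<Psi>'_def
    proof (rule leibniz_rule[OF _ _ _ x convex_ball])
      fix y and t :: real assume y: "y \<in> ?B" and t: "t \<in> cbox 0 1"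
      then have "t \<in> {0..1}" by simp
      from df[OF y this] show "((\<lambda>y. f y t) has_derivative blinfun_apply (fx y t)) (at y within ?B)"
        by (simp only: fx[OF y \<open>t \<in> {0..1}\<close>] has_derivative_at_withinI)
    next
      fix y assume y: "y \<in> ?B"
      have "continuous_on (cbox 0 1) (p y)" unfolding p_def by (intro continuous_intros)
      then have "continuous_on (cbox 0 1) (\<lambda>t. \<rho> (p y t))"
        by (rule continuous_on_compose2[OF cont\<rho>]) (use p y in auto)
      then have "continuous_on (cbox 0 1) (f y)" unfolding f_def by (intro continuous_intros)
      then show "f y integrable_on cbox 0 1" by (rule integrable_continuous)
    next
      show "continuous_on (?B \<times> cbox 0 1) (\<lambda>(x, t). fx x t)" unfolding split_beta by (rule cfx)
    qed
    then show ?thesis by (simp only: at_within_open[OF x open_ball])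
  qed
  \<comment> \<open>Of the gradient of \<open>\<Psi>\<close> only the component along
    \<open>e\<close> enters the determinant; its integrand is d/dt of
    \<open>t * \<rho> (p x t)\<close>.\<close>
  have \<Psi>'e: "blinfun_apply (\<Psi>' x) e = \<rho> x" if x: "x \<in> ?B" for x
  proof -
    have cfxx: "continuous_on (cbox 0 1) (fx x)"
      using continuous_on_compose2[OF cfx, of "cbox 0 1" "\<lambda>t. (x, t)"] x
      by (simp add: continuous_on_Pair continuous_on_const image_subset_iff)
    have "((\<lambda>t. blinfun_apply (fx x t) e) has_integral blinfun_apply (\<Psi>' x) e) (cbox 0 1)"
      unfolding \<Psi>'_def
      using has_integral_linear[OF integrable_integral[OF integrable_continuous[OF cfxx]] blinfun.bounded_linear_left[of e]]
      by (simp add: o_def)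
    moreover have "((\<lambda>t. blinfun_apply (fx x t) e) has_integral (1 * \<rho> (p x 1) - 0 * \<rho> (p x 0))) {0..1}"
    proof (rule fundamental_theorem_of_calculus)
      fix t :: real assume t: "t \<in> {0..1}"
      have "((p x) has_derivative (\<lambda>s. s *\<^sub>R (x $ k - x0 $ k) *\<^sub>R e)) (at t within {0..1})"
        unfolding p_def by (auto intro!: derivative_eq_intros)
      from has_derivative_compose[OF this D[OF p[OF x t]]]
      have "((\<lambda>t. \<rho> (p x t)) has_derivative (\<lambda>s. D (p x t) (s *\<^sub>R (x $ k - x0 $ k) *\<^sub>R e))) (at t within {0..1})" .
      moreover have "D (p x t) (s *\<^sub>R (x $ k - x0 $ k) *\<^sub>R e) = s *\<^sub>R ((x $ k - x0 $ k) * D (p x t) e)" for s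
        using has_derivative_linear[OF D[OF p[OF x t]]] by (simp add: linear_cmul)
      ultimately have "((\<lambda>t. \<rho> (p x t)) has_vector_derivative ((x $ k - x0 $ k) * D (p x t) e)) (at t within {0..1})"
        by (simp add: has_vector_derivative_def)
      from has_vector_derivative_mult[OF has_vector_derivative_id this]
      have "((\<lambda>t. t * \<rho> (p x t)) has_vector_derivative t * ((x $ k - x0 $ k) * D (p x t) e) + 1 * \<rho> (p x t)) (at t within {0..1})"
        by simp
      moreover have "blinfun_apply (fx x t) e = t * ((x $ k - x0 $ k) * D (p x t) e) + 1 * \<rho> (p x t)"
        using Dlin[OF p[OF x t], of e "1 - t" e] by (simp add: fx[OF x t] f'_def ek algebra_simps)
      ultimately show "((\<lambda>t. t * \<rho> (p x t)) has_vector_derivative blinfun_apply (fx x t) e) (at t within {0..1})"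
        by (simp only:)
    qed simp
    ultimately show ?thesis by (simp add: p_def has_integral_unique)
  qed
  define \<Phi> where "\<Phi> = (\<lambda>x. x + (\<Psi> x - x $ k) *\<^sub>R e)"
  define \<Phi>' where "\<Phi>' = (\<lambda>x v. v + (blinfun_apply (\<Psi>' x) v - v $ k) *\<^sub>R e)"
  have d\<Phi>: "(\<Phi> has_derivative \<Phi>' x) (at x)" if "x \<in> ?B" for x
    unfolding \<Phi>_def \<Phi>'_def
    by (auto intro!: derivative_eq_intros d\<Psi>[OF that] bounded_linear.has_derivative[OF bounded_linear_vec_nth])
  \<comment> \<open>The Jacobian matrix is the identity with row \<open>k\<close> replaced by the
    gradient of \<open>\<Psi>\<close>, so its determinant is entry \<open>k\<close> of that
    gradient.\<close>
  have det\<Phi>: "det (matrix (\<Phi>' x)) = \<rho> x" if x: "x \<in> ?B" for x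
  proof -
    define g where "g = (\<chi> j. blinfun_apply (\<Psi>' x) (axis j 1))"
    have "(\<Sum>i\<in>UNIV. g $ i *s row i (mat 1 :: real ^ 'n ^ 'n)) = g"
      by (simp add: vec_eq_iff row_def mat_def if_distrib[of "\<lambda>u. _ * u"] sum.delta cong: if_cong)
    then have "matrix (\<Phi>' x) = (\<chi> i. if i = k then (\<Sum>i\<in>UNIV. g $ i *s row i (mat 1 :: real ^ 'n ^ 'n)) else row i (mat 1))"
      by (auto simp: vec_eq_iff matrix_def \<Phi>'_def g_def row_def mat_def ek axis_def)
    then have "det (matrix (\<Phi>' x)) = g $ k * det (mat 1 :: real ^ 'n ^ 'n)"
      by (simp only: cramer_lemma_transpose)
    then show ?thesis using \<Psi>'e[OF x] by (simp add: g_def e_def)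
  qed
  \<comment> \<open>Points with equal image differ only in coordinate \<open>k\<close>; by the mean
    value theorem, the positive derivative \<open>\<rho>\<close> in that direction forbids equal
    values of \<open>\<Psi>\<close> at distinct points.\<close>
  have inj: "inj_on \<Phi> ?B"
  proof (rule inj_onI, rule ccontr)
    fix x y assume xy: "x \<in> ?B" "y \<in> ?B" "\<Phi> x = \<Phi> y" "x \<noteq> y"
    have off: "x $ i = y $ i" if "i \<noteq> k" for i
      using arg_cong[OF xy(3), of "\<lambda>z. z $ i"] that by (simp add: \<Phi>_def ek)
    have \<Psi>eq: "\<Psi> x = \<Psi> y"
      using arg_cong[OF xy(3), of "\<lambda>z. z $ k"] by (simp add: \<Phi>_def ek)
    define d where "d = x $ k - y $ k"
    have xyd: "x = y + d *\<^sub>R e" using off by (auto simp: vec_eq_iff d_def) (metis add_diff_cancel_left' diff_add_cancel ek mult.right_neutral mult_zero_right add.right_neutral)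
    have "d \<noteq> 0" using xyd xy(4) by auto
    have seg: "y + s *\<^sub>R (d *\<^sub>R e) \<in> ?B" if "0 \<le> s" "s \<le> 1" for s
    proof -
      have "y + s *\<^sub>R (d *\<^sub>R e) = (1 - s) *\<^sub>R y + s *\<^sub>R x" by (simp add: xyd algebra_simps)
      then show ?thesis using convexD_alt[OF convex_ball xy(2,1) that] by simp
    qed
    have "\<exists>s\<in>{0..1}. \<Psi> (y + 1 *\<^sub>R (d *\<^sub>R e)) - \<Psi> (y + 0 *\<^sub>R (d *\<^sub>R e))
        = blinfun_apply (\<Psi>' (y + s *\<^sub>R (d *\<^sub>R e))) ((1 - 0) *\<^sub>R (d *\<^sub>R e))"
    proof (rule mvt_very_simple[of 0 1 "\<lambda>s. \<Psi> (y + s *\<^sub>R (d *\<^sub>R e))" "\<lambda>s h. blinfun_apply (\<Psi>' (y + s *\<^sub>R (d *\<^sub>R e))) (h *\<^sub>R (d *\<^sub>R e))"])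
      fix s :: real assume s: "0 \<le> s" "s \<le> 1"
      show "((\<lambda>s. \<Psi> (y + s *\<^sub>R (d *\<^sub>R e))) has_derivative
          (\<lambda>h. blinfun_apply (\<Psi>' (y + s *\<^sub>R (d *\<^sub>R e))) (h *\<^sub>R (d *\<^sub>R e)))) (at s within {0..1})"
        by (rule has_derivative_compose[of "\<lambda>s. y + s *\<^sub>R (d *\<^sub>R e)" "\<lambda>h. h *\<^sub>R (d *\<^sub>R e)" s "{0..1}" \<Psi>, OF _ d\<Psi>[OF seg[OF s]]])
          (auto intro!: derivative_eq_intros)
    qed simp
    then obtain s where s: "s \<in> {0..1}" "\<Psi> x - \<Psi> y = d * \<rho> (y + s *\<^sub>R (d *\<^sub>R e))"
      using \<Psi>'e[OF seg] by (auto simp: xyd blinfun.scaleR_right)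
    then have "\<rho> (y + s *\<^sub>R (d *\<^sub>R e)) = 0" using \<open>d \<noteq> 0\<close> \<Psi>eq by simp
    then show False using pos[OF seg[of s]] s(1) by simp
  qed
  show thesis
  proof (rule that)
    show "continuous_on ?B \<Phi>"
      by (rule continuous_at_imp_continuous_on) (use d\<Phi> has_derivative_continuous in blast)
    show "inj_on \<Phi> ?B" by (rule inj)
    fix S assume S: "S \<in> sets borel" "S \<subseteq> ?B"
    have "continuous_on ?B (\<lambda>x. det (matrix (\<Phi>' x)))"
      using cont\<rho> by (rule continuous_on_eq) (simp add: det\<Phi>)
    then have "emeasure lborel (\<Phi> ` S) = (\<integral>\<^sup>+x\<in>S. ennreal \<bar>det (matrix (\<Phi>' x))\<bar> \<partial>lborel)"
      by (intro emeasure_differentiable_image[OF open_ball d\<Phi> inj _ S]) auto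
    also have "\<dots> = (\<integral>\<^sup>+x\<in>S. ennreal (\<rho> x) \<partial>lborel)"
    proof (rule nn_integral_cong)
      fix x
      show "ennreal \<bar>det (matrix (\<Phi>' x))\<bar> * indicator S x = ennreal (\<rho> x) * indicator S x"
        using S(2) det\<Phi>[of x] pos[of x] by (cases "x \<in> S") auto
    qed
    finally show "emeasure lborel (\<Phi> ` S) = (\<integral>\<^sup>+x\<in>S. ennreal (\<rho> x) \<partial>lborel)" .
  qed
qed

context volume_manifold
begin

text \<open>The chart followed by the straightening map. Only a homeomorphism that carries
  \<open>\<mu>\<close> to Lebesgue measure is asked for; invariance of domain supplies the open
  image and the continuous inverse.\<close>

lemma straight_chart:
  assumes c: "c \<in> A" and r: "r > 0" and B: "ball x0 r \<subseteq> cimg c"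
  defines "U \<equiv> cinv c ` ball x0 r"
  obtains k :: "'m \<Rightarrow> real ^ 'n" and W m where "open W" "homeomorphism U W k m"
    "\<And>S. S \<in> sets borel \<Longrightarrow> S \<subseteq> U \<Longrightarrow> emeasure \<mu> S = emeasure lborel (k ` S)"
proof -
  have sm: "smooth_on (\<Omega> c) (cimg c)" and pos: "\<And>x. x \<in> cimg c \<Longrightarrow> \<Omega> c x > 0"
    using volume_form c unfolding volume_form_def by blast+
  obtain \<Phi> :: "real ^ 'n \<Rightarrow> real ^ 'n" where \<Phi>: "continuous_on (ball x0 r) \<Phi>" "inj_on \<Phi> (ball x0 r)"
    "\<And>S. S \<in> sets borel \<Longrightarrow> S \<subseteq> ball x0 r \<Longrightarrow> emeasure lborel (\<Phi> ` S) = (\<integral>\<^sup>+x\<in>S. ennreal (\<Omega> c x) \<partial>lborel)"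
  proof (rule straighten_density[of x0 r "\<Omega> c" "\<lambda>x. frechet_derivative (\<Omega> c) (at x)"])
    show "(\<Omega> c has_derivative frechet_derivative (\<Omega> c) (at x)) (at x)" if "x \<in> ball x0 r" for x
      using smooth_on_has_derivative[OF sm] that B by blast
    show "continuous_on (ball x0 r) (\<lambda>x. frechet_derivative (\<Omega> c) (at x) v)" for v
      using smooth_on_continuous_derivative[OF sm] B continuous_on_subset by blast
    show "\<Omega> c x > 0" if "x \<in> ball x0 r" for x using pos that B by blast
  qed blast
  obtain \<Phi>i where \<Phi>i: "homeomorphism (ball x0 r) (\<Phi> ` ball x0 r) \<Phi> \<Phi>i"
    using invariance_of_domain_homeomorphism[OF open_ball \<Phi>(1) order_refl \<Phi>(2)] by blast
  have "homeomorphism U (ball x0 r) (cmap c) (cinv c)"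
    by (rule homeomorphism_of_subsets[OF chart_homeomorphism[OF c]])
      (use chart_ball_open(2,3)[OF c B] B in \<open>auto simp: U_def\<close>)
  from homeomorphism_compose[OF this \<Phi>i]
  have "homeomorphism U (\<Phi> ` ball x0 r) (\<Phi> \<circ> cmap c) (cinv c \<circ> \<Phi>i)" .
  moreover have "open (\<Phi> ` ball x0 r)" by (rule invariance_of_domain[OF \<Phi>(1) open_ball \<Phi>(2)])
  moreover have "emeasure \<mu> S = emeasure lborel ((\<Phi> \<circ> cmap c) ` S)" if S: "S \<in> sets borel" "S \<subseteq> U" for S
  proof -
    have Sc: "S \<subseteq> cdom c" using S(2) chart_ball_open(2)[OF c B] unfolding U_def by blast
    have "cmap c ` S \<subseteq> ball x0 r" using S(2) chart_ball_open(3)[OF c B] unfolding U_def by blast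
    from \<Phi>(3)[OF chart_image_borel[OF c S(1) Sc] this] show ?thesis
      unfolding \<mu>_def image_comp[symmetric] by (simp add: density_measure(2)[OF compatible_volume c S(1) Sc])
  qed
  ultimately show thesis using that by blast
qed

end

section \<open>Local twists and injectivity\<close>

context volume_manifold
begin

text \<open>The transplanted twists depend jointly continuously on the parameter and the point.
  Hence they form a connected set of volume preserving homeomorphisms, which contains the identity
  at parameter 0.\<close>

lemma local_twist_in_G:
  fixes k :: "'m \<Rightarrow> real ^ 'n"
  assumes hom: "homeomorphism U W k m" and UW: "open U" "open W"
    and vol: "\<And>S. S \<in> sets borel \<Longrightarrow> S \<subseteq> U \<Longrightarrow> emeasure \<mu> S = emeasure lborel (k ` S)"
    and pl: "plane e f" and R: "R > 0" and sub: "cball q R \<subseteq> W"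
  defines "h \<equiv> \<lambda>\<kappa> z. if z \<in> U then m (plane.twist e f q R \<kappa> (k z)) else z"
  shows "h \<kappa> \<in> G"
proof -
  interpret plane e f by (rule pl)
  have km: "k (m y) = y" "m y \<in> U" if "y \<in> W" for y
    using hom that by (auto simp: homeomorphism_def)
  have mk: "m (k z) = z" "k z \<in> W" if "z \<in> U" for z
    using hom that by (auto simp: homeomorphism_def)
  have tW: "twist q R \<kappa> y \<in> W" if "y \<in> W" for \<kappa> y
  proof (cases "y \<in> ball q R")
    case True
    then have "twist q R \<kappa> y \<in> ball q R" by (simp only: twist_ball)
    then show ?thesis using sub ball_subset_cball by blast
  next
    case False
    then have "twist q R \<kappa> y = y" using R by (intro twist_outside) simp_all
    then show ?thesis using that by simp
  qed
  have h_U: "h \<kappa> z \<in> U" "k (h \<kappa> z) = twist q R \<kappa> (k z)" if "z \<in> U" for \<kappa> z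
    using that km[OF tW[OF mk(2)[OF that]]] by (simp_all add: h_def)
  have h_comp: "h \<kappa> (h \<kappa>' z) = h (\<kappa> + \<kappa>') z" for \<kappa> \<kappa>' z
  proof (cases "z \<in> U")
    case True
    have "h \<kappa> (h \<kappa>' z) = m (twist q R \<kappa> (k (h \<kappa>' z)))"
      using h_U(1)[OF True, of \<kappa>'] by (subst h_def) (simp only: if_True)
    also have "\<dots> = m (twist q R \<kappa> (twist q R \<kappa>' (k z)))" by (simp only: h_U(2)[OF True])
    finally show ?thesis using True by (simp add: twist_comp h_def)
  qed (simp add: h_def)
  have h_0: "h 0 z = z" for z using mk by (simp add: h_def)
  \<comment> \<open>Nothing moves outside this compact set. So continuity can be checked on the open
    sets \<open>U\<close> and \<open>- K\<close>, which cover the manifold, and the boundary of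
    \<open>U\<close> raises no question.\<close>
  define K where "K = m ` cball q R"
  have "compact K"
    unfolding K_def
    by (rule compact_continuous_image[OF continuous_on_subset[OF homeomorphism_cont2[OF hom] sub] compact_cball])
  then have K: "closed K" by (rule compact_imp_closed)
  have KU: "K \<subseteq> U" unfolding K_def using km(2) sub by blast
  have h_out: "h \<kappa> z = z" if "z \<notin> K" for \<kappa> z
  proof (cases "z \<in> U")
    case True
    have "k z \<notin> cball q R" using that mk(1)[OF True] unfolding K_def by (metis imageI)
    then have "twist q R \<kappa> (k z) = k z" using twist_outside[of R "k z" q \<kappa>] R by simp
    then show ?thesis using mk(1)[OF True] True by (simp add: h_def)
  qed (simp add: h_def)
  have cont: "continuous_on UNIV (\<lambda>z. h (fst z) (snd z))"
  proof -
    have 1: "continuous_on (UNIV \<times> U) (\<lambda>z. h (fst z) (snd z))"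
    proof -
      have "continuous_on (UNIV \<times> U) (\<lambda>z :: real \<times> 'm. twist q R (fst z) (k (snd z)))"
        by (intro continuous_on_twist continuous_on_fst continuous_on_id
          continuous_on_compose2[OF homeomorphism_cont1[OF hom] continuous_on_snd[OF continuous_on_id]]) auto
      then have "continuous_on (UNIV \<times> U) (\<lambda>z. m (twist q R (fst z) (k (snd z))))"
        by (rule continuous_on_compose2[OF homeomorphism_cont2[OF hom]]) (use tW mk(2) in auto)
      then show ?thesis by (rule continuous_on_eq) (auto simp: h_def)
    qed
    have 2: "continuous_on (UNIV \<times> (- K)) (\<lambda>z. h (fst z) (snd z))"
      by (rule continuous_on_eq[OF continuous_on_snd[OF continuous_on_id]]) (auto simp: h_out)
    have "continuous_on (UNIV \<times> U \<union> UNIV \<times> (- K)) (\<lambda>z. h (fst z) (snd z))"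
      using K by (intro continuous_on_open_Un open_Times 1 2 UW) auto
    moreover have "UNIV \<times> U \<union> UNIV \<times> (- K) = (UNIV :: (real \<times> 'm) set)" using KU by auto
    ultimately show ?thesis by simp
  qed
  have hc: "continuous_on UNIV (h \<kappa>)" for \<kappa>
    using continuous_on_compose2[OF cont, of UNIV "\<lambda>z. (\<kappa>, z)"]
    by (simp add: continuous_on_Pair continuous_on_const)
  have homeo: "homeomorphism UNIV UNIV (h \<kappa>) (h (- \<kappa>))" for \<kappa>
    by (rule homeomorphismI) (auto simp: hc h_comp h_0)
  have "distr \<mu> \<mu> (h \<kappa>) = \<mu>" for \<kappa>
  proof (rule measure_eqI)
    fix B assume "B \<in> sets (distr \<mu> \<mu> (h \<kappa>))"
    then have B: "B \<in> sets borel" by simp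
    have hm: "h \<kappa> \<in> measurable \<mu> \<mu>" by (rule continuous_measurable[OF hc])
    have hB: "h \<kappa> -` B \<in> sets borel" using measurable_sets[OF hm, of B] B by simp
    have BU: "B \<inter> U \<in> sets borel" "B - U \<in> sets borel" "h \<kappa> -` B \<inter> U \<in> sets borel" using B hB UW(1) by auto
    have kBU: "k ` (B \<inter> U) \<in> sets borel"
      by (rule homeomorphism_image_borel[OF hom]) (use UW BU in auto)
    \<comment> \<open>In straight coordinates the preimage is the image under the inverse twist, to
      which \<open>emeasure_twist_image\<close> applies.\<close>
    have im: "k ` (h \<kappa> -` B \<inter> U) = twist q R (- \<kappa>) ` k ` (B \<inter> U)"
    proof (intro Set.set_eqI iffI)
      fix y assume "y \<in> k ` (h \<kappa> -` B \<inter> U)"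
      then obtain z where z: "z \<in> U" "h \<kappa> z \<in> B" "y = k z" by blast
      then have "y = twist q R (- \<kappa>) (k (h \<kappa> z))" using h_U[OF z(1)] by (simp add: twist_comp)
      then show "y \<in> twist q R (- \<kappa>) ` k ` (B \<inter> U)" using z h_U(1) by blast
    next
      fix y assume "y \<in> twist q R (- \<kappa>) ` k ` (B \<inter> U)"
      then obtain z where z: "z \<in> U" "z \<in> B" "y = twist q R (- \<kappa>) (k z)" by blast
      then have "y = k (h (- \<kappa>) z)" "h (- \<kappa>) z \<in> U" "h \<kappa> (h (- \<kappa>) z) = z"
        using h_U[OF z(1)] by (simp_all add: h_comp h_0)
      then show "y \<in> k ` (h \<kappa> -` B \<inter> U)" using z(2) by auto
    qed
    have "emeasure (distr \<mu> \<mu> (h \<kappa>)) B = emeasure \<mu> (h \<kappa> -` B)"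
      using B by (simp add: emeasure_distr[OF hm])
    also have "h \<kappa> -` B = (h \<kappa> -` B \<inter> U) \<union> (B - U)" by (auto simp: h_def split: if_splits)
    also have "emeasure \<mu> \<dots> = emeasure \<mu> (h \<kappa> -` B \<inter> U) + emeasure \<mu> (B - U)"
      using BU by (intro plus_emeasure[symmetric]) auto
    also have "emeasure \<mu> (h \<kappa> -` B \<inter> U) = emeasure lborel (twist q R (- \<kappa>) ` k ` (B \<inter> U))"
      by (simp only: vol[OF BU(3) Int_lower2] im)
    also have "\<dots> = emeasure lborel (k ` (B \<inter> U))" using R by (intro emeasure_twist_image kBU) simp
    also have "\<dots> = emeasure \<mu> (B \<inter> U)" by (rule vol[OF BU(1) Int_lower2, symmetric])
    also have "emeasure \<mu> (B \<inter> U) + emeasure \<mu> (B - U) = emeasure \<mu> ((B \<inter> U) \<union> (B - U))"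
      using BU by (intro plus_emeasure) auto
    finally show "emeasure (distr \<mu> \<mu> (h \<kappa>)) B = emeasure \<mu> B" by (simp add: Int_Diff_Un)
  qed simp
  then have hv: "h \<kappa> \<in> Homeo_vol A \<Omega>" for \<kappa>
    using homeo unfolding Homeo_vol_def \<mu>_def by blast
  have co: "continuous_map euclideanreal compact_open_topology h"
    unfolding compact_open_topology_def
  proof (rule continuous_on_generated_topo)
    fix V :: "('m \<Rightarrow> 'm) set" assume "V \<in> {{h. h ` K \<subseteq> U} |K U. compact K \<and> open U}"
    then obtain C O' where CO: "V = {h. h ` C \<subseteq> O'}" "compact C" "open O'" by blast
    have "open {\<kappa>. h \<kappa> ` C \<subseteq> O'}"
    proof (subst open_subopen, intro ballI)
      fix \<kappa> assume "\<kappa> \<in> {\<kappa>. h \<kappa> ` C \<subseteq> O'}"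
      then have "{\<kappa>} \<times> C \<subseteq> (\<lambda>z. h (fst z) (snd z)) -` O'" by auto
      \<comment> \<open>Compactness of \<open>C\<close> turns joint continuity into openness in the
        parameter.\<close>
      from Elementary_Topology.tube_lemma[OF CO(2) open_vimage[OF CO(3) cont] this]
      obtain X where X: "\<kappa> \<in> X" "open X" "X \<times> C \<subseteq> (\<lambda>z. h (fst z) (snd z)) -` O'" by blast
      have "X \<subseteq> {\<kappa>. h \<kappa> ` C \<subseteq> O'}" using X(3) by auto
      then show "\<exists>T. open T \<and> \<kappa> \<in> T \<and> T \<subseteq> {\<kappa>. h \<kappa> ` C \<subseteq> O'}" using X(1,2) by blast
    qed
    then show "openin euclideanreal (h -` V \<inter> topspace euclideanreal)" by (simp add: CO(1) vimage_def)
  next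
    show "h ` topspace euclideanreal \<subseteq> \<Union> {{h. h ` K \<subseteq> U} |K U. compact K \<and> open U}"
      using topspace_compact_open[where 'a = 'm and 'b = 'm] unfolding compact_open_topology_def by auto
  qed
  have "continuous_map euclideanreal HV h"
    unfolding continuous_map_in_subtopology by (intro conjI co funcsetI hv)
  then have "connectedin HV (range h)"
    using connectedin_continuous_map_image[of euclideanreal HV h UNIV] by simp
  moreover have "h 0 = id" using h_0 by (simp add: fun_eq_iff)
  then have "range h \<inter> G \<noteq> {}" using id_G by (metis IntI empty_iff rangeI)
  ultimately show ?thesis using connectedin_subset_G by blast
qed

text \<open>If \<open>\<tau>\<close> is the coboundary of \<open>f\<close>, then \<open>\<phi> + f\<close> has equal increments from a fixed point to \<open>x\<close>
  and to its image under any local twist that fixes this point, for every local primitive \<open>\<phi>\<close> of \<open>\<alpha>\<close>.\<close>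

lemma coboundary_local_primitive:
  assumes n: "CARD('n) \<ge> 2" and \<alpha>: "closed_form A \<alpha>"
    and f: "f \<in> cont_funs" "cocycle_of \<alpha> = coboundary0 G f"
  obtains V where "open V" "p \<in> V" "primitive_on A V \<alpha> (\<lambda>z. - f z)"
proof -
  \<comment> \<open>\<open>mean_displacement_diff\<close> undoes the averaging: the displacement is
    the difference of two values of the coboundary.\<close>
  have disp: "displacement A \<alpha> h x y = (f (h x) - f x) - (f (h y) - f y)" if h: "h \<in> G" for h x y
  proof -
    have "mean_displacement \<alpha> h z = f (h z) - f z" for z
      using fun_cong[OF fun_cong[OF f(2), of h], of z] h by (simp add: cocycle_of_def coboundary0_def)
    then show ?thesis using mean_displacement_diff[OF \<alpha> h, of y x] by simp
  qed
  obtain c r where c: "c \<in> A" "r > 0" "ball (cmap c p) r \<subseteq> cimg c" "p \<in> cinv c ` ball (cmap c p) r"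
    by (rule chart_ball_neighbourhood[OF open_UNIV UNIV_I])
  define U where "U = cinv c ` ball (cmap c p) r"
  have U: "open U" unfolding U_def by (rule chart_ball_open(1)[OF c(1,3)])
  obtain \<phi> where \<phi>: "primitive_on A U \<alpha> \<phi>"
    unfolding U_def by (rule closed_form_primitive_chart_ball[OF \<alpha> c(1,3)])
  obtain k :: "'m \<Rightarrow> real ^ 'n" and W m where W: "open W" "homeomorphism U W k m"
    and vol: "\<And>S. S \<in> sets borel \<Longrightarrow> S \<subseteq> U \<Longrightarrow> emeasure \<mu> S = emeasure lborel (k ` S)"
    unfolding U_def by (rule straight_chart[OF c(1-3)]) blast
  have km: "k (m y) = y" "m y \<in> U" if "y \<in> W" for y
    using W(2) that by (auto simp: homeomorphism_def)
  have mk: "m (k z) = z" "k z \<in> W" if "z \<in> U" for z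
    using W(2) that by (auto simp: homeomorphism_def)
  have pU: "p \<in> U" using c(4) by (simp add: U_def)
  obtain r0 where r0: "r0 > 0" "ball (k p) r0 \<subseteq> W" by (rule openE[OF W(1) mk(2)[OF pU]])
  \<comment> \<open>The midpoint \<open>q\<close> of two points of \<open>B\<close> lies within
    \<open>r0 / 4\<close> of \<open>k p\<close>, so the closed ball of radius \<open>r0 / 2\<close>
    about \<open>q\<close> stays in the ball of radius \<open>r0\<close> inside \<open>W\<close>.
    Both points lie in its interior, as their distance from \<open>q\<close> is less than
    \<open>r0 / 4\<close>.\<close>
  define B where "B = ball (k p) (r0 / 4)"
  have BW: "B \<subseteq> W" unfolding B_def using r0 by (intro order_trans[OF _ r0(2)] subset_ball) simp
  have const: "\<phi> (m w') + f (m w') = \<phi> (m w) + f (m w)" if ww: "w \<in> B" "w' \<in> B" for w w'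
  proof -
    define q where "q = (1/2) *\<^sub>R (w + w')"
    have qB: "q \<in> B"
      using convexD_alt[OF convex_ball ww[unfolded B_def], of "1/2"] by (simp add: q_def B_def scaleR_add_right)
    have "dist w w' \<le> dist w (k p) + dist w' (k p)" by (rule dist_triangle2)
    then have "norm (w' - w) / 2 < r0 / 2"
      using ww r0(1) by (simp add: B_def dist_norm norm_minus_commute)
    then obtain e u \<kappa> where tw: "plane e u" "plane.twist e u q (r0 / 2) \<kappa> w = w'"
      using twist_moves[OF n] q_def by metis
    have sub: "cball q (r0 / 2) \<subseteq> W"
    proof
      fix y assume "y \<in> cball q (r0 / 2)"
      then have "dist (k p) y < r0"
        using dist_triangle[of "k p" y q] qB r0(1) by (simp add: B_def)
      then show "y \<in> W" using r0(2) by auto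
    qed
    define h where "h = (\<lambda>z. if z \<in> U then m (plane.twist e u q (r0 / 2) \<kappa> (k z)) else z)"
    have hG: "h \<in> G"
      unfolding h_def
      by (rule local_twist_in_G[OF W(2) U W(1) vol tw(1) _ sub]) (use r0(1) in auto)
    have wW: "w \<in> W" "w' \<in> W" "q \<in> W" using ww qB BW by auto
    have hw: "h (m w) = m w'" using km[OF wW(1)] tw(2) by (simp add: h_def)
    have hq: "h (m q) = m q" using km[OF wW(3)] plane.twist_centre[OF tw(1)] by (simp add: h_def)
    \<comment> \<open>Since \<open>h\<close> maps \<open>U\<close> into itself, the same primitive
      \<open>\<phi>\<close> evaluates the integrals along a curve in \<open>U\<close> and along its
      image.\<close>
    have hU: "h z \<in> U" if z: "z \<in> U" for z
    proof -
      have "plane.twist e u q (r0 / 2) \<kappa> (k z) \<in> W"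
      proof (cases "k z \<in> ball q (r0 / 2)")
        case True
        then have "plane.twist e u q (r0 / 2) \<kappa> (k z) \<in> ball q (r0 / 2)"
          by (simp only: plane.twist_ball[OF tw(1)])
        then show ?thesis using sub ball_subset_cball by blast
      next
        case False
        then show ?thesis
          using plane.twist_outside[OF tw(1), of "r0 / 2" "k z" q \<kappa>] r0(1) mk(2)[OF z] by simp
      qed
      then show ?thesis using km(2) z by (simp add: h_def)
    qed
    have seg: "path_image (linepath q w) \<subseteq> W"
      using closed_segment_subset[OF _ _ convex_ball, of q "k p" "r0 / 4" w] qB ww(1) BW by (simp add: B_def)
    have mp: "path (m \<circ> linepath q w)"
      by (rule path_continuous_image[OF path_linepath continuous_on_subset[OF homeomorphism_cont2[OF W(2)] seg]])
    have mpU: "path_image (m \<circ> linepath q w) \<subseteq> U" using seg km(2) by (auto simp: path_image_compose)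
    then have hmpU: "h ` path_image (m \<circ> linepath q w) \<subseteq> U" using hU by blast
    \<comment> \<open>The terms at the fixed centre cancel. What remains says that
      \<open>\<phi>\<close> and \<open>- f\<close> have the same increment from \<open>m w\<close>
      to \<open>m w'\<close>.\<close>
    have "displacement A \<alpha> h (m q) (m w) = (\<phi> (h (m w)) - \<phi> (h (m q))) - (\<phi> (m w) - \<phi> (m q))"
      by (rule displacement_local[OF \<alpha> hG mp _ _ U \<phi> mpU U \<phi> hmpU])
        (simp_all add: pathstart_compose pathfinish_compose)
    then show ?thesis using disp[OF hG, of "m q" "m w"] by (simp add: hw hq)
  qed
  define V where "V = U \<inter> k -` B"
  have V: "open V"
    unfolding V_def by (rule continuous_open_preimage[OF homeomorphism_cont1[OF W(2)] U]) (simp add: B_def)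
  have pV: "p \<in> V" using pU r0(1) by (simp add: V_def B_def)
  have eq: "- f z = \<phi> z - (\<phi> p + f p)" if "z \<in> V" for z
    using const[of "k p" "k z"] that pV mk(1) by (simp add: V_def)
  have "primitive_on A V \<alpha> (\<lambda>z. - f z)"
    unfolding primitive_on_def
  proof (intro ballI)
    fix d z assume d: "d \<in> A" and z: "z \<in> V \<inter> cdom d"
    have "(\<phi> \<circ> cinv d has_derivative blinfun_apply (\<alpha> d (cmap d z))) (at (cmap d z))"
      using primitive_onD[OF \<phi> d, of z] z by (simp add: V_def)
    then have "((\<lambda>y. (\<phi> \<circ> cinv d) y - (\<phi> p + f p)) has_derivative blinfun_apply (\<alpha> d (cmap d z))) (at (cmap d z))"
      using has_derivative_diff[OF _ has_derivative_const] by fastforce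
    then show "((\<lambda>z. - f z) \<circ> cinv d has_derivative blinfun_apply (\<alpha> d (cmap d z))) (at (cmap d z))"
    proof (rule has_derivative_transform_within_open)
      show "open (cmap d ` (V \<inter> cdom d))"
        by (rule open_cmap_image[OF d]) (use V open_cdom[OF d] in auto)
      show "cmap d z \<in> cmap d ` (V \<inter> cdom d)" using z by blast
      fix y assume "y \<in> cmap d ` (V \<inter> cdom d)"
      then have "cinv d y \<in> V" using cinv_cmap[OF d] by auto
      then show "(\<phi> \<circ> cinv d) y - (\<phi> p + f p) = ((\<lambda>z. - f z) \<circ> cinv d) y" using eq by simp
    qed
  qed
  with V pV show thesis by (rule that)
qed

text \<open>The one global function \<open>- f\<close> is a primitive near every point, so the local
  statements need no gluing and no periods can arise.\<close>

lemma coboundary_exact: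
  assumes n: "CARD('n) \<ge> 2" and \<alpha>: "closed_form A \<alpha>" and cob: "cocycle_of \<alpha> \<in> coboundaries1 G"
  shows "exact_form A \<alpha>"
proof -
  obtain f where f: "f \<in> cont_funs" "cocycle_of \<alpha> = coboundary0 G f"
    using cob by (auto simp: coboundaries1_def)
  have "primitive_on A UNIV \<alpha> (\<lambda>z. - f z)"
    unfolding primitive_on_def
  proof (intro ballI)
    fix c p assume c: "c \<in> A" and p: "p \<in> UNIV \<inter> cdom c"
    obtain V where V: "open V" "p \<in> V" "primitive_on A V \<alpha> (\<lambda>z. - f z)"
      by (rule coboundary_local_primitive[OF n \<alpha> f])
    show "((\<lambda>z. - f z) \<circ> cinv c has_derivative blinfun_apply (\<alpha> c (cmap c p))) (at (cmap c p))"
      using primitive_onD[OF V(3) c V(2)] p by simp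
  qed
  then show ?thesis unfolding exact_form_iff using closed_form_one_form[OF \<alpha>] by blast
qed

end

theorem proposition4p3:
  fixes A :: "('m::{second_countable_topology, t2_space}, 'n::finite) chart set"
    and \<Omega> :: "('m, 'n) chart \<Rightarrow> real ^ 'n \<Rightarrow> real"
    and g :: "('m, 'n) chart \<Rightarrow> real ^ 'n \<Rightarrow> real ^ 'n ^ 'n"
  assumes "closed_connected_oriented_manifold A"
    and "volume_form A \<Omega>"
    and "emeasure (density_measure A \<Omega>) UNIV = 1"
    and "riemannian_metric A g"
  shows "(\<forall>\<alpha>. closed_form A \<alpha> \<longrightarrow>
            tau_cochain A \<Omega> g \<alpha> \<in> carrier (cocycles1 (Homeo0 A \<Omega>)) \<and>
            group_H1_class (Homeo0 A \<Omega>) (tau_cochain A \<Omega> g \<alpha>)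
              \<in> carrier (group_H1 (Homeo0 A \<Omega>))) \<and>
         (\<exists>\<iota> \<in> hom (deRham_H1 A) (group_H1 (Homeo0 A \<Omega>)).
            (\<forall>\<alpha>. closed_form A \<alpha> \<longrightarrow> \<iota> (deRham_class A \<alpha>) = iota0_class A \<Omega> g \<alpha>) \<and>
            (CARD('n) \<ge> 2 \<longrightarrow> inj_on \<iota> (carrier (deRham_H1 A))))"
proof -
  interpret volume_manifold A \<Omega>
    by unfold_locales (use assms(1-3) in \<open>auto simp: closed_connected_oriented_manifold_def\<close>)
  have tau: "tau_cochain A \<Omega> g \<alpha> \<in> carrier (cocycles1 G) \<and>
      group_H1_class G (tau_cochain A \<Omega> g \<alpha>) \<in> carrier (group_H1 G)" if "closed_form A \<alpha>" for \<alpha>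
    using tau_cochain_carrier[OF that, of g] by (auto simp: group_H1_def group_H1_class_def carrier_FactGroup)
  obtain \<iota> where \<iota>: "\<iota> \<in> hom (deRham_H1 A) (group_H1 G)"
      "\<forall>\<alpha>\<in>carrier (closed_forms A). \<iota> (deRham_class A \<alpha>) = group_H1_class G (cocycle_of \<alpha>)"
      "(\<forall>\<alpha>\<in>carrier (closed_forms A). cocycle_of \<alpha> \<in> coboundaries1 G \<longrightarrow> \<alpha> \<in> exact_forms A) \<longrightarrow>
        inj_on \<iota> (carrier (deRham_H1 A))"
    using induced_hom_Mod[OF comm_group_closed_forms comm_group_cocycles subgroup_exact_forms
        subgroup_coboundaries cocycle_of_hom cocycle_of_exact]
    unfolding deRham_H1_def group_H1_def deRham_class_def group_H1_class_def by blast
  have "\<iota> (deRham_class A \<alpha>) = iota0_class A \<Omega> g \<alpha>" if "closed_form A \<alpha>" for \<alpha>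
    using \<iota>(2) that by (simp add: iota0_class_def cochain_scale_tau[OF assms(4) that] closed_forms_def)
  moreover have "inj_on \<iota> (carrier (deRham_H1 A))" if "CARD('n) \<ge> 2"
    using \<iota>(3) coboundary_exact[OF that] by (simp add: closed_forms_def exact_forms_def)
  ultimately show ?thesis using tau \<iota>(1) by blast
qed

end
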